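(* Let $s\in(0,1)$, $\gamma\in(1,2)$, $T>0$, and assume that $g\in\mathbb{H}^s(\Omega)$, $h\in L^2(\Omega)$ and $f\in H^2(0,T;\mathbb{H}^{-s}(\Omega))$. Then the solution $u$ to $$\partial_t^\gamma u+\mathcal{L}^su=f\ \text{ in }\Omega\times(0,T),\qquad u(0)=g,\quad\partial_tu(0)=h\ \text{ in }\Omega,$$ satisfies $$\|t^{\rho/2}\,\partial_t^3u\|_{L^2(0,T;\mathbb{H}^{-s}(\Omega))}\le C\left(\|g\|_{\mathbb{H}^s(\Omega)}+\|h\|_{L^2(\Omega)}+\|f\|_{H^2(0,T;\mathbb{H}^{-s}(\Omega))}\right),$$ where $\rho>5-2\gamma$. The constant $C$ is independent of $t$ and of the problem data $f,g,h$, but blows up as $\gamma\downarrow1$.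
   Context: $\Omega\subset\mathbb{R}^n$ ($n\ge1$) is open, bounded and convex. $\mathcal{L}w=-\mathrm{div}(A\nabla w)+cw$ with homogeneous Dirichlet boundary conditions, where $0\le c\in L^\infty(\Omega)$ and $A$ is a Lipschitz ($C^{0,1}$), symmetric, uniformly positive definite matrix field on $\Omega$. $\{(\lambda_k,\varphi_k)\}_{k\ge1}\subset\mathbb{R}_+\times H_0^1(\Omega)$ are the eigenpairs of $\mathcal{L}$, with $\{\varphi_k\}$ an orthonormal basis of $L^2(\Omega)$. For $r\ge0$, $\mathbb{H}^r(\Omega)=\{w=\sum_kw_k\varphi_k:\|w\|_{\mathbb{H}^r(\Omega)}^2=\sum_k\lambda_k^r|w_k|^2<\infty\}$; $\mathbb{H}^{-r}(\Omega)$ is its dual, identified with formal series $\sum_kw_k\varphi_k$, $w_k=\langle w,\varphi_k\rangle$, with norm squared $\sum_k\lambda_k^{-r}|w_k|^2$. $\mathcal{L}^sw=\sum_k\lambda_k^sw_k\varphi_k$. $\partial_t^\gamma$ is the left-sided Caputo derivative, $\partial_t^\gamma u(t)=\frac1{\Gamma(2-\gamma)}\int_0^t(t-r)^{1-\gamma}\frac{d^2u(r)}{dr^2}\,dr$. The solution $u$ is the one given by the representation formula $u(\cdot,t)=\sum_{k\ge1}u_k(t)\varphi_k$, where, with $E_{\gamma,\mu}(z)=\sum_{j\ge0}\frac{z^j}{\Gamma(\gamma j+\mu)}$ (Mittag-Leffler function) and $g_k,h_k,f_k(t)$ the coefficients of $g,h,f(\cdot,t)$ with respect to $\varphi_k$,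 $$u_k(t)=E_{\gamma,1}(-\lambda_k^st^\gamma)g_k+tE_{\gamma,2}(-\lambda_k^st^\gamma)h_k+\int_0^t(t-r)^{\gamma-1}E_{\gamma,\gamma}(-\lambda_k^s(t-r)^\gamma)f_k(r)\,dr.$$ *)

theory Defs
  imports "HOL-Analysis.Analysis"
begin

section \<open>The sequence space \<open>\<ell>\<^sup>2\<close>\<close>

text \<open>
  A separable Hilbert space as a type, so that the library's Bochner integral and Borel
  measurability apply to functions with values in it.
\<close>

typedef ell2 = "{x :: nat \<Rightarrow> real. summable (\<lambda>k. (x k)\<^sup>2)}"
  morphisms coord Ell2
  by (rule exI[of _ "\<lambda>_. 0"]) simp

lemma summable_coord: "summable (\<lambda>k. (coord x k)\<^sup>2)"
  using coord[of x] by simp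

lemma coord_Ell2: "summable (\<lambda>k. (x k)\<^sup>2) \<Longrightarrow> coord (Ell2 x) = x"
  by (simp add: Ell2_inverse)

lemma ell2_eqI: "(\<And>k. coord x k = coord y k) \<Longrightarrow> x = y"
  by (metis coord_inject ext)

lemma summable_mult_sq:
  fixes x y :: "nat \<Rightarrow> real"
  assumes "summable (\<lambda>k. (x k)\<^sup>2)" "summable (\<lambda>k. (y k)\<^sup>2)"
  shows "summable (\<lambda>k. x k * y k)"
proof (rule summable_comparison_test'[where N = 0])
  show "summable (\<lambda>k. (x k)\<^sup>2 + (y k)\<^sup>2)"
    by (intro summable_add assms)
  show "norm (x k * y k) \<le> (x k)\<^sup>2 + (y k)\<^sup>2" for k
  proof -
    have "0 \<le> (\<bar>x k\<bar> - \<bar>y k\<bar>)\<^sup>2" "0 \<le> \<bar>x k\<bar> * \<bar>y k\<bar>" by auto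
    then show ?thesis unfolding power2_diff real_norm_def abs_mult power2_abs by linarith
  qed
qed

lemma summable_add_sq:
  fixes x y :: "nat \<Rightarrow> real"
  assumes "summable (\<lambda>k. (x k)\<^sup>2)" "summable (\<lambda>k. (y k)\<^sup>2)"
  shows "summable (\<lambda>k. (x k + y k)\<^sup>2)"
proof -
  have "summable (\<lambda>k. (x k)\<^sup>2 + (y k)\<^sup>2 + 2 * (x k * y k))"
    by (intro summable_add summable_mult summable_mult_sq assms)
  then show ?thesis by (simp add: power2_sum mult.assoc)
qed

lemma summable_scale_sq:
  fixes x :: "nat \<Rightarrow> real"
  assumes "summable (\<lambda>k. (x k)\<^sup>2)"
  shows "summable (\<lambda>k. (r * x k)\<^sup>2)"
  using summable_mult[OF assms, of "r\<^sup>2"] by (simp add: power_mult_distrib)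

instantiation ell2 :: real_inner
begin

definition zero_ell2 where "0 = Ell2 (\<lambda>_. 0)"
definition plus_ell2 where "x + y = Ell2 (\<lambda>k. coord x k + coord y k)"
definition uminus_ell2 where "- x = Ell2 (\<lambda>k. - coord x k)"
definition minus_ell2 where "x - y = x + - (y :: ell2)"
definition scaleR_ell2 where "r *\<^sub>R x = Ell2 (\<lambda>k. r * coord x k)"
definition inner_ell2 where "x \<bullet> y = (\<Sum>k. coord x k * coord y k)"
definition norm_ell2 where "norm x = sqrt (x \<bullet> (x :: ell2))"
definition sgn_ell2 where "sgn x = inverse (norm x) *\<^sub>R (x :: ell2)"
definition dist_ell2 where "dist x y = norm (x - y :: ell2)"
definition [code del]:
  "(uniformity :: (ell2 \<times> ell2) filter) = (INF e\<in>{0<..}. principal {(x, y). dist x y < e})"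
definition [code del]:
  "open (U :: ell2 set) \<longleftrightarrow> (\<forall>x\<in>U. eventually (\<lambda>(x', y). x' = x \<longrightarrow> y \<in> U) uniformity)"

lemma coord_zero: "coord 0 k = 0"
  by (simp add: zero_ell2_def coord_Ell2)

lemma coord_plus: "coord (x + y) k = coord x k + coord y k"
  by (simp add: plus_ell2_def coord_Ell2 summable_add_sq summable_coord)

lemma coord_uminus: "coord (- x) k = - coord x k"
  by (simp add: uminus_ell2_def coord_Ell2 summable_coord)

lemma coord_minus: "coord (x - y) k = coord x k - coord y k"
  by (simp add: minus_ell2_def coord_plus coord_uminus)

lemma coord_scaleR: "coord (r *\<^sub>R x) k = r * coord x k"
  by (simp add: scaleR_ell2_def coord_Ell2 summable_scale_sq summable_coord)

instance
proof
  fix x y z :: ell2 and r q :: real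
  show "x + y + z = x + (y + z)" "x + y = y + x" "0 + x = x" "- x + x = 0" "x - y = x + - y"
    "r *\<^sub>R (x + y) = r *\<^sub>R x + r *\<^sub>R y" "(r + q) *\<^sub>R x = r *\<^sub>R x + q *\<^sub>R x"
    "r *\<^sub>R q *\<^sub>R x = (r * q) *\<^sub>R x" "1 *\<^sub>R x = x"
    by (rule ell2_eqI,
        simp add: coord_zero coord_plus coord_uminus coord_minus coord_scaleR algebra_simps)+
  have s: "summable (\<lambda>k. coord u k * coord v k)" for u v
    by (rule summable_mult_sq) (rule summable_coord)+
  show "x \<bullet> y = y \<bullet> x" by (simp add: inner_ell2_def mult.commute)
  show "(x + y) \<bullet> z = x \<bullet> z + y \<bullet> z"
    by (simp add: inner_ell2_def coord_plus distrib_right suminf_add s)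
  show "(r *\<^sub>R x) \<bullet> y = r * (x \<bullet> y)"
    by (simp add: inner_ell2_def coord_scaleR mult.assoc suminf_mult s)
  show "0 \<le> x \<bullet> x" by (simp add: inner_ell2_def suminf_nonneg s)
  have "coord x k = 0" if "x \<bullet> x = 0" for k
  proof -
    have "(\<Sum>k. coord x k * coord x k) = 0" using that by (simp only: inner_ell2_def)
    then have "coord x k * coord x k = 0"
      using suminf_eq_zero_iff[OF s[of x x]] by (metis zero_le_square)
    then show ?thesis by simp
  qed
  moreover have "0 \<bullet> (0 :: ell2) = 0" by (simp add: inner_ell2_def coord_zero)
  ultimately show "x \<bullet> x = 0 \<longleftrightarrow> x = 0" by (metis coord_zero ell2_eqI)
qed (simp_all add: norm_ell2_def sgn_ell2_def dist_ell2_def uniformity_ell2_def open_ell2_def)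

end

lemma norm_ell2_sq: "(norm x)\<^sup>2 = (\<Sum>k. (coord x k)\<^sup>2)"
proof -
  have "0 \<le> x \<bullet> x" by (rule inner_ge_zero)
  then show ?thesis by (simp add: norm_ell2_def) (simp add: inner_ell2_def power2_eq_square)
qed

lemma sum_coord_le: "(\<Sum>k<K. (coord x k)\<^sup>2) \<le> (norm x)\<^sup>2"
  unfolding norm_ell2_sq by (intro sum_le_suminf summable_coord) auto

lemma abs_coord_le: "\<bar>coord x k\<bar> \<le> norm x"
proof -
  have "(coord x k)\<^sup>2 \<le> (\<Sum>j<Suc k. (coord x j)\<^sup>2)"
    by (intro member_le_sum) auto
  also have "\<dots> \<le> (norm x)\<^sup>2" by (rule sum_coord_le)
  finally show ?thesis using abs_le_square_iff[of "coord x k" "norm x"] by simp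
qed

lemma bounded_linear_coord: "bounded_linear (\<lambda>x. coord x k)"
  by (rule bounded_linear_intro[where K = 1])
    (simp_all add: coord_plus coord_scaleR abs_coord_le)

instance ell2 :: complete_space
proof
  fix X :: "nat \<Rightarrow> ell2" assume X: "Cauchy X"
  have "Cauchy (\<lambda>n. coord (X n) k)" for k
    by (rule bounded_linear.Cauchy[OF bounded_linear_coord X])
  then have "\<forall>k. \<exists>l. (\<lambda>n. coord (X n) k) \<longlonglongrightarrow> l"
    by (simp add: Cauchy_convergent_iff convergent_def)
  then obtain L where L: "\<And>k. (\<lambda>n. coord (X n) k) \<longlonglongrightarrow> L k" by metis
  have ev: "\<exists>N. \<forall>m\<ge>N. \<forall>K. (\<Sum>k<K. (coord (X m) k - L k)\<^sup>2) \<le> e\<^sup>2" if "e > 0" for e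
  proof -
    obtain N where N: "\<And>m n. m \<ge> N \<Longrightarrow> n \<ge> N \<Longrightarrow> dist (X m) (X n) < e"
      using X \<open>e > 0\<close> unfolding Cauchy_def by metis
    have "(\<Sum>k<K. (coord (X m) k - L k)\<^sup>2) \<le> e\<^sup>2" if "m \<ge> N" for m K
    proof (rule tendsto_upperbound)
      show "((\<lambda>n. \<Sum>k<K. (coord (X m) k - coord (X n) k)\<^sup>2) \<longlongrightarrow>
              (\<Sum>k<K. (coord (X m) k - L k)\<^sup>2)) sequentially"
        by (intro tendsto_intros L)
      show "\<forall>\<^sub>F n in sequentially. (\<Sum>k<K. (coord (X m) k - coord (X n) k)\<^sup>2) \<le> e\<^sup>2"
        using eventually_ge_at_top[of N]
      proof eventually_elim
        case (elim n)
        have "(\<Sum>k<K. (coord (X m) k - coord (X n) k)\<^sup>2) \<le> (norm (X m - X n))\<^sup>2"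
          using sum_coord_le[where x = "X m - X n"] by (simp add: coord_minus)
        also have "\<dots> \<le> e\<^sup>2"
          using N[OF \<open>m \<ge> N\<close> elim] by (intro power_mono) (auto simp: dist_norm)
        finally show ?case .
      qed
    qed simp
    then show ?thesis by blast
  qed
  have dsum: "summable (\<lambda>k. (coord (X m) k - L k)\<^sup>2)"
    if "\<forall>K. (\<Sum>k<K. (coord (X m) k - L k)\<^sup>2) \<le> e\<^sup>2" for m and e :: real
    using that by (intro summableI_nonneg_bounded) auto
  obtain M where "\<forall>m\<ge>M. \<forall>K. (\<Sum>k<K. (coord (X m) k - L k)\<^sup>2) \<le> 1\<^sup>2"
    using ev[of 1] by auto
  then have "summable (\<lambda>k. (coord (X M) k - L k)\<^sup>2)" by (intro dsum[of _ 1]) auto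
  then have "summable (\<lambda>k. ((- 1) * (coord (X M) k - L k) + coord (X M) k)\<^sup>2)"
    by (intro summable_add_sq summable_scale_sq summable_coord)
  then have Ls: "summable (\<lambda>k. (L k)\<^sup>2)" by simp
  have "X \<longlonglongrightarrow> Ell2 L"
  proof (rule LIMSEQ_I)
    fix e :: real assume "0 < e"
    then obtain N where N: "\<forall>m\<ge>N. \<forall>K. (\<Sum>k<K. (coord (X m) k - L k)\<^sup>2) \<le> (e / 2)\<^sup>2"
      using ev[of "e / 2"] by auto
    have "norm (X m - Ell2 L) < e" if "m \<ge> N" for m
    proof -
      have b: "\<forall>K. (\<Sum>k<K. (coord (X m) k - L k)\<^sup>2) \<le> (e / 2)\<^sup>2" using N that by blast
      have "(norm (X m - Ell2 L))\<^sup>2 \<le> (e / 2)\<^sup>2"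
        unfolding norm_ell2_sq coord_minus coord_Ell2[OF Ls]
        using b by (intro suminf_le_const dsum[OF b]) auto
      then have "norm (X m - Ell2 L) \<le> e / 2"
        using \<open>0 < e\<close> by (simp add: power_mono_iff)
      then show ?thesis using \<open>0 < e\<close> by simp
    qed
    then show "\<exists>N. \<forall>m\<ge>N. norm (X m - Ell2 L) < e" by blast
  qed
  then show "convergent X" by (auto simp: convergent_def)
qed

instance ell2 :: banach ..

lemma ell2_dense:
  fixes x :: ell2 assumes "0 < e"
  shows "\<exists>qs :: rat list.
    dist x (Ell2 (\<lambda>k. if k < length qs then of_rat (qs ! k) else 0)) < e"
proof -
  obtain N where N: "norm (\<Sum>k. (coord x (k + N))\<^sup>2) < e\<^sup>2 / 2"
    using suminf_exist_split[OF _ summable_coord[of x], of "e\<^sup>2 / 2"] assms by auto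
  define d where "d = e / (2 * (real N + 1))"
  have d: "0 < d" using assms by (simp add: d_def)
  have "\<exists>q :: rat. \<bar>coord x k - of_rat q\<bar> < d" for k
  proof -
    obtain q :: rat where "coord x k < of_rat q" "of_rat q < coord x k + d"
      using of_rat_dense[of "coord x k" "coord x k + d"] d by auto
    then show ?thesis by (intro exI[of _ q]) auto
  qed
  then obtain q :: "nat \<Rightarrow> rat" where q: "\<And>k. \<bar>coord x k - of_rat (q k)\<bar> < d" by metis
  define y :: "nat \<Rightarrow> real" where "y = (\<lambda>k. if k < N then of_rat (q k) else 0)"
  have y: "summable (\<lambda>k. (y k)\<^sup>2)"
    by (rule summable_finite[of "{..<N}"]) (auto simp: y_def)
  have "(norm (x - Ell2 y))\<^sup>2 = (\<Sum>k. (coord x k - y k)\<^sup>2)"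
    by (simp add: norm_ell2_sq coord_minus coord_Ell2[OF y])
  also have "\<dots> = (\<Sum>k. (coord x (k + N) - y (k + N))\<^sup>2) + (\<Sum>k<N. (coord x k - y k)\<^sup>2)"
    using summable_coord[of "x - Ell2 y"]
    by (intro suminf_split_initial_segment) (simp add: coord_minus coord_Ell2[OF y])
  also have "(\<Sum>k. (coord x (k + N) - y (k + N))\<^sup>2) < e\<^sup>2 / 2"
    using N by (simp add: y_def)
  also have "(\<Sum>k<N. (coord x k - y k)\<^sup>2) \<le> (\<Sum>k<N. d\<^sup>2)"
  proof (rule sum_mono)
    fix k assume "k \<in> {..<N}"
    then have "\<bar>coord x k - y k\<bar> \<le> \<bar>d\<bar>" using q[of k] d by (simp add: y_def)
    then show "(coord x k - y k)\<^sup>2 \<le> d\<^sup>2" by (simp add: abs_le_square_iff)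
  qed
  also have "(\<Sum>k<N. d\<^sup>2) \<le> e\<^sup>2 / 2"
  proof -
    have "real N * d\<^sup>2 \<le> (2 * (real N + 1)\<^sup>2) * d\<^sup>2"
      by (intro mult_right_mono) (auto simp: power2_eq_square algebra_simps)
    also have "\<dots> = ((real N + 1) * d)\<^sup>2 * 2" by (simp add: power_mult_distrib)
    also have "(real N + 1) * d = e / 2" by (simp add: d_def field_simps)
    also have "(e / 2)\<^sup>2 * 2 = e\<^sup>2 / 2" by (simp add: power_divide)
    finally show ?thesis by simp
  qed
  finally have "(norm (x - Ell2 y))\<^sup>2 < e\<^sup>2" by simp
  then have "dist x (Ell2 y) < e"
    using assms by (simp add: dist_norm power2_less_imp_less)
  moreover have "y = (\<lambda>k. if k < length (map q [0..<N]) then of_rat (map q [0..<N] ! k) else 0)"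
    by (auto simp: y_def)
  ultimately show ?thesis by metis
qed

instance ell2 :: second_countable_topology
proof
  define D where "D = range (\<lambda>qs :: rat list.
    Ell2 (\<lambda>k. if k < length qs then of_rat (qs ! k) else 0))"
  define B where "B = (\<lambda>(d, n). ball d (1 / Suc n)) ` (D \<times> (UNIV :: nat set))"
  have "countable B" by (auto simp: B_def D_def intro!: countable_image countable_SIGMA)
  moreover have "topological_basis B"
  proof (rule topological_basisI)
    fix U and x :: ell2 assume "open U" "x \<in> U"
    then obtain e where e: "e > 0" "ball x e \<subseteq> U" using open_contains_ball by blast
    obtain n where n: "1 / Suc n < e / 2"
      using nat_approx_posE[of "e / 2"] e by auto
    obtain d where d: "d \<in> D" "dist x d < 1 / Suc n"
      using ell2_dense[of "1 / Suc n" x] by (auto simp: D_def)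
    have "x \<in> ball d (1 / Suc n)" using d by (simp add: dist_commute)
    moreover have "ball d (1 / Suc n) \<subseteq> U"
    proof
      fix z assume "z \<in> ball d (1 / Suc n)"
      then have "dist x z < e" using d n dist_triangle[of x z d] by simp
      then show "z \<in> U" using e by auto
    qed
    ultimately show "\<exists>V\<in>B. x \<in> V \<and> V \<subseteq> U" using d by (auto simp: B_def)
  qed (auto simp: B_def)
  ultimately show "\<exists>B :: ell2 set set. countable B \<and> open = generate_topology B"
    using topological_basis_imp_subbasis by blast
qed


section \<open>Lebesgue and Sobolev spaces\<close>

definition L2 :: "'a measure \<Rightarrow> ('a \<Rightarrow> 'b::{banach, second_countable_topology}) set" where
  "L2 M = {v. v \<in> borel_measurable M \<and> integrable M (\<lambda>x. (norm (v x))\<^sup>2)}"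

definition L2_norm :: "'a measure \<Rightarrow> ('a \<Rightarrow> 'b::{banach, second_countable_topology}) \<Rightarrow> real" where
  "L2_norm M v = sqrt (\<integral>x. (norm (v x))\<^sup>2 \<partial>M)"

primrec Cm :: "nat \<Rightarrow> ('a::euclidean_space \<Rightarrow> real) \<Rightarrow> bool" where
  "Cm 0 f \<longleftrightarrow> continuous_on UNIV f"
| "Cm (Suc m) f \<longleftrightarrow>
     (\<forall>x. f differentiable (at x)) \<and> (\<forall>i\<in>Basis. Cm m (\<lambda>x. frechet_derivative f (at x) i))"

definition test_function :: "'a::euclidean_space set \<Rightarrow> ('a \<Rightarrow> real) \<Rightarrow> bool" where
  "test_function S \<psi> \<longleftrightarrow>
     (\<forall>m. Cm m \<psi>) \<and> compact (closure {x. \<psi> x \<noteq> 0}) \<and> closure {x. \<psi> x \<noteq> 0} \<subseteq> S"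

definition grad :: "('a::euclidean_space \<Rightarrow> real) \<Rightarrow> 'a \<Rightarrow> 'a" where
  "grad \<psi> x = (\<Sum>i\<in>Basis. frechet_derivative \<psi> (at x) i *\<^sub>R i)"

definition has_weak_grad ::
  "'a::euclidean_space set \<Rightarrow> ('a \<Rightarrow> real) \<Rightarrow> ('a \<Rightarrow> 'a) \<Rightarrow> bool" where
  "has_weak_grad \<Omega> w G \<longleftrightarrow>
     (\<forall>\<psi>. test_function \<Omega> \<psi> \<longrightarrow>
        (\<integral>x. w x *\<^sub>R grad \<psi> x \<partial>lebesgue_on \<Omega>) = - (\<integral>x. \<psi> x *\<^sub>R G x \<partial>lebesgue_on \<Omega>))"

text \<open>Weak gradients are unique almost everywhere, so the choice below is immaterial.\<close>

definition weak_grad :: "'a::euclidean_space set \<Rightarrow> ('a \<Rightarrow> real) \<Rightarrow> 'a \<Rightarrow> 'a" where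
  "weak_grad \<Omega> w = (SOME G. G \<in> L2 (lebesgue_on \<Omega>) \<and> has_weak_grad \<Omega> w G)"

text \<open>\<open>H\<^sub>0\<^sup>1(\<Omega>)\<close> is the closure of the test functions in \<open>H\<^sup>1(\<Omega>)\<close>.\<close>

definition H01 :: "'a::euclidean_space set \<Rightarrow> ('a \<Rightarrow> real) set" where
  "H01 \<Omega> = {w \<in> L2 (lebesgue_on \<Omega>).
     (\<exists>G\<in>L2 (lebesgue_on \<Omega>). has_weak_grad \<Omega> w G) \<and>
     (\<exists>\<psi>. (\<forall>m::nat. test_function \<Omega> (\<psi> m)) \<and>
        (\<lambda>m. L2_norm (lebesgue_on \<Omega>) (\<lambda>x. \<psi> m x - w x)) \<longlonglongrightarrow> 0 \<and>
        (\<lambda>m. L2_norm (lebesgue_on \<Omega>) (\<lambda>x. grad (\<psi> m) x - weak_grad \<Omega> w x)) \<longlonglongrightarrow> 0)}"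


section \<open>The elliptic operator and its eigenpairs\<close>

definition energy_form ::
  "(real^'n) set \<Rightarrow> (real^'n \<Rightarrow> real^'n^'n) \<Rightarrow> (real^'n \<Rightarrow> real) \<Rightarrow>
   (real^'n \<Rightarrow> real) \<Rightarrow> (real^'n \<Rightarrow> real) \<Rightarrow> real" where
  "energy_form \<Omega> A c w v =
     (\<integral>x. (A x *v weak_grad \<Omega> w x) \<bullet> weak_grad \<Omega> v x + c x * w x * v x \<partial>lebesgue_on \<Omega>)"

text \<open>
  Weak form of \<open>- div (A \<nabla>w) + c w = \<mu> w\<close> in \<open>\<Omega>\<close> with \<open>w = 0\<close> on the boundary.
\<close>

definition eigenpair ::
  "(real^'n) set \<Rightarrow> (real^'n \<Rightarrow> real^'n^'n) \<Rightarrow> (real^'n \<Rightarrow> real) \<Rightarrow>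
   real \<Rightarrow> (real^'n \<Rightarrow> real) \<Rightarrow> bool" where
  "eigenpair \<Omega> A c \<mu> w \<longleftrightarrow>
     w \<in> H01 \<Omega> \<and> L2_norm (lebesgue_on \<Omega>) w \<noteq> 0 \<and>
     (\<forall>v\<in>H01 \<Omega>. energy_form \<Omega> A c w v = \<mu> * (\<integral>x. w x * v x \<partial>lebesgue_on \<Omega>))"

definition fourier_coeff ::
  "'a::euclidean_space set \<Rightarrow> (nat \<Rightarrow> 'a \<Rightarrow> real) \<Rightarrow> ('a \<Rightarrow> real) \<Rightarrow> nat \<Rightarrow> real" where
  "fourier_coeff \<Omega> \<phi> w k = (\<integral>x. w x * \<phi> k x \<partial>lebesgue_on \<Omega>)"

definition orthonormal_basis ::
  "'a::euclidean_space set \<Rightarrow> (nat \<Rightarrow> 'a \<Rightarrow> real) \<Rightarrow> bool" where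
  "orthonormal_basis \<Omega> \<phi> \<longleftrightarrow>
     (\<forall>k. \<phi> k \<in> L2 (lebesgue_on \<Omega>)) \<and>
     (\<forall>j k. (\<integral>x. \<phi> j x * \<phi> k x \<partial>lebesgue_on \<Omega>) = (if j = k then 1 else 0)) \<and>
     (\<forall>w\<in>L2 (lebesgue_on \<Omega>).
        (\<lambda>N. L2_norm (lebesgue_on \<Omega>) (\<lambda>x. w x - (\<Sum>k<N. fourier_coeff \<Omega> \<phi> w k * \<phi> k x))) \<longlonglongrightarrow> 0)"


section \<open>The scale \<open>\<bbbH>\<^sup>r(\<Omega>)\<close>\<close>

text \<open>
  \<open>HH lam r\<close> is \<open>\<bbbH>\<^sup>r(\<Omega>)\<close> in terms of coefficients with respect to the eigenfunctions, for
  any real \<open>r\<close>; for \<open>r < 0\<close> its elements are formal series.  \<open>HH_fun\<close> is the space of functions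
  on \<open>\<Omega>\<close> for \<open>r \<ge> 0\<close>.  Eigenpairs are numbered from 0.
\<close>

definition HH :: "(nat \<Rightarrow> real) \<Rightarrow> real \<Rightarrow> (nat \<Rightarrow> real) set" where
  "HH lam r = {a. summable (\<lambda>k. lam k powr r * \<bar>a k\<bar>\<^sup>2)}"

definition HH_norm :: "(nat \<Rightarrow> real) \<Rightarrow> real \<Rightarrow> (nat \<Rightarrow> real) \<Rightarrow> real" where
  "HH_norm lam r a = sqrt (\<Sum>k. lam k powr r * \<bar>a k\<bar>\<^sup>2)"

definition HH_fun ::
  "'a::euclidean_space set \<Rightarrow> (nat \<Rightarrow> 'a \<Rightarrow> real) \<Rightarrow> (nat \<Rightarrow> real) \<Rightarrow> real \<Rightarrow> ('a \<Rightarrow> real) set" where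
  "HH_fun \<Omega> \<phi> lam r = {w \<in> L2 (lebesgue_on \<Omega>). fourier_coeff \<Omega> \<phi> w \<in> HH lam r}"

text \<open>
  Restricted to \<open>HH lam r\<close> this is a linear isometry onto \<open>\<ell>\<^sup>2\<close> (when all \<open>lam k > 0\<close>).
  Bochner spaces of \<open>\<bbbH>\<^sup>r(\<Omega>)\<close>-valued functions are taken through it.
\<close>

definition HH_iso :: "(nat \<Rightarrow> real) \<Rightarrow> real \<Rightarrow> (nat \<Rightarrow> real) \<Rightarrow> ell2" where
  "HH_iso lam r a = Ell2 (\<lambda>k. lam k powr (r / 2) * a k)"

lemma norm_HH_iso:
  assumes "a \<in> HH lam r"
  shows "norm (HH_iso lam r a) = HH_norm lam r a"
proof -
  have eq: "(lam k powr (r / 2) * a k)\<^sup>2 = lam k powr r * \<bar>a k\<bar>\<^sup>2" for k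
    by (simp add: power_mult_distrib power2_eq_square flip: powr_add)
  have "(norm (HH_iso lam r a))\<^sup>2 = (\<Sum>k. lam k powr r * \<bar>a k\<bar>\<^sup>2)"
    using assms unfolding HH_iso_def norm_ell2_sq
    by (subst coord_Ell2) (simp_all only: eq HH_def mem_Collect_eq)
  then show ?thesis by (metis HH_norm_def norm_ge_zero real_sqrt_unique)
qed


section \<open>Vector-valued functions of time\<close>

definition has_weak_deriv ::
  "nat \<Rightarrow> real \<Rightarrow> (real \<Rightarrow> 'b) \<Rightarrow> (real \<Rightarrow> 'b::{banach, second_countable_topology}) \<Rightarrow> bool" where
  "has_weak_deriv m T V W \<longleftrightarrow>
     (\<forall>a b. 0 < a \<and> b < T \<longrightarrow>
        set_integrable lebesgue {a..b} V \<and> set_integrable lebesgue {a..b} W) \<and>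
     (\<forall>\<psi>. test_function {0<..<T} \<psi> \<longrightarrow>
        (\<integral>t. (deriv ^^ m) \<psi> t *\<^sub>R V t \<partial>lebesgue_on {0<..<T}) =
        (- 1) ^ m *\<^sub>R (\<integral>t. \<psi> t *\<^sub>R W t \<partial>lebesgue_on {0<..<T}))"

definition weak_deriv ::
  "nat \<Rightarrow> real \<Rightarrow> (real \<Rightarrow> 'b) \<Rightarrow> real \<Rightarrow> 'b::{banach, second_countable_topology}" where
  "weak_deriv m T V = (SOME W. W \<in> L2 (lebesgue_on {0<..<T}) \<and> has_weak_deriv m T V W)"

definition H2 :: "real \<Rightarrow> (real \<Rightarrow> 'b::{banach, second_countable_topology}) set" where
  "H2 T = {V \<in> L2 (lebesgue_on {0<..<T}).
     (\<exists>W\<in>L2 (lebesgue_on {0<..<T}). has_weak_deriv 1 T V W) \<and>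
     (\<exists>W\<in>L2 (lebesgue_on {0<..<T}). has_weak_deriv 2 T V W)}"

definition H2_norm :: "real \<Rightarrow> (real \<Rightarrow> 'b::{banach, second_countable_topology}) \<Rightarrow> real" where
  "H2_norm T V = sqrt ((L2_norm (lebesgue_on {0<..<T}) V)\<^sup>2 +
     (L2_norm (lebesgue_on {0<..<T}) (weak_deriv 1 T V))\<^sup>2 +
     (L2_norm (lebesgue_on {0<..<T}) (weak_deriv 2 T V))\<^sup>2)"

definition HH_valued :: "(nat \<Rightarrow> real) \<Rightarrow> real \<Rightarrow> real \<Rightarrow> (real \<Rightarrow> nat \<Rightarrow> real) \<Rightarrow> bool" where
  "HH_valued lam r T v \<longleftrightarrow> (AE t in lebesgue_on {0<..<T}. v t \<in> HH lam r)"


section \<open>The solution\<close>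

definition mittag_leffler :: "real \<Rightarrow> real \<Rightarrow> real \<Rightarrow> real" where
  "mittag_leffler \<gamma> \<mu> z = (\<Sum>j. z ^ j / Gamma (\<gamma> * real j + \<mu>))"

text \<open>
  The solution of \<open>\<partial>\<^sub>t\<^sup>\<gamma> u + \<L>\<^sup>s u = f\<close>, \<open>u(0) = g\<close>, \<open>\<partial>\<^sub>t u(0) = h\<close> is understood as the formal series
  in the eigenfunctions given by the representation formula, \<open>a\<close> and \<open>b\<close> being the coefficients
  of \<open>g\<close> and \<open>h\<close>.
\<close>

definition solution ::
  "(nat \<Rightarrow> real) \<Rightarrow> real \<Rightarrow> real \<Rightarrow> (nat \<Rightarrow> real) \<Rightarrow> (nat \<Rightarrow> real) \<Rightarrow> (real \<Rightarrow> nat \<Rightarrow> real) \<Rightarrow>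
   real \<Rightarrow> nat \<Rightarrow> real" where
  "solution lam s \<gamma> a b f t k =
     mittag_leffler \<gamma> 1 (- (lam k powr s) * t powr \<gamma>) * a k +
     t * mittag_leffler \<gamma> 2 (- (lam k powr s) * t powr \<gamma>) * b k +
     (\<integral>r. (t - r) powr (\<gamma> - 1) * mittag_leffler \<gamma> \<gamma> (- (lam k powr s) * (t - r) powr \<gamma>) * f r k
        \<partial>lebesgue_on {0<..<t})"

end

theory Submission
  imports Defs "HOL-Complex_Analysis.Cauchy_Integral_Theorem"
begin

text \<open>
  With \<open>m = \<lambda>\<^sub>k\<^sup>s\<close>, the norms of the data and of the solution turn the representation formula into a
  statement about each coefficient separately.  Let \<open>p = sqrt m * g\<^sub>k\<close>, \<open>q = h\<^sub>k\<close>, \<open>F = f\<^sub>k / sqrt m\<close> and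
  \<open>v = u\<^sub>k / sqrt m\<close>; the squares of \<open>p\<close>, \<open>q\<close> and of the \<open>H\<^sup>2\<close> norm of \<open>F\<close> sum to the squares of the norms of
  \<open>g\<close>, \<open>h\<close> and \<open>f\<close>, and those of \<open>v\<close> to the square of the \<open>\<bbbH>\<^sup>-\<^sup>s\<close> norm of \<open>u\<close>.
  Writing
  \<open>e\<^sub>\<mu>(t) = t powr (\<mu> - 1) * E\<^sub>\<gamma>\<^sub>,\<^sub>\<mu>(- m * t powr \<gamma>)\<close> and \<open>*\<close> for convolution,
  \<open>v = (p / m) e\<^sub>1 + (q / sqrt m) e\<^sub>2 + e\<^sub>\<gamma> * F\<close>.
  The theorem is a bound for \<open>v'''\<close> in \<open>L\<^sup>2((0,T), t powr \<rho> dt)\<close> with a constant that does not depend on \<open>m\<close>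
  (\<open>mode_third_derivative\<close>), summed over \<open>k\<close> (\<open>third_derivative_estimate\<close>).

  Three properties of \<open>e\<^sub>\<mu>\<close> give that bound.  Its derivative is \<open>e\<close> with index \<open>\<mu> - 1\<close>
  (\<open>ml_fun_has_derivative\<close>).  When \<open>\<mu>\<close> is \<open>0\<close> or a negative integer, the first term of the series has the
  coefficient \<open>1 / \<Gamma>(\<mu>) = 0\<close>, so that \<open>e\<^sub>\<mu>\<close> is \<open>- m\<close> times \<open>e\<close> with index \<open>\<mu> + \<gamma>\<close> (\<open>ml_fun_shift\<close>).
  And \<open>\<bar>e\<^sub>\<mu>(t)\<bar> \<le> B t powr (\<mu> - 1) / (1 + m t powr \<gamma>)\<close> with \<open>B\<close> depending on \<open>\<gamma>\<close> and \<open>\<mu>\<close> only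
  (\<open>ml_fun_bound\<close>).  The first two show that the third derivatives of \<open>e\<^sub>1\<close> and \<open>e\<^sub>2\<close> are \<open>- m\<close> times \<open>e\<close>
  with the indices \<open>\<gamma> - 2\<close> and \<open>\<gamma> - 1\<close>, which cancels the negative powers of \<open>m\<close> in \<open>v\<close>.  A function \<open>F\<close>
  with two weak derivatives is \<open>a + b t\<close> plus the double primitive of \<open>F''\<close>, and convolving with \<open>e\<close>
  passes the primitives on to \<open>e\<close> (\<open>conv_of_primitive\<close>).  Altogether
  \<open>v''' = (a - p) e\<^sub>\<gamma>\<^sub>-\<^sub>2 + (b - q sqrt m) e\<^sub>\<gamma>\<^sub>-\<^sub>1 + e\<^sub>\<gamma>\<^sub>-\<^sub>1 * F''\<close>.
  The most singular term is of size \<open>t powr (\<gamma> - 3)\<close>, and \<open>t powr (\<rho> + 2 * \<gamma> - 6)\<close> is integrable at \<open>0\<close>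
  for \<open>\<rho> > 5 - 2 * \<gamma>\<close>: this is where the condition on \<open>\<rho>\<close> comes from.  Since \<open>sqrt y \<le> 1 + y\<close>, the term with
  \<open>sqrt m\<close> is of size \<open>t powr (\<gamma> / 2 - 2)\<close>, for which \<open>\<rho> > 3 - \<gamma>\<close> suffices, a weaker condition because
  \<open>\<gamma> < 2\<close>.  The convolution is controlled by Young's inequality; its kernel is bounded by a multiple of
  \<open>t powr (\<gamma> - 2)\<close>, whose integral \<open>T powr (\<gamma> - 1) / (\<gamma> - 1)\<close> is finite because \<open>\<gamma> > 1\<close> and grows
  without bound as \<open>\<gamma>\<close> decreases to \<open>1\<close>.

  The bound on \<open>e\<^sub>\<mu>\<close> amounts to \<open>\<bar>E\<^sub>\<gamma>\<^sub>,\<^sub>\<mu>(- x)\<bar> \<le> B / (1 + x)\<close> for \<open>x \<ge> 0\<close> (\<open>mittag_leffler_bound\<close>).  It is read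
  off from the integral of \<open>exp \<zeta> * \<zeta> powr (\<gamma> - \<mu>) / (\<zeta> powr \<gamma> + x)\<close> along a Hankel contour opening at an
  angle between \<open>\<pi> / 2\<close> and \<open>\<pi> / \<gamma>\<close>: there \<open>exp \<zeta>\<close> decays, and \<open>\<zeta> powr \<gamma>\<close> stays away from the negative
  half-line.  That the integral is \<open>E\<^sub>\<gamma>\<^sub>,\<^sub>\<mu>(- x)\<close> follows by expanding the fraction into a geometric series
  and from Hankel's formula for \<open>1 / \<Gamma>\<close>.

  For \<open>u(t)\<close> itself to lie in \<open>\<bbbH>\<^sup>-\<^sup>s\<close>, the factors \<open>1 / m\<close> in \<open>v\<close> have to be bounded, that is, the
  eigenvalues have to stay away from \<open>0\<close>.  This is Poincare's inequality together with the ellipticity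
  of \<open>A\<close> (\<open>eigenvalue_lower_bound\<close>).
\<close>

section \<open>A Hankel contour for the Mittag-Leffler function\<close>

lemma powr_le_exp_mult:
  fixes q \<delta> \<epsilon> :: real
  assumes "0 < \<delta>" "0 < \<epsilon>"
  obtains C where "0 < C" "\<And>y. \<delta> \<le> y \<Longrightarrow> y powr q \<le> C * exp (\<epsilon> * y)"
proof -
  \<comment> \<open>Passing to an exponent \<open>p > 0\<close> makes \<open>y powr p\<close> monotone, so that \<open>1 + w \<le> exp w\<close> can be raised to
    the power \<open>p\<close>.\<close>
  define p where "p = max q 1"
  define C where "C = (\<epsilon> / p) powr (- p) * \<delta> powr (q - p)"
  have p: "p > 0" "p \<ge> q" by (auto simp: p_def)
  have C: "0 < C" using assms p by (simp add: C_def)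
  have "y powr q \<le> C * exp (\<epsilon> * y)" if "\<delta> \<le> y" for y
  proof -
    have y: "0 < y" using assms that by linarith
    have "y powr q = y powr (q - p) * y powr p" by (simp flip: powr_add)
    also have "\<dots> \<le> \<delta> powr (q - p) * y powr p"
      using p assms that by (intro mult_right_mono powr_mono2') auto
    also have "y powr p = (\<epsilon> / p) powr (- p) * (\<epsilon> / p * y) powr p"
      using y p assms by (subst powr_mult) (auto simp: powr_minus field_simps)
    also have "\<delta> powr (q - p) * ((\<epsilon> / p) powr (- p) * (\<epsilon> / p * y) powr p) = C * (\<epsilon> / p * y) powr p"
      by (simp add: C_def)
    also have "\<dots> \<le> C * exp (\<epsilon> / p * y) powr p"
      using y p assms C by (intro mult_left_mono powr_mono2) (auto intro: order_trans[OF _ exp_ge_add_one_self])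
    also have "exp (\<epsilon> / p * y) powr p = exp (\<epsilon> * y)" using p by (simp add: powr_def)
    finally show ?thesis .
  qed
  then show thesis using C that by blast
qed

lemma LIMSEQ_primitive_halfline:
  fixes F f :: "real \<Rightarrow> complex"
  assumes F: "\<And>r. 0 \<le> r \<Longrightarrow> (F has_vector_derivative f r) (at r within {0..})"
    and f: "integrable (lebesgue_on {0..}) f"
  shows "(\<lambda>n. F (real n) - F 0) \<longlonglongrightarrow> (\<integral>r. f r \<partial>lebesgue_on {0..})"
proof -
  let ?g = "\<lambda>n r. indicator {0..real n} r *\<^sub>R f r"
  have lim: "(\<lambda>n. \<integral>r. ?g n r \<partial>lebesgue_on {0..}) \<longlonglongrightarrow> (\<integral>r. f r \<partial>lebesgue_on {0..})"
  proof (rule integral_dominated_convergence[where w = "\<lambda>r. norm (f r)"])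
    show "?g n \<in> borel_measurable (lebesgue_on {0..})" for n
      using f by (intro borel_measurable_scaleR borel_measurable_indicator)
        (auto simp: sets_restrict_space_iff)
    show "AE r in lebesgue_on {0..}. (\<lambda>n. ?g n r) \<longlonglongrightarrow> f r"
    proof (rule AE_I2)
      fix r :: real assume "r \<in> space (lebesgue_on {0..})"
      then have r: "0 \<le> r" by simp
      have "\<forall>\<^sub>F n in sequentially. r \<le> real n"
        using filterlim_real_sequentially unfolding filterlim_at_top by blast
      then have "\<forall>\<^sub>F n in sequentially. ?g n r = f r" by eventually_elim (use r in auto)
      then show "(\<lambda>n. ?g n r) \<longlonglongrightarrow> f r" by (rule tendsto_eventually)
    qed
  qed (use f in \<open>auto simp: indicator_def\<close>)
  have "(\<integral>r. ?g n r \<partial>lebesgue_on {0..}) = F (real n) - F 0" for n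
  proof -
    have i: "integrable (lebesgue_on {0..}) (?g n)"
      using f by (intro Bochner_Integration.integrable_bound[OF f] borel_measurable_scaleR borel_measurable_indicator)
        (auto simp: sets_restrict_space_iff indicator_def)
    have "(\<integral>r. ?g n r \<partial>lebesgue_on {0..}) = integral {0..} (?g n)"
      by (rule lebesgue_integral_eq_integral[OF i]) auto
    also have "\<dots> = integral {0..} (\<lambda>r. if r \<in> {0..real n} then f r else 0)"
      by (rule integral_cong) (auto simp: indicator_def)
    also have "\<dots> = F (real n) - F 0"
    proof (rule integral_unique)
      have "(f has_integral F (real n) - F 0) {0..real n}"
        by (rule fundamental_theorem_of_calculus)
          (auto intro: has_vector_derivative_within_subset[OF F])
      then show "((\<lambda>r. if r \<in> {0..real n} then f r else 0) has_integral F (real n) - F 0) {0..}"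
        by (subst has_integral_restrict) auto
    qed
    finally show ?thesis .
  qed
  with lim show ?thesis by simp
qed

lemma integral_halfline_eq:
  fixes F f :: "real \<Rightarrow> complex"
  assumes "\<And>r. 0 \<le> r \<Longrightarrow> (F has_vector_derivative f r) (at r within {0..})"
    and "integrable (lebesgue_on {0..}) f" and lim: "(F \<longlongrightarrow> l) at_top"
  shows "(\<integral>r. f r \<partial>lebesgue_on {0..}) = l - F 0"
  using LIMSEQ_primitive_halfline[OF assms(1,2)]
    tendsto_diff[OF filterlim_compose[OF lim filterlim_real_sequentially] tendsto_const]
  by (rule LIMSEQ_unique) auto

lemma integrable_exp_decay:
  assumes "0 < c"
  shows "integrable (lebesgue_on {0..}) (\<lambda>r::real. C * exp (- c * r))"
proof -
  have "(\<lambda>r. exp (- c * r)) absolutely_integrable_on {0..}"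
    by (rule nonnegative_absolutely_integrable_1[OF integrable_on_exp_minus_to_infinity]) (use assms in auto)
  then have "integrable (lebesgue_on {0..}) (\<lambda>r::real. exp (- c * r))"
    by (simp add: absolutely_integrable_on_def set_integrable_def integrable_restrict_space)
  then show ?thesis by simp
qed

lemma convex_strip: "convex {v :: complex. \<bar>Im v\<bar> < b}"
proof -
  have "{v. \<bar>Im v\<bar> < b} = {v. Im v < b} \<inter> {v. Im v > - b}" by auto
  then show ?thesis by (simp add: convex_Int convex_halfspace_Im_lt convex_halfspace_Im_gt)
qed

lemma open_strip: "open {v :: complex. \<bar>Im v\<bar> < b}"
proof -
  have "{v. \<bar>Im v\<bar> < b} = {v. Im v < b} \<inter> {v. Im v > - b}" by auto
  then show ?thesis by (simp add: open_Int open_halfspace_Im_lt open_halfspace_Im_gt)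
qed

lemma exp_add_nonneg_real_nonzero:
  fixes v :: complex
  assumes "\<bar>Im v\<bar> < pi" "0 \<le> x"
  shows "exp v + of_real x \<noteq> 0"
proof
  assume eq: "exp v + of_real x = 0"
  have "x \<noteq> 0" using eq by auto
  with assms have x: "x > 0" by simp
  have "exp v = of_real (- x)" using eq by (simp add: eq_neg_iff_add_eq_0)
  then have "v = Ln (of_real (- x))" using assms Ln_exp[of v] by (simp add: abs_less_iff)
  then have "Im v = pi" using x by (simp add: Ln_minus Im_Ln_eq_pi)
  with assms show False by simp
qed

text \<open>
  The contour consists of the ray from a point \<open>\<sigma> > 0\<close> in the direction \<open>cis \<theta>\<close> and of its mirror image.
  On it \<open>exp \<zeta>\<close> decays because \<open>\<theta> > \<pi> / 2\<close>, and \<open>\<zeta> powr \<gamma>\<close> has argument at most \<open>\<gamma> * \<theta> < \<pi>\<close>, so that it does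
  not meet \<open>- x\<close>.  Such a \<open>\<theta>\<close> exists if and only if \<open>\<gamma> < 2\<close>.
\<close>

locale ml_contour =
  fixes \<gamma> \<theta> :: real
  assumes \<gamma>: "0 < \<gamma>" and \<theta>: "pi / 2 < \<theta>" "\<theta> < pi" "\<gamma> * \<theta> < pi"
begin

text \<open>
  The region between the positive axis and the direction \<open>cis \<theta>\<close>, in which the upper halves of all
  contours run.
\<close>

definition sector :: "complex set" where
  "sector = {\<zeta>. \<zeta> \<noteq> 0 \<and> 0 \<le> Im (Ln \<zeta>) \<and> Im (Ln \<zeta>) \<le> \<theta>}"

definition ray :: "real \<Rightarrow> real \<Rightarrow> complex" where
  "ray \<sigma> r = of_real \<sigma> + of_real r * cis \<theta>"

definition ml_kernel :: "real \<Rightarrow> real \<Rightarrow> complex \<Rightarrow> complex" where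
  "ml_kernel \<mu> x \<zeta> = exp \<zeta> * exp (of_real (\<gamma> - \<mu>) * Ln \<zeta>) / (exp (of_real \<gamma> * Ln \<zeta>) + of_real x)"

text \<open>
  The integral over the whole contour, divided by \<open>2 \<pi> \<i>\<close>.  The integrand takes conjugate values at
  conjugate points, so the lower half contributes minus the conjugate of the upper half, and the sum
  is \<open>2 \<i>\<close> times the imaginary part.
\<close>

definition hankel :: "real \<Rightarrow> real \<Rightarrow> real \<Rightarrow> real" where
  "hankel \<mu> x \<sigma> = Im (\<integral>r. cis \<theta> * ml_kernel \<mu> x (ray \<sigma> r) \<partial>lebesgue_on {0..}) / pi"

lemma sin_\<theta>: "0 < sin \<theta>" and cos_\<theta>: "cos \<theta> < 0"
proof -
  show "0 < sin \<theta>" using \<theta> pi_gt_zero by (intro sin_gt_zero) linarith+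
  show "cos \<theta> < 0" using \<theta> cos_monotone_0_pi[of "pi/2" \<theta>] by simp
qed

lemma cos_half: "0 < cos (\<gamma> * \<theta> / 2)"
proof -
  have "0 < \<gamma> * \<theta>" using \<gamma> \<theta> pi_gt_zero by (intro mult_pos_pos) linarith+
  then show ?thesis using \<theta> by (intro cos_gt_zero_pi) linarith+
qed

lemma norm_exp_Ln: "\<zeta> \<noteq> 0 \<Longrightarrow> norm (exp (of_real a * Ln \<zeta>)) = norm \<zeta> powr a"
  by (simp add: powr_def)

lemma Re_ray: "Re (ray \<sigma> r) = \<sigma> + r * cos \<theta>" and Im_ray: "Im (ray \<sigma> r) = r * sin \<theta>"
  by (simp_all add: ray_def)

lemma norm_ray_ge: "\<bar>\<sigma>\<bar> * sin \<theta> \<le> norm (ray \<sigma> r)"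
proof -
  \<comment> \<open>The distance of the ray from the origin: rotate the ray to a horizontal line.\<close>
  have "Im (ray \<sigma> r * cis (- \<theta>)) = - (\<sigma> * sin \<theta>)" by (simp add: Re_ray Im_ray algebra_simps)
  then have "\<bar>\<sigma>\<bar> * sin \<theta> = \<bar>Im (ray \<sigma> r * cis (- \<theta>))\<bar>" using sin_\<theta> by (simp add: abs_mult)
  also have "\<dots> \<le> norm (ray \<sigma> r * cis (- \<theta>))" by (rule abs_Im_le_cmod)
  finally show ?thesis by (simp add: norm_mult)
qed

lemma norm_ray_le: "0 \<le> \<sigma> \<Longrightarrow> 0 \<le> r \<Longrightarrow> norm (ray \<sigma> r) \<le> \<sigma> + r"
  unfolding ray_def by (rule order_trans[OF norm_triangle_ineq]) (simp add: norm_mult)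

lemma ray_nonzero: assumes "0 \<le> \<sigma>" "0 \<le> r" "0 < \<sigma> + r" shows "ray \<sigma> r \<noteq> 0"
proof (cases "r = 0")
  case True with assms show ?thesis by (simp add: ray_def)
next
  case False
  then have "Im (ray \<sigma> r) \<noteq> 0" using sin_\<theta> by (simp add: Im_ray)
  then show ?thesis by auto
qed

lemma ray_in_sector:
  assumes "0 \<le> \<sigma>" "0 \<le> r" "0 < \<sigma> + r"
  shows "ray \<sigma> r \<in> sector"
proof -
  let ?z = "ray \<sigma> r"
  define a where "a = Im (Ln ?z)"
  have nz: "?z \<noteq> 0" by (rule ray_nonzero[OF assms])
  have z: "?z = of_real (norm ?z) * cis a"
    using nz by (metis Arg_def a_def rcis_cmod_Arg rcis_def)
  have a: "- pi < a" "a \<le> pi" using nz by (auto simp: a_def mpi_less_Im_Ln Im_Ln_le_pi)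
  have "0 \<le> Im ?z" using assms sin_\<theta> by (simp add: Im_ray)
  then have a0: "0 \<le> a" using Im_Ln_pos_le[OF nz] by (simp add: a_def)
  \<comment> \<open>Rotated by \<open>- \<theta>\<close>, the ray lies below the real axis, so the argument is at most \<open>\<theta>\<close>.\<close>
  have "norm ?z * sin (a - \<theta>) = Im (?z * cis (- \<theta>))"
    by (subst (2) z) (simp add: sin_diff algebra_simps)
  also have "\<dots> = - (\<sigma> * sin \<theta>)" by (simp add: Re_ray Im_ray algebra_simps)
  also have "\<dots> \<le> 0" using assms sin_\<theta> by simp
  finally have "sin (a - \<theta>) \<le> 0" using nz by (simp add: mult_le_0_iff)
  moreover have "0 < sin (a - \<theta>)" if "a > \<theta>" using that a \<theta> pi_gt_zero by (intro sin_gt_zero) linarith+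
  ultimately have "a \<le> \<theta>" by fastforce
  with a0 nz show ?thesis by (simp add: sector_def a_def)
qed

lemma real_in_sector: "0 < \<sigma> \<Longrightarrow> of_real \<sigma> \<in> sector"
  using ray_in_sector[of \<sigma> 0] by (simp add: ray_def)

lemma sector_not_nonpos: "\<zeta> \<in> sector \<Longrightarrow> \<zeta> \<notin> \<real>\<^sub>\<le>\<^sub>0"
proof
  assume s: "\<zeta> \<in> sector" and "\<zeta> \<in> \<real>\<^sub>\<le>\<^sub>0"
  then have "\<zeta> \<noteq> 0" "Re \<zeta> \<le> 0" "Im \<zeta> = 0" by (simp_all add: sector_def complex_nonpos_Reals_iff)
  then have "Re \<zeta> < 0" by (simp add: complex_eq_iff)
  then have "Im (Ln \<zeta>) = pi" using \<open>\<zeta> \<noteq> 0\<close> \<open>Im \<zeta> = 0\<close> by (simp add: Im_Ln_eq_pi)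
  with s \<theta> show False by (simp add: sector_def)
qed

text \<open>
  The argument of \<open>\<zeta> powr \<gamma>\<close> lies in \<open>[0, \<gamma> * \<theta>]\<close> and that of \<open>x\<close> is \<open>0\<close>.  Rotating by \<open>- \<gamma> * \<theta> / 2\<close> puts both
  into the sector \<open>\<bar>arg\<bar> \<le> \<gamma> * \<theta> / 2 < \<pi> / 2\<close>, where the real part is at least \<open>cos (\<gamma> * \<theta> / 2)\<close> times
  the modulus; hence the two summands do not cancel.
\<close>

lemma ml_kernel_denominator_ge:
  assumes "\<zeta> \<in> sector" "0 \<le> x"
  shows "cos (\<gamma> * \<theta> / 2) * (norm \<zeta> powr \<gamma> + x) \<le> norm (exp (of_real \<gamma> * Ln \<zeta>) + of_real x)"
proof -
  let ?b = "\<gamma> * \<theta> / 2" and ?a = "\<gamma> * Im (Ln \<zeta>)"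
  have nz: "\<zeta> \<noteq> 0" and a: "0 \<le> ?a" "?a \<le> \<gamma> * \<theta>" using assms \<gamma> by (auto simp: sector_def)
  have w: "exp (of_real \<gamma> * Ln \<zeta>) = of_real (norm \<zeta> powr \<gamma>) * cis ?a"
    using nz by (simp add: exp_eq_polar powr_def)
  have "cos ?b \<le> cos \<bar>?a - ?b\<bar>"
    using a \<theta> pi_gt_zero by (intro cos_monotone_0_pi_le) (auto simp: abs_if)
  then have c: "cos ?b \<le> cos (?a - ?b)" by simp
  have "cos ?b * (norm \<zeta> powr \<gamma> + x) \<le> norm \<zeta> powr \<gamma> * cos (?a - ?b) + x * cos ?b"
    using mult_left_mono[OF c, of "norm \<zeta> powr \<gamma>"] by (simp add: algebra_simps)
  also have "\<dots> = Re ((exp (of_real \<gamma> * Ln \<zeta>) + of_real x) * cis (- ?b))"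
    by (simp add: w cos_diff algebra_simps)
  also have "\<dots> \<le> norm ((exp (of_real \<gamma> * Ln \<zeta>) + of_real x) * cis (- ?b))"
    by (rule complex_Re_le_cmod)
  finally show ?thesis by (simp add: norm_mult)
qed

lemma norm_ml_kernel_le:
  assumes "\<zeta> \<in> sector" "0 \<le> x"
  shows "norm (ml_kernel \<mu> x \<zeta>) \<le>
    exp (Re \<zeta>) * norm \<zeta> powr (\<gamma> - \<mu>) / (cos (\<gamma> * \<theta> / 2) * (norm \<zeta> powr \<gamma> + x))"
proof -
  have nz: "\<zeta> \<noteq> 0" using assms by (simp add: sector_def)
  have "0 < cos (\<gamma> * \<theta> / 2) * (norm \<zeta> powr \<gamma> + x)"
    using cos_half nz assms by (intro mult_pos_pos add_pos_nonneg) auto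
  moreover note ml_kernel_denominator_ge[OF assms]
  moreover have "0 < norm (exp (of_real \<gamma> * Ln \<zeta>) + of_real x) * (cos (\<gamma> * \<theta> / 2) * (norm \<zeta> powr \<gamma> + x))"
    by (rule mult_pos_pos) (use calculation in linarith)+
  ultimately show ?thesis
    unfolding ml_kernel_def norm_divide norm_mult norm_exp_Ln[OF nz] norm_exp_eq_Re[of \<zeta>]
    by (intro divide_left_mono) auto
qed

lemma norm_ml_kernel_le':
  assumes "\<zeta> \<in> sector" "0 \<le> x"
  shows "norm (ml_kernel \<mu> x \<zeta>) \<le> exp (Re \<zeta>) * norm \<zeta> powr (- \<mu>) / cos (\<gamma> * \<theta> / 2)"
proof -
  have nz: "\<zeta> \<noteq> 0" using assms by (simp add: sector_def)
  have "exp (Re \<zeta>) * norm \<zeta> powr (\<gamma> - \<mu>) / (cos (\<gamma> * \<theta> / 2) * (norm \<zeta> powr \<gamma> + x)) \<le>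
     exp (Re \<zeta>) * norm \<zeta> powr (\<gamma> - \<mu>) / (cos (\<gamma> * \<theta> / 2) * norm \<zeta> powr \<gamma>)"
    using cos_half nz assms by (intro divide_left_mono mult_left_mono mult_pos_pos) (auto intro: add_pos_nonneg)
  also have "\<dots> = exp (Re \<zeta>) * norm \<zeta> powr (- \<mu>) / cos (\<gamma> * \<theta> / 2)"
    using nz by (simp add: powr_diff powr_minus field_simps)
  finally show ?thesis using norm_ml_kernel_le[OF assms, of \<mu>] by linarith
qed

text \<open>
  The sector is not convex, so the primitive is taken in the variable \<open>v = Ln \<zeta>\<close>, which ranges over the
  convex strip \<open>\<bar>Im v\<bar> < \<pi> / \<gamma>\<close>.  A single primitive for all rays replaces closed contours: differences
  of its values compare the integrals.
\<close>

lemma ml_kernel_primitive: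
  assumes "0 \<le> x"
  obtains P where "\<And>\<zeta>. \<zeta> \<in> sector \<Longrightarrow> (P has_field_derivative ml_kernel \<mu> x \<zeta>) (at \<zeta>)"
proof -
  let ?S = "{v. \<bar>Im v\<bar> < pi / \<gamma>}"
  let ?q = "\<lambda>v. exp (exp v) * exp (of_real (\<gamma> - \<mu>) * v) * exp v / (exp (of_real \<gamma> * v) + of_real x)"
  have nz: "exp (of_real \<gamma> * v) + of_real x \<noteq> 0" if "v \<in> ?S" for v
  proof (rule exp_add_nonneg_real_nonzero[OF _ assms])
    show "\<bar>Im (of_real \<gamma> * v)\<bar> < pi" using that \<gamma> by (simp add: abs_mult field_simps)
  qed
  have "?q holomorphic_on ?S" by (intro holomorphic_intros nz)
  then obtain Q where Q: "\<And>v. v \<in> ?S \<Longrightarrow> (Q has_field_derivative ?q v) (at v within ?S)"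
    using holomorphic_convex_primitive'[OF convex_strip open_strip] by blast
  have "((\<lambda>\<zeta>. Q (Ln \<zeta>)) has_field_derivative ml_kernel \<mu> x \<zeta>) (at \<zeta>)" if "\<zeta> \<in> sector" for \<zeta>
  proof -
    have nz: "\<zeta> \<noteq> 0" and a: "0 \<le> Im (Ln \<zeta>)" "Im (Ln \<zeta>) \<le> \<theta>" using that by (auto simp: sector_def)
    have "\<theta> < pi / \<gamma>" using \<theta> \<gamma> by (simp add: field_simps)
    with a have "Ln \<zeta> \<in> ?S" by auto
    then have "(Q has_field_derivative ?q (Ln \<zeta>)) (at (Ln \<zeta>))"
      using Q at_within_open[OF _ open_strip] by metis
    then have "((\<lambda>\<zeta>. Q (Ln \<zeta>)) has_field_derivative ?q (Ln \<zeta>) * inverse \<zeta>) (at \<zeta>)"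
      by (rule DERIV_chain2) (rule has_field_derivative_Ln[OF sector_not_nonpos[OF that]])
    then show ?thesis using nz by (simp add: ml_kernel_def field_simps)
  qed
  then show thesis using that by blast
qed

lemma continuous_ml_kernel:
  assumes "0 \<le> x"
  shows "continuous_on sector (ml_kernel \<mu> x)"
proof -
  have nz: "exp (of_real \<gamma> * Ln \<zeta>) + of_real x \<noteq> 0" if "\<zeta> \<in> sector" for \<zeta>
  proof -
    have "0 < cos (\<gamma> * \<theta> / 2) * (norm \<zeta> powr \<gamma> + x)"
      using cos_half that assms by (intro mult_pos_pos add_pos_nonneg) (auto simp: sector_def)
    then show ?thesis using ml_kernel_denominator_ge[OF that assms] by auto
  qed
  show ?thesis unfolding ml_kernel_def
    by (intro continuous_intros) (use nz sector_not_nonpos in blast)+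
qed

text \<open>
  Half of the decay rate \<open>- cos \<theta>\<close> of \<open>exp \<zeta>\<close> absorbs the power of \<open>\<zeta>\<close>; the bound is uniform for
  rays with \<open>\<sigma>\<close> in a compact interval, as needed for moving the contour.
\<close>

lemma ml_kernel_ray_decay:
  assumes "0 < \<sigma>\<^sub>1" "0 \<le> x"
  obtains C where "0 < C" "\<And>\<sigma> r. \<sigma>\<^sub>1 \<le> \<sigma> \<Longrightarrow> \<sigma> \<le> \<sigma>\<^sub>2 \<Longrightarrow> 0 \<le> r \<Longrightarrow>
    norm (ml_kernel \<mu> x (ray \<sigma> r)) \<le> C * exp (- (- cos \<theta> / 2) * r)"
proof -
  let ?\<epsilon> = "- cos \<theta> / 2"
  obtain C where C: "0 < C" "\<And>y. \<sigma>\<^sub>1 * sin \<theta> \<le> y \<Longrightarrow> y powr (- \<mu>) \<le> C * exp (?\<epsilon> * y)"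
    using powr_le_exp_mult[of "\<sigma>\<^sub>1 * sin \<theta>" ?\<epsilon> "- \<mu>"] assms sin_\<theta> cos_\<theta> by auto
  show thesis
  proof (rule that)
    show "0 < C / cos (\<gamma> * \<theta> / 2) * exp (2 * \<sigma>\<^sub>2)" using C cos_half by simp
    fix \<sigma> r :: real assume \<sigma>: "\<sigma>\<^sub>1 \<le> \<sigma>" "\<sigma> \<le> \<sigma>\<^sub>2" and r: "0 \<le> r"
    have s: "ray \<sigma> r \<in> sector" using assms \<sigma> r by (intro ray_in_sector) auto
    have "\<sigma>\<^sub>1 * sin \<theta> \<le> \<bar>\<sigma>\<bar> * sin \<theta>" using \<sigma> assms sin_\<theta> by (intro mult_right_mono) auto
    also have "\<dots> \<le> norm (ray \<sigma> r)" by (rule norm_ray_ge)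
    finally have *: "norm (ray \<sigma> r) powr (- \<mu>) \<le> C * exp (?\<epsilon> * norm (ray \<sigma> r))" by (rule C)
    have "?\<epsilon> * norm (ray \<sigma> r) \<le> ?\<epsilon> * (\<sigma> + r)"
      using cos_\<theta> \<sigma> r assms by (intro mult_left_mono norm_ray_le) auto
    then have e: "Re (ray \<sigma> r) + ?\<epsilon> * norm (ray \<sigma> r) \<le> 2 * \<sigma>\<^sub>2 + cos \<theta> / 2 * r"
    proof -
      have "?\<epsilon> * \<sigma> \<le> 1 * \<sigma>"
      proof (rule mult_right_mono)
        show "?\<epsilon> \<le> 1" using cos_ge_minus_one[of \<theta>] by linarith
      qed (use assms \<sigma> in linarith)
      with \<open>?\<epsilon> * norm (ray \<sigma> r) \<le> ?\<epsilon> * (\<sigma> + r)\<close> \<sigma> show ?thesis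
        unfolding Re_ray by (simp add: algebra_simps)
    qed
    have "norm (ml_kernel \<mu> x (ray \<sigma> r)) \<le>
        exp (Re (ray \<sigma> r)) * norm (ray \<sigma> r) powr (- \<mu>) / cos (\<gamma> * \<theta> / 2)"
      by (rule norm_ml_kernel_le'[OF s assms(2)])
    also have "\<dots> \<le> exp (Re (ray \<sigma> r)) * (C * exp (?\<epsilon> * norm (ray \<sigma> r))) / cos (\<gamma> * \<theta> / 2)"
      using * cos_half by (intro divide_right_mono mult_left_mono) auto
    also have "\<dots> = C / cos (\<gamma> * \<theta> / 2) * exp (Re (ray \<sigma> r) + ?\<epsilon> * norm (ray \<sigma> r))"
      by (simp only: exp_add) (simp add: mult_ac)
    also have "\<dots> \<le> C / cos (\<gamma> * \<theta> / 2) * exp (2 * \<sigma>\<^sub>2 + cos \<theta> / 2 * r)"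
      using e C cos_half by (intro mult_left_mono) auto
    finally show "norm (ml_kernel \<mu> x (ray \<sigma> r)) \<le> C / cos (\<gamma> * \<theta> / 2) * exp (2 * \<sigma>\<^sub>2) * exp (- ?\<epsilon> * r)"
      by (simp add: exp_add)
  qed
qed

lemma continuous_on_ml_kernel_ray: "0 < \<sigma> \<Longrightarrow> 0 \<le> x \<Longrightarrow> continuous_on {0..} (\<lambda>r. ml_kernel \<mu> x (ray \<sigma> r))"
proof -
  assume a: "0 < \<sigma>" "0 \<le> x"
  have 1: "continuous_on {0..} (\<lambda>r. ray \<sigma> r)" unfolding ray_def by (intro continuous_intros)
  have 2: "(\<lambda>r. ray \<sigma> r) ` {0..} \<subseteq> sector"
  proof (rule image_subsetI)
    fix r :: real assume "r \<in> {0..}"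
    with a show "ray \<sigma> r \<in> sector" by (intro ray_in_sector) simp_all
  qed
  show "continuous_on {0..} (\<lambda>r. ml_kernel \<mu> x (ray \<sigma> r))"
    by (rule continuous_on_compose2[OF continuous_ml_kernel[OF a(2)] 1 2])
qed

lemma integrable_ml_kernel_ray:
  assumes "0 < \<sigma>" "0 \<le> x"
  shows "integrable (lebesgue_on {0..}) (\<lambda>r. cis \<theta> * ml_kernel \<mu> x (ray \<sigma> r))"
proof -
  obtain C where C: "0 < C" "\<And>s r. \<sigma> \<le> s \<Longrightarrow> s \<le> \<sigma> \<Longrightarrow> 0 \<le> r \<Longrightarrow>
    norm (ml_kernel \<mu> x (ray s r)) \<le> C * exp (- (- cos \<theta> / 2) * r)"
    using ml_kernel_ray_decay[OF assms, where \<sigma>\<^sub>2 = \<sigma> and \<mu> = \<mu>] by metis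
  show ?thesis
  proof (rule Bochner_Integration.integrable_bound)
    show "integrable (lebesgue_on {0..}) (\<lambda>r. C * exp (- (- cos \<theta> / 2) * r))"
      by (rule integrable_exp_decay) (use cos_\<theta> in simp)
    show "(\<lambda>r. cis \<theta> * ml_kernel \<mu> x (ray \<sigma> r)) \<in> borel_measurable (lebesgue_on {0..})"
      by (intro continuous_imp_measurable_on_sets_lebesgue continuous_intros continuous_on_ml_kernel_ray assms) auto
    show "AE r in lebesgue_on {0..}. norm (cis \<theta> * ml_kernel \<mu> x (ray \<sigma> r)) \<le> norm (C * exp (- (- cos \<theta> / 2) * r))"
    proof (rule AE_I2)
      fix r :: real assume "r \<in> space (lebesgue_on {0..})"
      then show "norm (cis \<theta> * ml_kernel \<mu> x (ray \<sigma> r)) \<le> norm (C * exp (- (- cos \<theta> / 2) * r))"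
        using C(2)[of \<sigma> r] C(1) by (simp add: norm_mult)
    qed
  qed
qed

lemma ray_has_vector_derivative:
  assumes "\<And>\<zeta>. \<zeta> \<in> sector \<Longrightarrow> (P has_field_derivative p \<zeta>) (at \<zeta>)" "0 < \<sigma>" "0 \<le> r"
  shows "((\<lambda>r. P (ray \<sigma> r)) has_vector_derivative cis \<theta> * p (ray \<sigma> r)) (at r within A)"
proof -
  have 1: "((\<lambda>r. ray \<sigma> r) has_vector_derivative cis \<theta>) (at r within A)"
    unfolding ray_def by (auto intro!: derivative_eq_intros simp: scaleR_conv_of_real)
  have "ray \<sigma> r \<in> sector" using assms by (intro ray_in_sector) auto
  from field_vector_diff_chain_within[OF 1 has_field_derivative_at_within[OF assms(1)[OF this]]]
  show ?thesis by (simp add: o_def)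
qed

end

lemma (in ml_contour) ml_kernel_of_real:
  assumes "0 < t"
  shows "ml_kernel \<mu> x (of_real t) = of_real (exp t * exp ((\<gamma> - \<mu>) * ln t) / (exp (\<gamma> * ln t) + x))"
  using assms by (simp add: ml_kernel_def Ln_of_real exp_of_real flip: of_real_mult of_real_diff of_real_add)

text \<open>
  The kernels are real on the positive axis, so moving the starting point of a ray along it changes
  the integral by a real number, which \<open>hankel\<close> does not see.
\<close>

lemma Im_primitive_const:
  assumes P: "\<And>t. 0 < t \<Longrightarrow> (P has_field_derivative p (of_real t)) (at (of_real t :: complex))"
    and p: "\<And>t. 0 < t \<Longrightarrow> Im (p (of_real t)) = 0" and "0 < a" "0 < b"
  shows "Im (P (of_real a)) = Im (P (of_real b))"
proof (rule has_derivative_zero_unique_connected[of "{0<..}" "\<lambda>t. Im (P (of_real t))"])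
  fix t :: real assume "t \<in> {0<..}"
  then have t: "0 < t" by simp
  have "((\<lambda>t. of_real t :: complex) has_vector_derivative 1) (at t)"
    by (auto intro!: derivative_eq_intros simp: has_vector_derivative_def scaleR_conv_of_real)
  from field_vector_diff_chain_at[OF this P[OF t]]
  have "((\<lambda>t. P (of_real t)) has_vector_derivative p (of_real t)) (at t)" by (simp add: o_def)
  from bounded_linear.has_vector_derivative[OF bounded_linear_Im this]
  show "((\<lambda>t. Im (P (of_real t))) has_derivative (\<lambda>h. 0)) (at t)"
    using p[OF t] by (simp add: has_vector_derivative_def)
qed (use assms in auto)

context ml_contour
begin

lemma ml_kernel_0: "ml_kernel \<nu> 0 \<zeta> = exp \<zeta> * exp (- (of_real \<nu> * Ln \<zeta>))"
  by (simp add: ml_kernel_def left_diff_distrib exp_diff exp_minus field_simps)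

lemma norm_ml_kernel_0:
  assumes "\<zeta> \<noteq> 0"
  shows "norm (ml_kernel \<nu> 0 \<zeta>) = exp (Re \<zeta>) * norm \<zeta> powr (- \<nu>)"
  using norm_exp_Ln[OF assms, of "- \<nu>"] by (simp add: ml_kernel_0 norm_mult)

text \<open>
  The integrals over two parallel rays differ by the integrals over the two segments that join them:
  the one at the far end tends to \<open>0\<close>, and the one on the positive axis is real.
\<close>

lemma hankel_shift:
  assumes "0 < \<sigma>\<^sub>1" "\<sigma>\<^sub>1 \<le> \<sigma>\<^sub>2" "0 \<le> x"
  shows "hankel \<mu> x \<sigma>\<^sub>1 = hankel \<mu> x \<sigma>\<^sub>2"
proof -
  obtain P where P: "\<And>\<zeta>. \<zeta> \<in> sector \<Longrightarrow> (P has_field_derivative ml_kernel \<mu> x \<zeta>) (at \<zeta>)"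
    using ml_kernel_primitive[OF assms(3)] by metis
  obtain C where C: "0 < C" "\<And>\<sigma> r. \<sigma>\<^sub>1 \<le> \<sigma> \<Longrightarrow> \<sigma> \<le> \<sigma>\<^sub>2 \<Longrightarrow> 0 \<le> r \<Longrightarrow>
    norm (ml_kernel \<mu> x (ray \<sigma> r)) \<le> C * exp (- (- cos \<theta> / 2) * r)"
    using ml_kernel_ray_decay[OF assms(1,3), where \<sigma>\<^sub>2 = \<sigma>\<^sub>2 and \<mu> = \<mu>] by metis
  have \<sigma>: "0 < \<sigma>\<^sub>2" using assms by linarith
  let ?D = "\<lambda>r. P (ray \<sigma>\<^sub>1 r) - P (ray \<sigma>\<^sub>2 r)"
  let ?k = "\<lambda>\<sigma> r. cis \<theta> * ml_kernel \<mu> x (ray \<sigma> r)"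
  have int: "integrable (lebesgue_on {0..}) (?k \<sigma>\<^sub>1)" "integrable (lebesgue_on {0..}) (?k \<sigma>\<^sub>2)"
    using assms \<sigma> by (auto intro: integrable_ml_kernel_ray)
  have D: "norm (?D r) \<le> C * (\<sigma>\<^sub>2 - \<sigma>\<^sub>1) * exp (cos \<theta> / 2 * r)" if r: "0 \<le> r" for r
  proof -
    let ?S = "closed_segment (ray \<sigma>\<^sub>1 r) (ray \<sigma>\<^sub>2 r)"
    have S: "\<exists>\<sigma>. \<zeta> = ray \<sigma> r \<and> \<sigma>\<^sub>1 \<le> \<sigma> \<and> \<sigma> \<le> \<sigma>\<^sub>2" if "\<zeta> \<in> ?S" for \<zeta>
    proof -
      from that obtain u where u: "0 \<le> u" "u \<le> 1" "\<zeta> = (1 - u) *\<^sub>R ray \<sigma>\<^sub>1 r + u *\<^sub>R ray \<sigma>\<^sub>2 r"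
        by (auto simp: in_segment)
      let ?s = "\<sigma>\<^sub>1 + u * (\<sigma>\<^sub>2 - \<sigma>\<^sub>1)"
      have "\<zeta> = ray ?s r" unfolding u ray_def by (simp add: scaleR_conv_of_real algebra_simps)
      moreover have "u * (\<sigma>\<^sub>2 - \<sigma>\<^sub>1) \<le> 1 * (\<sigma>\<^sub>2 - \<sigma>\<^sub>1)" using u assms by (intro mult_right_mono) auto
      moreover have "0 \<le> u * (\<sigma>\<^sub>2 - \<sigma>\<^sub>1)" using u assms by auto
      ultimately show ?thesis by (intro exI[of _ ?s]) auto
    qed
    have "norm (?D r) \<le> C * exp (- (- cos \<theta> / 2) * r) * norm (ray \<sigma>\<^sub>1 r - ray \<sigma>\<^sub>2 r)"
    proof (rule field_differentiable_bound[of ?S])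
      fix \<zeta> assume "\<zeta> \<in> ?S"
      then obtain \<sigma> where \<sigma>: "\<zeta> = ray \<sigma> r" "\<sigma>\<^sub>1 \<le> \<sigma>" "\<sigma> \<le> \<sigma>\<^sub>2" using S by blast
      then show "(P has_field_derivative ml_kernel \<mu> x \<zeta>) (at \<zeta> within ?S)"
        using assms r by (intro has_field_derivative_at_within[OF P]) (auto intro: ray_in_sector)
      show "norm (ml_kernel \<mu> x \<zeta>) \<le> C * exp (- (- cos \<theta> / 2) * r)"
        using C(2)[OF \<sigma>(2,3) r] \<sigma> by simp
    qed auto
    also have "ray \<sigma>\<^sub>1 r - ray \<sigma>\<^sub>2 r = of_real (\<sigma>\<^sub>1 - \<sigma>\<^sub>2)" by (simp add: ray_def)
    also have "norm (of_real (\<sigma>\<^sub>1 - \<sigma>\<^sub>2) :: complex) = \<sigma>\<^sub>2 - \<sigma>\<^sub>1" unfolding norm_of_real using assms by simp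
    finally show ?thesis by (simp add: mult_ac)
  qed
  have lim: "(?D \<longlongrightarrow> 0) at_top"
  proof (rule Lim_null_comparison)
    show "\<forall>\<^sub>F r in at_top. norm (?D r) \<le> C * (\<sigma>\<^sub>2 - \<sigma>\<^sub>1) * exp (cos \<theta> / 2 * r)"
      using eventually_ge_at_top[of 0] by eventually_elim (rule D)
    have "((\<lambda>r. exp (cos \<theta> / 2 * r)) \<longlongrightarrow> 0) at_top"
      using cos_\<theta> by (intro filterlim_compose[OF exp_at_bot] filterlim_tendsto_neg_mult_at_bot[OF tendsto_const]
        filterlim_ident) auto
    from tendsto_mult_right_zero[OF this]
    show "((\<lambda>r. C * (\<sigma>\<^sub>2 - \<sigma>\<^sub>1) * exp (cos \<theta> / 2 * r)) \<longlongrightarrow> 0) at_top" by blast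
  qed
  have "(\<integral>r. ?k \<sigma>\<^sub>1 r - ?k \<sigma>\<^sub>2 r \<partial>lebesgue_on {0..}) = 0 - ?D 0"
    using lim by (intro integral_halfline_eq has_vector_derivative_diff Bochner_Integration.integrable_diff int
      ray_has_vector_derivative[OF P] assms \<sigma>) auto
  also have "Im (0 - ?D 0) = 0"
    using Im_primitive_const[of P "ml_kernel \<mu> x" \<sigma>\<^sub>1 \<sigma>\<^sub>2] P[OF real_in_sector] assms \<sigma>
    by (simp add: ray_def ml_kernel_of_real)
  finally have "Im (integral\<^sup>L (lebesgue_on {0..}) (?k \<sigma>\<^sub>1)) = Im (integral\<^sup>L (lebesgue_on {0..}) (?k \<sigma>\<^sub>2))"
    using int by simp
  then show ?thesis by (simp add: hankel_def)
qed

text \<open>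
  Integration by parts for \<open>x = 0\<close>: the derivative of \<open>exp \<zeta> * \<zeta> powr - \<mu>\<close> is the kernel for \<open>\<mu>\<close> minus \<open>\<mu>\<close> times
  the kernel for \<open>\<mu> + 1\<close>.  This is the functional equation of \<open>1 / \<Gamma>\<close>.
\<close>

lemma hankel_recursion:
  assumes "0 < \<sigma>"
  shows "hankel \<mu> 0 \<sigma> = \<mu> * hankel (\<mu> + 1) 0 \<sigma>"
proof -
  let ?P = "\<lambda>\<zeta>. exp \<zeta> * exp (- of_real \<mu> * Ln \<zeta>)"
  let ?p = "\<lambda>\<zeta>. ml_kernel \<mu> 0 \<zeta> - of_real \<mu> * ml_kernel (\<mu> + 1) 0 \<zeta>"
  let ?k = "\<lambda>\<mu> r. cis \<theta> * ml_kernel \<mu> 0 (ray \<sigma> r)"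
  have k0: "ml_kernel \<nu> 0 \<zeta> = exp \<zeta> * exp (- of_real \<nu> * Ln \<zeta>)" for \<nu> \<zeta>
    by (simp add: ml_kernel_0)
  have P: "(?P has_field_derivative ?p \<zeta>) (at \<zeta>)" if "\<zeta> \<in> sector" for \<zeta>
  proof -
    have [simp]: "\<zeta> \<noteq> 0" using that by (simp add: sector_def)
    have "exp (- (of_real (\<mu> + 1) * Ln \<zeta>)) = exp (- (of_real \<mu> * Ln \<zeta>) - Ln \<zeta>)"
      by (rule arg_cong[where f = exp]) (simp add: algebra_simps)
    then have k1: "ml_kernel (\<mu> + 1) 0 \<zeta> = exp \<zeta> * (exp (- of_real \<mu> * Ln \<zeta>) * inverse \<zeta>)"
      by (simp add: ml_kernel_0 exp_diff divide_inverse)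
    show ?thesis unfolding k1 k0[of \<mu>]
      by (rule derivative_eq_intros refl sector_not_nonpos[OF that])+ (simp add: algebra_simps)
  qed
  have int: "integrable (lebesgue_on {0..}) (?k \<mu>)" "integrable (lebesgue_on {0..}) (?k (\<mu> + 1))"
    using assms by (auto intro: integrable_ml_kernel_ray)
  obtain C where C: "0 < C" "\<And>s r. \<sigma> \<le> s \<Longrightarrow> s \<le> \<sigma> \<Longrightarrow> 0 \<le> r \<Longrightarrow>
    norm (ml_kernel \<mu> 0 (ray s r)) \<le> C * exp (- (- cos \<theta> / 2) * r)"
    using ml_kernel_ray_decay[OF assms order.refl, where \<sigma>\<^sub>2 = \<sigma> and \<mu> = \<mu>] by metis
  have lim: "((\<lambda>r. ?P (ray \<sigma> r)) \<longlongrightarrow> 0) at_top"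
  proof (rule Lim_null_comparison)
    show "\<forall>\<^sub>F r in at_top. norm (?P (ray \<sigma> r)) \<le> C * exp (cos \<theta> / 2 * r)"
      using eventually_ge_at_top[of 0] by eventually_elim (use C(2)[of \<sigma>] in \<open>simp add: k0\<close>)
    have "((\<lambda>r. exp (cos \<theta> / 2 * r)) \<longlongrightarrow> 0) at_top"
      using cos_\<theta> by (intro filterlim_compose[OF exp_at_bot] filterlim_tendsto_neg_mult_at_bot[OF tendsto_const]
        filterlim_ident) auto
    from tendsto_mult_right_zero[OF this]
    show "((\<lambda>r. C * exp (cos \<theta> / 2 * r)) \<longlongrightarrow> 0) at_top" by blast
  qed
  have "(\<integral>r. ?k \<mu> r - of_real \<mu> * ?k (\<mu> + 1) r \<partial>lebesgue_on {0..}) = (\<integral>r. cis \<theta> * ?p (ray \<sigma> r) \<partial>lebesgue_on {0..})"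
    by (simp add: algebra_simps)
  also have "\<dots> = 0 - ?P (ray \<sigma> 0)"
  proof (rule integral_halfline_eq[OF _ _ lim])
    show "((\<lambda>r. ?P (ray \<sigma> r)) has_vector_derivative cis \<theta> * ?p (ray \<sigma> r)) (at r within {0..})"
      if "0 \<le> r" for r by (rule ray_has_vector_derivative[OF P assms that])
    show "integrable (lebesgue_on {0..}) (\<lambda>r. cis \<theta> * ?p (ray \<sigma> r))"
      using Bochner_Integration.integrable_diff[OF int(1) integrable_mult_right[OF int(2), of "of_real \<mu>"]]
      by (simp add: algebra_simps)
  qed
  also have "?P (ray \<sigma> 0) = ml_kernel \<mu> 0 (of_real \<sigma>)" by (simp add: k0 ray_def)
  also have "Im (0 - ml_kernel \<mu> 0 (of_real \<sigma>)) = 0" by (simp add: ml_kernel_of_real[OF assms])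
  finally have "Im (integral\<^sup>L (lebesgue_on {0..}) (?k \<mu>)) = \<mu> * Im (integral\<^sup>L (lebesgue_on {0..}) (?k (\<mu> + 1)))"
    using int by simp
  then show ?thesis by (simp add: hankel_def)
qed

text \<open>
  For \<open>\<sigma> = 1\<close> the contour keeps the distance \<open>sin \<theta>\<close> from the origin.  So the denominator is at least a
  constant times \<open>1 + x\<close>, and what remains of the integrand is integrable and free of \<open>x\<close>.
\<close>

lemma hankel_bound:
  obtains B where "0 < B" "\<And>x. 0 \<le> x \<Longrightarrow> \<bar>hankel \<mu> x 1\<bar> \<le> B / (1 + x)"
proof -
  define s where "s = sin \<theta> powr \<gamma>"
  define \<kappa> where "\<kappa> = cos (\<gamma> * \<theta> / 2)"
  define N where "N = (\<integral>r. norm (ml_kernel (\<mu> - \<gamma>) 0 (ray 1 r)) \<partial>lebesgue_on {0..})"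
  have s: "0 < s" "s \<le> 1" using sin_\<theta> \<gamma> sin_le_one[of \<theta>] by (auto simp: s_def powr_le1)
  have \<kappa>: "0 < \<kappa>" using cos_half by (simp add: \<kappa>_def)
  have N: "0 \<le> N" by (simp add: N_def)
  have i: "integrable (lebesgue_on {0..}) (\<lambda>r. ml_kernel \<nu> x (ray 1 r))" if "0 \<le> x" for \<nu> x
    using integrable_mult_right[OF integrable_ml_kernel_ray[of 1 x \<nu>], of "cis (- \<theta>)"] that
    by (simp add: mult.assoc[symmetric] cis_mult)
  show thesis
  proof (rule that)
    show "0 < (N + 1) / (\<kappa> * s * pi)" using N s \<kappa> by simp
    fix x :: real assume x: "0 \<le> x"
    have b: "norm (cis \<theta> * ml_kernel \<mu> x (ray 1 r)) \<le> norm (ml_kernel (\<mu> - \<gamma>) 0 (ray 1 r)) / (\<kappa> * s * (1 + x))"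
      if "0 \<le> r" for r
    proof -
      let ?z = "ray 1 r"
      have z: "?z \<in> sector" using that by (intro ray_in_sector) auto
      then have nz: "?z \<noteq> 0" by (simp add: sector_def)
      have "sin \<theta> \<le> norm ?z" using norm_ray_ge[of 1 r] by simp
      then have "s \<le> norm ?z powr \<gamma>" unfolding s_def using \<gamma> sin_\<theta> by (intro powr_mono2) auto
      moreover have "s * x \<le> x" using s x by (simp add: mult_left_le_one_le)
      ultimately have "s * (1 + x) \<le> norm ?z powr \<gamma> + x" by (simp add: algebra_simps)
      then have le: "\<kappa> * s * (1 + x) \<le> \<kappa> * (norm ?z powr \<gamma> + x)" using \<kappa> by simp
      have "norm (ml_kernel (\<mu> - \<gamma>) 0 ?z) = exp (Re ?z) * norm ?z powr (\<gamma> - \<mu>)"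
        using norm_ml_kernel_0[OF nz, of "\<mu> - \<gamma>"] by simp
      then have "norm (ml_kernel \<mu> x ?z) \<le> norm (ml_kernel (\<mu> - \<gamma>) 0 ?z) / (\<kappa> * (norm ?z powr \<gamma> + x))"
        using norm_ml_kernel_le[OF z x, of \<mu>] by (simp add: \<kappa>_def)
      also have "\<dots> \<le> norm (ml_kernel (\<mu> - \<gamma>) 0 ?z) / (\<kappa> * s * (1 + x))"
      proof (rule divide_left_mono[OF le norm_ge_zero])
        have 0: "0 < \<kappa> * s * (1 + x)" using \<kappa> s x by simp
        show "0 < \<kappa> * (norm ?z powr \<gamma> + x) * (\<kappa> * s * (1 + x))"
          by (rule mult_pos_pos[OF less_le_trans[OF 0 le] 0])
      qed
      finally show ?thesis by (simp add: norm_mult)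
    qed
    have "norm (\<integral>r. cis \<theta> * ml_kernel \<mu> x (ray 1 r) \<partial>lebesgue_on {0..}) \<le>
      (\<integral>r. norm (ml_kernel (\<mu> - \<gamma>) 0 (ray 1 r)) / (\<kappa> * s * (1 + x)) \<partial>lebesgue_on {0..})"
      using b x i
      by (intro order_trans[OF integral_norm_bound integral_mono])
        (auto intro!: integrable_ml_kernel_ray integrable_norm)
    also have "\<dots> = N / (\<kappa> * s * (1 + x))" by (simp add: N_def)
    also have "\<dots> \<le> (N + 1) / (\<kappa> * s * (1 + x))" using \<kappa> s x by (intro divide_right_mono) auto
    finally have "\<bar>Im (\<integral>r. cis \<theta> * ml_kernel \<mu> x (ray 1 r) \<partial>lebesgue_on {0..})\<bar> \<le> (N + 1) / (\<kappa> * s * (1 + x))"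
      by (rule order_trans[OF abs_Im_le_cmod])
    then show "\<bar>hankel \<mu> x 1\<bar> \<le> (N + 1) / (\<kappa> * s * pi) / (1 + x)"
      unfolding hankel_def using divide_right_mono[of _ _ pi] by (fastforce simp: abs_divide field_simps)
  qed
qed

text \<open>
  The fraction \<open>1 / (\<zeta> powr \<gamma> + x)\<close> is a geometric series in \<open>- x / \<zeta> powr \<gamma>\<close>, which converges uniformly
  on a contour that passes the origin at a distance greater than \<open>x powr (1 / \<gamma>)\<close>.
\<close>

lemma sums_hankel:
  assumes "0 < \<sigma>" "0 \<le> x" "x < (\<sigma> * sin \<theta>) powr \<gamma>"
  shows "(\<lambda>j. (- x) ^ j * hankel (\<gamma> * real j + \<mu>) 0 \<sigma>) sums hankel \<mu> x \<sigma>"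
proof -
  let ?N = "lebesgue_on {0..} :: real measure"
  define q where "q = x / (\<sigma> * sin \<theta>) powr \<gamma>"
  define f where "f = (\<lambda>j r. of_real ((- x) ^ j) * (cis \<theta> * ml_kernel (\<gamma> * real j + \<mu>) 0 (ray \<sigma> r)))"
  define n where "n = (\<lambda>r. norm (ml_kernel \<mu> 0 (ray \<sigma> r)))"
  have p: "0 < (\<sigma> * sin \<theta>) powr \<gamma>" using assms sin_\<theta> by simp
  have q: "0 \<le> q" "q < 1" using assms p by (auto simp: q_def)
  have f_eq: "f j r = cis \<theta> * ml_kernel \<mu> 0 (ray \<sigma> r) * (- of_real x / exp (of_real \<gamma> * Ln (ray \<sigma> r))) ^ j"
    for j r
  proof -
    have "exp (- (of_real (\<gamma> * real j + \<mu>) * Ln (ray \<sigma> r))) =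
        exp (- (of_real \<mu> * Ln (ray \<sigma> r)) - of_nat j * (of_real \<gamma> * Ln (ray \<sigma> r)))"
      by (simp add: algebra_simps)
    also have "\<dots> = exp (- (of_real \<mu> * Ln (ray \<sigma> r))) / exp (of_real \<gamma> * Ln (ray \<sigma> r)) ^ j"
      by (simp only: exp_diff exp_of_nat_mult)
    finally have e: "exp (- (of_real (\<gamma> * real j + \<mu>) * Ln (ray \<sigma> r))) =
        exp (- (of_real \<mu> * Ln (ray \<sigma> r))) / exp (of_real \<gamma> * Ln (ray \<sigma> r)) ^ j" .
    show ?thesis unfolding f_def ml_kernel_0 e power_divide by simp
  qed
  have ratio: "norm (- of_real x / exp (of_real \<gamma> * Ln (ray \<sigma> r))) \<le> q" if "0 \<le> r" for r
  proof -
    have nz: "ray \<sigma> r \<noteq> 0" using that assms by (intro ray_nonzero) auto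
    have "(\<sigma> * sin \<theta>) powr \<gamma> \<le> norm (ray \<sigma> r) powr \<gamma>"
      using norm_ray_ge[of \<sigma> r] assms sin_\<theta> \<gamma> by (intro powr_mono2) auto
    then show ?thesis unfolding norm_divide norm_exp_Ln[OF nz] q_def
      using assms p by (auto intro!: divide_left_mono mult_pos_pos simp: nz)
  qed
  have nf: "norm (f j r) \<le> n r * q ^ j" if "0 \<le> r" for j r
    unfolding f_eq n_def norm_mult norm_power
    using power_mono[OF ratio[OF that], of j] by (simp add: mult_left_mono)
  have int: "integrable ?N (f j)" for j
    unfolding f_def using assms by (intro integrable_mult_right integrable_ml_kernel_ray) auto
  have intn: "integrable ?N n"
    using integrable_norm[OF integrable_ml_kernel_ray[of \<sigma> 0 \<mu>]] assms by (simp add: n_def norm_mult)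
  have "(\<lambda>j. integral\<^sup>L ?N (f j)) sums (\<integral>r. (\<Sum>j. f j r) \<partial>?N)"
  proof (rule sums_integral[OF int])
    show "AE r in ?N. summable (\<lambda>j. norm (f j r))"
    proof (rule AE_I2)
      fix r :: real assume "r \<in> space ?N"
      then show "summable (\<lambda>j. norm (f j r))"
        using nf q by (intro summable_comparison_test'[OF summable_mult[OF summable_geometric[of q], of "n r"], of 0]) auto
    qed
    have "norm (\<integral>r. norm (f j r) \<partial>?N) \<le> integral\<^sup>L ?N n * q ^ j" for j
    proof -
      have "(\<integral>r. norm (f j r) \<partial>?N) \<le> (\<integral>r. n r * q ^ j \<partial>?N)"
        using int intn nf by (intro integral_mono) auto
      then show ?thesis by (simp)
    qed
    then show "summable (\<lambda>j. \<integral>r. norm (f j r) \<partial>?N)"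
      using q by (intro summable_comparison_test'[OF summable_mult[OF summable_geometric[of q], of "integral\<^sup>L ?N n"], of 0]) auto
  qed
  also have "(\<integral>r. (\<Sum>j. f j r) \<partial>?N) = (\<integral>r. cis \<theta> * ml_kernel \<mu> x (ray \<sigma> r) \<partial>?N)"
  proof (rule Bochner_Integration.integral_cong[OF refl])
    fix r :: real assume "r \<in> space ?N"
    then have r: "0 \<le> r" by simp
    let ?w = "exp (of_real \<gamma> * Ln (ray \<sigma> r))"
    have "norm (- of_real x / ?w) < 1" using ratio[OF r] q by linarith
    then have "(\<lambda>j. (- of_real x / ?w) ^ j) sums (1 / (1 - (- of_real x / ?w)))" by (rule geometric_sums)
    from sums_mult[OF this, of "cis \<theta> * ml_kernel \<mu> 0 (ray \<sigma> r)"]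
    have "(\<Sum>j. f j r) = cis \<theta> * ml_kernel \<mu> 0 (ray \<sigma> r) * (1 / (1 + of_real x / ?w))"
      unfolding f_eq by (simp add: sums_iff)
    also have "\<dots> = cis \<theta> * ml_kernel \<mu> x (ray \<sigma> r)"
    proof -
      have "?w + of_real x = ?w * (1 + of_real x / ?w)" by (simp add: field_simps)
      then show ?thesis unfolding ml_kernel_def by simp
    qed
    finally show "(\<Sum>j. f j r) = cis \<theta> * ml_kernel \<mu> x (ray \<sigma> r)" .
  qed
  finally have "(\<lambda>j. Im (integral\<^sup>L ?N (f j)) / pi) sums hankel \<mu> x \<sigma>"
    unfolding hankel_def by (intro sums_divide bounded_linear.sums[OF bounded_linear_Im])
  moreover have "Im (integral\<^sup>L ?N (f j)) / pi = (- x) ^ j * hankel (\<gamma> * real j + \<mu>) 0 \<sigma>" for j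
    unfolding f_def hankel_def by (subst integral_mult_right_zero) (simp flip: of_real_minus of_real_power)
  ultimately show ?thesis by simp
qed

end

lemma LIMSEQ_exp_powr_0:
  assumes "0 < c"
  shows "(\<lambda>n. C * (exp (- c * real n) * real n powr a)) \<longlonglongrightarrow> 0"
proof -
  obtain K where K: "0 < K" "\<And>y. 1 \<le> y \<Longrightarrow> y powr a \<le> K * exp (c / 2 * y)"
    using powr_le_exp_mult[of 1 "c / 2"] assms by auto
  have "(\<lambda>n. exp (- c * real n) * real n powr a) \<longlonglongrightarrow> 0"
  proof (rule Lim_null_comparison)
    show "\<forall>\<^sub>F n in sequentially. norm (exp (- c * real n) * real n powr a) \<le> K * exp (- (c / 2) * real n)"
      using eventually_ge_at_top[of 1]
    proof eventually_elim
      case (elim n)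
      have "exp (- c * real n) * real n powr a \<le> exp (- c * real n) * (K * exp (c / 2 * real n))"
        using K(2)[of "real n"] elim by (intro mult_left_mono) auto
      also have "\<dots> = K * exp (- c * real n + c / 2 * real n)" by (simp only: exp_add mult_ac)
      finally show ?case by (simp add: algebra_simps)
    qed
    have "(\<lambda>n. exp (- (c / 2) * real n)) \<longlonglongrightarrow> 0"
      using assms by (intro filterlim_compose[OF exp_at_bot] filterlim_tendsto_neg_mult_at_bot[OF tendsto_const]
        filterlim_real_sequentially) auto
    from tendsto_mult_right_zero[OF this]
    show "(\<lambda>n. K * exp (- (c / 2) * real n)) \<longlonglongrightarrow> 0" by blast
  qed
  from tendsto_mult_right_zero[OF this] show ?thesis by blast
qed

lemma LIMSEQ_Gamma_truncated:
  fixes a :: real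
  assumes a: "0 < a"
  shows "(\<lambda>n. integral {1 / real n..real n} (\<lambda>t. t powr (a - 1) / exp t)) \<longlonglongrightarrow> Gamma a"
proof -
  let ?f = "\<lambda>t::real. t powr (a - 1) / exp t"
  have G: "(?f has_integral Gamma a) {0..}" by (rule Gamma_integral_real[OF a])
  have "(\<lambda>n. integral {0..} (\<lambda>t. if t \<in> {1 / real n..real n} then ?f t else 0)) \<longlonglongrightarrow> integral {0..} ?f"
  proof (rule dominated_convergence(2)[where h = ?f])
    show "(\<lambda>t. if t \<in> {1 / real n..real n} then ?f t else 0) integrable_on {0..}" for n
    proof (cases "n = 0")
      case False
      have "?f integrable_on {1 / real n..real n}"
        using False by (intro integrable_continuous_interval continuous_intros) auto
      then have "(\<lambda>t. if t \<in> {1 / real n..real n} then ?f t else 0) integrable_on UNIV"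
        by (simp only: Henstock_Kurzweil_Integration.integrable_restrict_UNIV)
      also have "?this \<longleftrightarrow> (\<lambda>t. if t \<in> {0..} then (if t \<in> {1 / real n..real n} then ?f t else 0) else 0) integrable_on UNIV"
      proof (rule integrable_cong)
        fix t :: real
        have 0: "0 \<le> 1 / real n" by simp
        show "(if t \<in> {1 / real n..real n} then ?f t else 0) =
          (if t \<in> {0..} then (if t \<in> {1 / real n..real n} then ?f t else 0) else 0)" by (auto dest: order_trans[OF 0])
      qed
      finally show ?thesis by (simp only: Henstock_Kurzweil_Integration.integrable_restrict_UNIV)
    next
      case True
      have "((\<lambda>t. if t \<in> {1 / real n..real n} then ?f t else 0) has_integral 0) {0..}"
        by (rule has_integral_is_0) (use True in auto)
      then show ?thesis by blast
    qed
    show "?f integrable_on {0..}" using G by blast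
    fix t :: real assume "t \<in> {0..}"
      then consider "t = 0" | "0 < t" by fastforce
      then show "(\<lambda>n. if t \<in> {1 / real n..real n} then ?f t else 0) \<longlonglongrightarrow> ?f t"
      proof cases
        case 1
        then show ?thesis by (auto intro!: tendsto_eventually always_eventually)
      next
        case 2
        have "\<forall>\<^sub>F n in sequentially. t \<le> real n" "\<forall>\<^sub>F n in sequentially. 1 / t \<le> real n"
          using filterlim_real_sequentially unfolding filterlim_at_top by blast+
        then have "\<forall>\<^sub>F n in sequentially. (if t \<in> {1 / real n..real n} then ?f t else 0) = ?f t"
          using eventually_gt_at_top[of 0] by eventually_elim (use 2 in \<open>auto simp: field_simps\<close>)
        then show ?thesis by (rule tendsto_eventually)
      qed
  qed (auto)
  also have "integral {0..} ?f = Gamma a" using G by (rule integral_unique)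
  also have "(\<lambda>n. integral {0..} (\<lambda>t. if t \<in> {1 / real n..real n} then ?f t else 0)) =
    (\<lambda>n. integral {1 / real n..real n} ?f)"
  proof
    fix n
    have 0: "0 \<le> 1 / real n" by simp
    have "integral {0..} (\<lambda>t. if t \<in> {1 / real n..real n} then ?f t else 0) = integral ({0..} \<inter> {1 / real n..real n}) ?f"
      by (simp only: Henstock_Kurzweil_Integration.integral_restrict_Int Int_commute)
    also have "{0..} \<inter> {1 / real n..real n} = {1 / real n..real n}" using 0 by (auto dest: order_trans)
    finally show "integral {0..} (\<lambda>t. if t \<in> {1 / real n..real n} then ?f t else 0) = integral {1 / real n..real n} ?f" .
  qed
  finally show ?thesis .
qed

context ml_contour
begin

text \<open>
  Hankel's formula for \<open>1 / \<Gamma>\<close>.  For \<open>\<mu> < 1\<close> the integrand is integrable at the origin and the ray may be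
  turned onto the upper side of the negative axis, where it becomes the integrand of \<open>\<Gamma>(1 - \<mu>)\<close> times
  the phase \<open>cis (\<pi> * (1 - \<mu>))\<close>.  The reflection formula turns
  \<open>sin (\<pi> * \<mu>) * \<Gamma>(1 - \<mu>) / \<pi>\<close> into \<open>1 / \<Gamma>(\<mu>)\<close>.  In the variable \<open>v = Ln \<zeta>\<close> the arcs around the origin are
  vertical segments and the primitive \<open>Q\<close> is entire, so the negative axis is reached without a branch cut.
\<close>

lemma hankel_0_unit_interval:
  assumes \<mu>: "0 < \<mu>" "\<mu> < 1"
  shows "hankel \<mu> 0 1 = rGamma \<mu>"
proof -
  let ?q = "\<lambda>v :: complex. exp (exp v) * exp (of_real (1 - \<mu>) * v)"
  obtain Q where Q: "\<And>v. (Q has_field_derivative ?q v) (at v)"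
  proof -
    have "?q holomorphic_on UNIV" by (intro holomorphic_intros)
    then show thesis
      by (rule holomorphic_convex_primitive'[OF convex_UNIV open_UNIV]) (rule that, simp)
  qed
  define P where "P = (\<lambda>\<zeta>. Q (Ln \<zeta>))"
  have P: "(P has_field_derivative ml_kernel \<mu> 0 \<zeta>) (at \<zeta>)" if "\<zeta> \<in> sector" for \<zeta>
  proof -
    have nz: "\<zeta> \<noteq> 0" using that by (simp add: sector_def)
    have "exp (of_real (1 - \<mu>) * Ln \<zeta>) = exp (Ln \<zeta> - of_real \<mu> * Ln \<zeta>)" by (simp add: algebra_simps)
    then have "exp (of_real (1 - \<mu>) * Ln \<zeta>) = \<zeta> * exp (- (of_real \<mu> * Ln \<zeta>))"
      using nz by (simp add: exp_diff exp_minus divide_inverse)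
    then have "ml_kernel \<mu> 0 \<zeta> = ?q (Ln \<zeta>) * inverse \<zeta>" using nz by (simp add: ml_kernel_0)
    then show ?thesis unfolding P_def
      using DERIV_chain2[OF Q has_field_derivative_Ln[OF sector_not_nonpos[OF that]]] by simp
  qed
  have seg: "norm (Q (of_real u + \<i> * of_real a) - Q (of_real u + \<i> * of_real b)) \<le> B * \<bar>a - b\<bar>"
    if B: "\<And>y. y \<in> closed_segment a b \<Longrightarrow> exp (exp u * cos y) * exp ((1 - \<mu>) * u) \<le> B" for u a b B
  proof -
    let ?l = "\<lambda>y. of_real u + \<i> * of_real y :: complex"
    have "norm (Q (?l a) - Q (?l b)) \<le> B * norm (?l a - ?l b)"
    proof (rule field_differentiable_bound[of "closed_segment (?l a) (?l b)"])
      fix v assume "v \<in> closed_segment (?l a) (?l b)"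
      then obtain t where t: "0 \<le> t" "t \<le> 1" "v = (1 - t) *\<^sub>R ?l a + t *\<^sub>R ?l b" by (auto simp: in_segment)
      let ?y = "(1 - t) * a + t * b"
      have v: "v = ?l ?y" unfolding t by (simp add: scaleR_conv_of_real algebra_simps)
      have "norm (?q v) = exp (exp u * cos ?y) * exp ((1 - \<mu>) * u)"
        by (simp add: v norm_mult Re_exp)
      also have "\<dots> \<le> B" using t by (intro B) (auto simp: in_segment)
      finally show "norm (?q v) \<le> B" .
    qed (use has_field_derivative_at_within[OF Q] in auto)
    also have "?l a - ?l b = \<i> * of_real (a - b)" by (simp add: algebra_simps)
    finally show ?thesis by (simp only: norm_mult norm_ii norm_of_real)
  qed
  define c where "c = - cos \<theta>"
  have c: "0 < c" using cos_\<theta> by (simp add: c_def)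
  let ?u = "\<lambda>n::nat. complex_of_real (ln (real n))"
  \<comment> \<open>The path from the end of the ray to a point near the origin has four pieces.  First, the end point
    is moved from the ray that starts at \<open>1\<close> to the ray that starts at \<open>0\<close>.\<close>
  have A1: "(\<lambda>n. P (ray 1 (real n)) - P (ray 0 (real n))) \<longlonglongrightarrow> 0"
  proof (rule Lim_null_comparison)
    let ?B = "\<lambda>n. exp 1 * exp (- c * real n) * (sin \<theta> powr (- \<mu>)) / cos (\<gamma> * \<theta> / 2)"
    show "\<forall>\<^sub>F n in sequentially. norm (P (ray 1 (real n)) - P (ray 0 (real n))) \<le> ?B n"
      using eventually_ge_at_top[of 1]
    proof eventually_elim
      case (elim n)
      then have n: "1 \<le> real n" by simp
      have "norm (P (ray 1 (real n)) - P (ray 0 (real n))) \<le> ?B n * norm (ray 1 (real n) - ray 0 (real n))"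
      proof (rule field_differentiable_bound[of "closed_segment (ray 1 (real n)) (ray 0 (real n))"])
        fix \<zeta> assume "\<zeta> \<in> closed_segment (ray 1 (real n)) (ray 0 (real n))"
        then obtain u where u: "0 \<le> u" "u \<le> 1" "\<zeta> = (1 - u) *\<^sub>R ray 1 (real n) + u *\<^sub>R ray 0 (real n)"
          by (auto simp: in_segment)
        have z: "\<zeta> = ray (1 - u) (real n)" unfolding u ray_def by (simp add: scaleR_conv_of_real algebra_simps)
        have s: "\<zeta> \<in> sector" unfolding z using u n by (intro ray_in_sector) auto
        then show "(P has_field_derivative ml_kernel \<mu> 0 \<zeta>) (at \<zeta> within closed_segment (ray 1 (real n)) (ray 0 (real n)))"
          by (intro has_field_derivative_at_within[OF P])
        have "1 * sin \<theta> \<le> real n * sin \<theta>" using n sin_\<theta> by (intro mult_right_mono) auto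
        also have "\<dots> = \<bar>Im \<zeta>\<bar>" using n sin_\<theta> by (simp add: z Im_ray abs_mult)
        also have "\<dots> \<le> norm \<zeta>" by (rule abs_Im_le_cmod)
        finally have "norm \<zeta> powr (- \<mu>) \<le> sin \<theta> powr (- \<mu>)"
          using \<mu> sin_\<theta> by (intro powr_mono2') auto
        moreover have "exp (Re \<zeta>) \<le> exp 1 * exp (- c * real n)"
          using u(1,2) by (simp add: z Re_ray c_def mult.commute flip: exp_add)
        ultimately have "exp (Re \<zeta>) * norm \<zeta> powr (- \<mu>) \<le> exp 1 * exp (- c * real n) * sin \<theta> powr (- \<mu>)"
          by (intro mult_mono) auto
        from divide_right_mono[OF this less_imp_le[OF cos_half]]
        show "norm (ml_kernel \<mu> 0 \<zeta>) \<le> ?B n"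
          using norm_ml_kernel_le'[OF s order.refl, of \<mu>] by linarith
      qed auto
      also have "norm (ray 1 (real n) - ray 0 (real n)) = 1" by (simp add: ray_def)
      finally show ?case by simp
    qed
    have "(\<lambda>n. exp 1 * (sin \<theta> powr (- \<mu>)) / cos (\<gamma> * \<theta> / 2) * (exp (- c * real n) * real n powr 0)) \<longlonglongrightarrow> 0"
      by (rule LIMSEQ_exp_powr_0[OF c])
    moreover have "\<forall>\<^sub>F n in sequentially. exp 1 * (sin \<theta> powr (- \<mu>)) / cos (\<gamma> * \<theta> / 2) * (exp (- c * real n) * real n powr 0) = ?B n"
      using eventually_gt_at_top[of 0] by eventually_elim (simp add: mult_ac)
    ultimately show "?B \<longlonglongrightarrow> 0" by (rule Lim_transform_eventually)
  qed
  \<comment> \<open>The arc of radius \<open>n\<close> from the argument \<open>\<theta>\<close> to \<open>\<pi>\<close>: there \<open>Re \<zeta> \<le> n * cos \<theta>\<close>, so \<open>exp \<zeta>\<close> decays.\<close>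
  have A2: "(\<lambda>n. P (ray 0 (real n)) - Q (?u n + \<i> * of_real pi)) \<longlonglongrightarrow> 0"
  proof (rule Lim_null_comparison)
    let ?B = "\<lambda>n. \<bar>\<theta> - pi\<bar> * (exp (- c * real n) * real n powr (1 - \<mu>))"
    show "\<forall>\<^sub>F n in sequentially. norm (P (ray 0 (real n)) - Q (?u n + \<i> * of_real pi)) \<le> ?B n"
      using eventually_gt_at_top[of 0]
    proof eventually_elim
      case (elim n)
      have "Ln (ray 0 (real n)) = ?u n + \<i> * of_real \<theta>"
      proof -
        have "ray 0 (real n) = exp (?u n + \<i> * of_real \<theta>)"
          using elim by (simp add: ray_def exp_add exp_of_real cis_conv_exp)
        then show ?thesis using \<theta> pi_gt_zero by (simp add: Ln_exp)
      qed
      then have "P (ray 0 (real n)) = Q (?u n + \<i> * of_real \<theta>)" by (simp add: P_def)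
      also have "norm (\<dots> - Q (?u n + \<i> * of_real pi)) \<le> (exp (- c * real n) * real n powr (1 - \<mu>)) * \<bar>\<theta> - pi\<bar>"
      proof (rule seg)
        fix y assume "y \<in> closed_segment \<theta> pi"
        then have y: "\<theta> \<le> y" "y \<le> pi" using \<theta> by (auto simp: closed_segment_eq_real_ivl)
        have "cos y \<le> cos \<theta>" using y \<theta> pi_gt_zero by (intro cos_monotone_0_pi_le) linarith+
        then have "real n * cos y \<le> real n * cos \<theta>" by (intro mult_left_mono) auto
        then show "exp (exp (ln (real n)) * cos y) * exp ((1 - \<mu>) * ln (real n)) \<le> exp (- c * real n) * real n powr (1 - \<mu>)"
          using elim by (auto intro!: mult_right_mono simp: powr_def c_def mult.commute)
      qed
      finally show ?case by (simp add: mult_ac)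
    qed
    show "?B \<longlonglongrightarrow> 0" by (rule LIMSEQ_exp_powr_0[OF c])
  qed
  \<comment> \<open>The arc of radius \<open>1 / n\<close> from the argument \<open>\<pi>\<close> to \<open>0\<close>: its contribution tends to \<open>0\<close> because \<open>\<mu> < 1\<close>.\<close>
  have A3: "(\<lambda>n. Q (- ?u n + \<i> * of_real pi) - Q (- ?u n)) \<longlonglongrightarrow> 0"
  proof (rule Lim_null_comparison)
    let ?B = "\<lambda>n. pi * exp 1 * real n powr (- (1 - \<mu>))"
    show "\<forall>\<^sub>F n in sequentially. norm (Q (- ?u n + \<i> * of_real pi) - Q (- ?u n)) \<le> ?B n"
      using eventually_ge_at_top[of 1]
    proof eventually_elim
      case (elim n)
      have "norm (Q (of_real (- ln (real n)) + \<i> * of_real pi) - Q (of_real (- ln (real n)) + \<i> * of_real 0))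
          \<le> (exp 1 * real n powr (- (1 - \<mu>))) * \<bar>pi - 0\<bar>"
      proof (rule seg)
        fix y :: real
        have "exp (- ln (real n)) * cos y \<le> exp (- ln (real n)) * 1" by (intro mult_left_mono) auto
        also have "\<dots> \<le> 1" using elim by simp
        finally have "exp (- ln (real n)) * cos y \<le> 1" .
        then show "exp (exp (- ln (real n)) * cos y) * exp ((1 - \<mu>) * - ln (real n)) \<le> exp 1 * real n powr (- (1 - \<mu>))"
          using elim by (intro mult_mono) (auto simp: powr_def algebra_simps)
      qed
      then show ?case by (simp add: mult_ac)
    qed
    have "(\<lambda>n. real n powr (- (1 - \<mu>))) \<longlonglongrightarrow> 0"
      using \<mu> by (intro tendsto_neg_powr filterlim_real_sequentially) auto
    from tendsto_mult_right_zero[OF this] show "?B \<longlonglongrightarrow> 0" by blast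
  qed
  \<comment> \<open>The upper side of the negative axis from \<open>- n\<close> to \<open>- 1 / n\<close>, which carries the Gamma integral.\<close>
  have A4: "(\<lambda>n. Q (?u n + \<i> * of_real pi) - Q (- ?u n + \<i> * of_real pi)) \<longlonglongrightarrow>
    cis (pi * (1 - \<mu>)) * of_real (Gamma (1 - \<mu>))"
  proof (rule Lim_transform_eventually)
    let ?f = "\<lambda>t::real. t powr ((1 - \<mu>) - 1) / exp t"
    show "(\<lambda>n. cis (pi * (1 - \<mu>)) * of_real (integral {1 / real n..real n} ?f)) \<longlonglongrightarrow>
      cis (pi * (1 - \<mu>)) * of_real (Gamma (1 - \<mu>))"
      using \<mu> by (intro tendsto_intros LIMSEQ_Gamma_truncated) auto
    show "\<forall>\<^sub>F n in sequentially. cis (pi * (1 - \<mu>)) * of_real (integral {1 / real n..real n} ?f) =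
        Q (?u n + \<i> * of_real pi) - Q (- ?u n + \<i> * of_real pi)"
      using eventually_ge_at_top[of 1]
    proof eventually_elim
      case (elim n)
      let ?F = "\<lambda>t. Q (of_real (ln t) + \<i> * of_real pi)"
      have "((\<lambda>t. cis (pi * (1 - \<mu>)) * of_real (?f t)) has_integral ?F (real n) - ?F (1 / real n)) {1 / real n..real n}"
      proof (rule fundamental_theorem_of_calculus)
        have "1 * 1 \<le> real n * real n" using elim by (intro mult_mono) auto
        then show "1 / real n \<le> real n" using elim by (simp add: field_simps)
        fix t assume "t \<in> {1 / real n..real n}"
        moreover have "0 < 1 / real n" using elim by simp
        ultimately have t: "0 < t" by (meson atLeastAtMost_iff less_le_trans)
        let ?v = "of_real (ln t) + \<i> * of_real pi :: complex"
        have "((\<lambda>t. of_real (ln t) + \<i> * of_real pi :: complex) has_vector_derivative of_real (1 / t)) (at t)"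
        proof -
          have "(ln has_vector_derivative (1 / t)) (at t)"
            using DERIV_ln_divide[OF t] by (simp add: has_real_derivative_iff_has_vector_derivative)
          then have "((\<lambda>t. of_real (ln t) :: complex) has_vector_derivative of_real (1 / t)) (at t)"
            by (rule bounded_linear.has_vector_derivative[OF bounded_linear_of_real])
          from has_vector_derivative_add[OF this has_vector_derivative_const]
          show ?thesis by simp
        qed
        from field_vector_diff_chain_at[OF this Q]
        have "(?F has_vector_derivative of_real (1 / t) * ?q ?v) (at t)" by (simp add: o_def)
        also have "of_real (1 / t) * ?q ?v = cis (pi * (1 - \<mu>)) * of_real (?f t)"
        proof -
          have 1: "exp ?v = - of_real t" using t by (simp add: exp_add exp_of_real)
          have 2: "exp (of_real (1 - \<mu>) * ?v) = of_real (t powr (1 - \<mu>)) * cis (pi * (1 - \<mu>))"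
            using t by (simp add: distrib_left exp_add powr_def cis_conv_exp mult_ac flip: exp_of_real)
          show ?thesis unfolding 1 2 using t
            by (simp add: exp_minus exp_of_real powr_diff powr_minus divide_inverse mult_ac)
        qed
        finally show "(?F has_vector_derivative cis (pi * (1 - \<mu>)) * of_real (?f t)) (at t within {1 / real n..real n})"
          by (rule has_vector_derivative_at_within)
      qed
      moreover have "((\<lambda>t. cis (pi * (1 - \<mu>)) * of_real (?f t)) has_integral
          cis (pi * (1 - \<mu>)) * of_real (integral {1 / real n..real n} ?f)) {1 / real n..real n}"
      proof -
        have "?f integrable_on {1 / real n..real n}"
          using elim by (intro integrable_continuous_interval continuous_intros) auto
        from has_integral_linear[OF integrable_integral[OF this] bounded_linear_of_real[where 'a = complex]]
        show ?thesis by (intro has_integral_mult_right) (simp add: o_def)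
      qed
      ultimately have "cis (pi * (1 - \<mu>)) * of_real (integral {1 / real n..real n} ?f) = ?F (real n) - ?F (1 / real n)"
        by (rule has_integral_unique[symmetric])
      then show ?case using elim by (simp add: ln_div)
    qed
  qed
  have Qreal: "Im (Q (of_real a)) = Im (Q (of_real b))" for a b
    using Im_primitive_const[of P "ml_kernel \<mu> 0" "exp a" "exp b"] P[OF real_in_sector]
    by (simp add: ml_kernel_of_real P_def Ln_of_real)
  have "(\<lambda>n. P (ray 1 (real n)) - P (ray 1 0)) \<longlonglongrightarrow> (\<integral>r. cis \<theta> * ml_kernel \<mu> 0 (ray 1 r) \<partial>lebesgue_on {0..})"
    by (intro LIMSEQ_primitive_halfline ray_has_vector_derivative[OF P] integrable_ml_kernel_ray) auto
  from tendsto_Im[OF this]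
  have L1: "(\<lambda>n. Im (P (ray 1 (real n)) - P (ray 1 0))) \<longlonglongrightarrow> pi * hankel \<mu> 0 1" by (simp add: hankel_def)
  have "(\<lambda>n. (P (ray 1 (real n)) - P (ray 0 (real n))) + (P (ray 0 (real n)) - Q (?u n + \<i> * of_real pi)) +
      (Q (?u n + \<i> * of_real pi) - Q (- ?u n + \<i> * of_real pi)) + (Q (- ?u n + \<i> * of_real pi) - Q (- ?u n)))
      \<longlonglongrightarrow> 0 + 0 + cis (pi * (1 - \<mu>)) * of_real (Gamma (1 - \<mu>)) + 0"
    by (intro tendsto_add A1 A2 A3 A4)
  from tendsto_Im[OF this]
  have "(\<lambda>n. Im (P (ray 1 (real n)) - Q (- ?u n))) \<longlonglongrightarrow> sin (pi * (1 - \<mu>)) * Gamma (1 - \<mu>)" by simp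
  moreover have "Im (P (ray 1 (real n)) - Q (- ?u n)) = Im (P (ray 1 (real n)) - P (ray 1 0))" for n
    using Qreal[of "- ln (real n)" 0] by (simp add: P_def ray_def)
  ultimately have "(\<lambda>n. Im (P (ray 1 (real n)) - P (ray 1 0))) \<longlonglongrightarrow> sin (pi * (1 - \<mu>)) * Gamma (1 - \<mu>)" by simp
  with L1 have "pi * hankel \<mu> 0 1 = sin (pi * (1 - \<mu>)) * Gamma (1 - \<mu>)" by (rule LIMSEQ_unique)
  also have "sin (pi * (1 - \<mu>)) = pi * (rGamma \<mu> * rGamma (1 - \<mu>))"
  proof -
    have "complex_of_real (rGamma \<mu> * rGamma (1 - \<mu>)) = rGamma (of_real \<mu>) * rGamma (of_real (1 - \<mu>))"
      by (simp only: of_real_mult rGamma_complex_of_real)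
    also have "complex_of_real (1 - \<mu>) = 1 - of_real \<mu>" by (rule of_real_diff[of 1, unfolded of_real_1])
    also have "rGamma (of_real \<mu>) * rGamma (1 - of_real \<mu> :: complex) = sin (of_real pi * of_real \<mu>) / of_real pi"
      by (rule rGamma_reflection_complex)
    also have "\<dots> = of_real (sin (pi * \<mu>) / pi)"
      by (simp only: of_real_mult[symmetric] sin_of_real of_real_divide)
    finally have "complex_of_real (rGamma \<mu> * rGamma (1 - \<mu>)) = of_real (sin (pi * \<mu>) / pi)" .
    then have "rGamma \<mu> * rGamma (1 - \<mu>) = sin (pi * \<mu>) / pi" by (simp only: of_real_eq_iff)
    then show ?thesis by (simp add: right_diff_distrib sin_diff)
  qed
  also have "pi * (rGamma \<mu> * rGamma (1 - \<mu>)) * Gamma (1 - \<mu>) = pi * rGamma \<mu>"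
  proof -
    have "0 < Gamma (1 - \<mu>)" using \<mu> by (intro Gamma_real_pos) simp
    then have "rGamma (1 - \<mu>) * Gamma (1 - \<mu>) = 1" by (simp only: rGamma_inverse_Gamma) simp
    then show ?thesis by (simp add: mult.assoc)
  qed
  finally show ?thesis by simp
qed

text \<open>
  At \<open>\<mu> = 1\<close> the singularity at the origin is no longer integrable, so this value is reached as a limit.
\<close>

lemma hankel_0_one: "hankel 1 0 1 = rGamma 1"
proof -
  let ?\<mu> = "\<lambda>n. 1 - 1 / real (n + 2)"
  have lim: "?\<mu> \<longlonglongrightarrow> 1"
    using tendsto_diff[OF tendsto_const[of 1] LIMSEQ_ignore_initial_segment[OF lim_1_over_n, of 2]] by simp
  have \<mu>: "0 < ?\<mu> n" "?\<mu> n < 1" for n by (auto simp: field_simps)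
  have 1: "(\<lambda>n. hankel (?\<mu> n) 0 1) \<longlonglongrightarrow> rGamma 1"
  proof -
    have "isCont rGamma (1 :: real)"
      using continuous_on_rGamma[of "UNIV :: real set"] by (simp add: continuous_on_eq_continuous_at)
    from isCont_tendsto_compose[OF this lim] show ?thesis
      by (simp only: hankel_0_unit_interval[OF \<mu>])
  qed
  have "(\<lambda>n. \<integral>r. cis \<theta> * ml_kernel (?\<mu> n) 0 (ray 1 r) \<partial>lebesgue_on {0..}) \<longlonglongrightarrow>
    (\<integral>r. cis \<theta> * ml_kernel 1 0 (ray 1 r) \<partial>lebesgue_on {0..})"
  proof (rule integral_dominated_convergence)
    show "(\<lambda>r. cis \<theta> * ml_kernel 1 0 (ray 1 r)) \<in> borel_measurable (lebesgue_on {0..})"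
      "(\<lambda>r. cis \<theta> * ml_kernel (?\<mu> n) 0 (ray 1 r)) \<in> borel_measurable (lebesgue_on {0..})" for n
      by (rule borel_measurable_integrable, rule integrable_ml_kernel_ray, simp, simp)+
    show "integrable (lebesgue_on {0..}) (\<lambda>r. (exp 1 / sin \<theta>) * exp (- (- cos \<theta>) * r))"
      by (rule integrable_exp_decay) (use cos_\<theta> in simp)
    show "AE r in lebesgue_on {0..}. norm (cis \<theta> * ml_kernel (?\<mu> n) 0 (ray 1 r)) \<le> (exp 1 / sin \<theta>) * exp (- (- cos \<theta>) * r)" for n
    proof (rule AE_I2)
      fix r :: real assume "r \<in> space (lebesgue_on {0..})"
      then have r: "0 \<le> r" by simp
      have nz: "ray 1 r \<noteq> 0" using r by (intro ray_nonzero) auto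
      have "norm (ray 1 r) powr (- ?\<mu> n) \<le> sin \<theta> powr (- ?\<mu> n)"
        using norm_ray_ge[of 1 r] sin_\<theta> \<mu>[of n] by (intro powr_mono2') auto
      also have "\<dots> \<le> sin \<theta> powr (- 1)" using sin_\<theta> \<mu>[of n] by (intro powr_mono') auto
      also have "\<dots> = 1 / sin \<theta>" using sin_\<theta> by (simp add: powr_minus divide_inverse)
      finally have "exp (Re (ray 1 r)) * norm (ray 1 r) powr (- ?\<mu> n) \<le> exp (Re (ray 1 r)) * (1 / sin \<theta>)"
        by (intro mult_left_mono) auto
      then show "norm (cis \<theta> * ml_kernel (?\<mu> n) 0 (ray 1 r)) \<le> (exp 1 / sin \<theta>) * exp (- (- cos \<theta>) * r)"
        using norm_ml_kernel_0[OF nz, of "?\<mu> n"] by (simp add: norm_mult Re_ray exp_add mult.commute)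
    qed
    show "AE r in lebesgue_on {0..}. (\<lambda>n. cis \<theta> * ml_kernel (?\<mu> n) 0 (ray 1 r)) \<longlonglongrightarrow> cis \<theta> * ml_kernel 1 0 (ray 1 r)"
      unfolding ml_kernel_0 by (intro AE_I2 tendsto_intros lim)
  qed
  from tendsto_Im[OF this] have "(\<lambda>n. hankel (?\<mu> n) 0 1) \<longlonglongrightarrow> hankel 1 0 1"
    unfolding hankel_def by (intro tendsto_divide) auto
  then show ?thesis using 1 by (rule LIMSEQ_unique)
qed

text \<open>
  Both sides obey the same functional equation, which propagates the formula from \<open>0 < \<mu> \<le> 1\<close>, one
  step to either side at a time.
\<close>

lemma hankel_0_eq_rGamma_1: "hankel \<mu> 0 1 = rGamma \<mu>"
proof -
  have "- real n < \<mu> \<Longrightarrow> \<mu> \<le> real n + 1 \<Longrightarrow> hankel \<mu> 0 1 = rGamma \<mu>" for n \<mu>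
  proof (induction n arbitrary: \<mu>)
    case 0
    then show ?case using hankel_0_unit_interval hankel_0_one by (cases "\<mu> = 1") auto
  next
    case (Suc n)
    consider "\<mu> \<le> - real n" | "- real n < \<mu>" "\<mu> \<le> real n + 1" | "real n + 1 < \<mu>" by linarith
    then show ?case
    proof cases
      case 1
      then have "hankel (\<mu> + 1) 0 1 = rGamma (\<mu> + 1)" using Suc by (intro Suc.IH) auto
      then show ?thesis using hankel_recursion[of 1 \<mu>] rGamma_plus1[of \<mu>] by simp
    next
      case 2
      then show ?thesis by (rule Suc.IH)
    next
      case 3
      then have "hankel (\<mu> - 1) 0 1 = rGamma (\<mu> - 1)" using Suc by (intro Suc.IH) auto
      then have "(\<mu> - 1) * hankel \<mu> 0 1 = (\<mu> - 1) * rGamma \<mu>" using hankel_recursion[of 1 "\<mu> - 1"] rGamma_plus1[of "\<mu> - 1"] by simp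
      then show ?thesis using 3 by auto
    qed
  qed
  note * = this
  obtain n where "\<bar>\<mu>\<bar> < real n" using reals_Archimedean2 by blast
  then show ?thesis by (intro *[of n]) (auto simp: abs_less_iff)
qed

lemma hankel_shift_1: "0 < \<sigma> \<Longrightarrow> 0 \<le> x \<Longrightarrow> hankel \<mu> x \<sigma> = hankel \<mu> x 1"
  using hankel_shift[of \<sigma> 1 x \<mu>] hankel_shift[of 1 \<sigma> x \<mu>] by (cases "\<sigma> \<le> 1") auto

text \<open>
  A large \<open>\<sigma>\<close> makes the geometric series converge; the value does not depend on \<open>\<sigma>\<close>.
\<close>

lemma mittag_leffler_sums_hankel:
  assumes "0 \<le> x"
  shows "(\<lambda>j. (- x) ^ j / Gamma (\<gamma> * real j + \<mu>)) sums hankel \<mu> x 1"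
proof -
  define \<sigma> where "\<sigma> = (x + 1) powr (1 / \<gamma>) / sin \<theta>"
  have \<sigma>: "0 < \<sigma>" using assms sin_\<theta> by (simp add: \<sigma>_def)
  have "(\<sigma> * sin \<theta>) powr \<gamma> = x + 1" using assms sin_\<theta> \<gamma> by (simp add: \<sigma>_def powr_powr)
  with sums_hankel[OF \<sigma> assms, of \<mu>] show ?thesis
    by (simp add: hankel_shift_1[OF \<sigma>] assms hankel_0_eq_rGamma_1 rGamma_inverse_Gamma divide_inverse)
qed

end

text \<open>
  Supplies the angle of the contour as the midpoint of \<open>\<pi> / 2\<close> and \<open>p = \<pi> / \<gamma>\<close>.
\<close>

lemma midpoint_above_half_pi: "pi / 2 < p \<Longrightarrow> p < pi \<Longrightarrow> pi / 2 < (pi / 2 + p) / 2 \<and> (pi / 2 + p) / 2 < p \<and> (pi / 2 + p) / 2 < pi"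
  by auto

lemma mittag_leffler_bound:
  assumes "1 < \<gamma>" "\<gamma> < 2"
  obtains B where "0 < B" "\<And>x. 0 \<le> x \<Longrightarrow> \<bar>mittag_leffler \<gamma> \<mu> (- x)\<bar> \<le> B / (1 + x)"
proof -
  define \<theta> where "\<theta> = (pi / 2 + pi / \<gamma>) / 2"
  have "pi / 2 < pi / \<gamma>" "pi / \<gamma> < pi" using assms by (auto simp: field_simps)
  then have \<theta>: "pi / 2 < \<theta> \<and> \<theta> < pi / \<gamma> \<and> \<theta> < pi"
    unfolding \<theta>_def using midpoint_above_half_pi by blast
  interpret ml_contour \<gamma> \<theta>
    by (rule ml_contour.intro) (use assms \<theta> in \<open>auto simp: field_simps\<close>)
  obtain B where B: "0 < B" "\<And>x. 0 \<le> x \<Longrightarrow> \<bar>hankel \<mu> x 1\<bar> \<le> B / (1 + x)" using hankel_bound by metis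
  show thesis
  proof (rule that[OF B(1)])
    fix x :: real assume x: "0 \<le> x"
    show "\<bar>mittag_leffler \<gamma> \<mu> (- x)\<bar> \<le> B / (1 + x)"
      using B(2)[OF x] mittag_leffler_sums_hankel[OF x, of \<mu>] by (simp add: mittag_leffler_def sums_iff)
  qed
qed

lemma mittag_leffler_summable:
  assumes "1 < \<gamma>" "\<gamma> < 2"
  shows "summable (\<lambda>j. x ^ j / Gamma (\<gamma> * real j + \<mu>))"
proof -
  define \<theta> where "\<theta> = (pi / 2 + pi / \<gamma>) / 2"
  have "pi / 2 < pi / \<gamma>" "pi / \<gamma> < pi" using assms by (auto simp: field_simps)
  then have \<theta>: "pi / 2 < \<theta> \<and> \<theta> < pi / \<gamma> \<and> \<theta> < pi"
    unfolding \<theta>_def using midpoint_above_half_pi by blast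
  interpret ml_contour \<gamma> \<theta>
    by (rule ml_contour.intro) (use assms \<theta> in \<open>auto simp: field_simps\<close>)
  have "summable (\<lambda>j. 1 / Gamma (\<gamma> * real j + \<mu>) * (- (\<bar>x\<bar> + 1)) ^ j)"
    using mittag_leffler_sums_hankel[of "\<bar>x\<bar> + 1" \<mu>] by (simp add: sums_iff)
  from powser_inside[OF this, of x] show ?thesis by simp
qed

section \<open>Relaxation functions\<close>

text \<open>
  For \<open>\<mu> > 0\<close> its Laplace transform is \<open>z powr (\<gamma> - \<mu>) / (z powr \<gamma> + m)\<close>.  Extended by \<open>0\<close> to \<open>t \<le> 0\<close> it serves as a convolution kernel, so that \<open>\<integral>\<^sub>0\<^sup>t\<close> becomes an integral over the whole time interval.
\<close>

definition ml_fun :: "real \<Rightarrow> real \<Rightarrow> real \<Rightarrow> real \<Rightarrow> real" where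
  "ml_fun \<gamma> \<mu> m t = (if 0 < t then t powr (\<mu> - 1) * mittag_leffler \<gamma> \<mu> (- m * t powr \<gamma>) else 0)"

lemma mittag_leffler_shift:
  assumes "1 < \<gamma>" "\<gamma> < 2"
  shows "mittag_leffler \<gamma> \<mu> z = rGamma \<mu> + z * mittag_leffler \<gamma> (\<mu> + \<gamma>) z"
proof -
  have "mittag_leffler \<gamma> \<mu> z = (\<Sum>j. z ^ Suc j / Gamma (\<gamma> * real (Suc j) + \<mu>)) + z ^ 0 / Gamma (\<gamma> * real 0 + \<mu>)"
    unfolding mittag_leffler_def by (subst suminf_split_head[OF mittag_leffler_summable[OF assms]]) simp
  also have "(\<Sum>j. z ^ Suc j / Gamma (\<gamma> * real (Suc j) + \<mu>)) = (\<Sum>j. z * (z ^ j / Gamma (\<gamma> * real j + (\<mu> + \<gamma>))))"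
    by (simp add: algebra_simps)
  also have "\<dots> = z * mittag_leffler \<gamma> (\<mu> + \<gamma>) z"
    unfolding mittag_leffler_def by (rule suminf_mult[OF mittag_leffler_summable[OF assms]])
  finally show ?thesis by (simp add: rGamma_inverse_Gamma divide_inverse)
qed

text \<open>
  This trades the strong singularity of \<open>\<mu> \<in> {0, - 1, - 2, \<dots>}\<close> at \<open>t = 0\<close> for a factor \<open>m\<close>.
\<close>

lemma ml_fun_shift:
  assumes "1 < \<gamma>" "\<gamma> < 2" "rGamma \<mu> = 0"
  shows "ml_fun \<gamma> \<mu> m t = - m * ml_fun \<gamma> (\<mu> + \<gamma>) m t"
  using mittag_leffler_shift[OF assms(1,2), of \<mu>] assms(3)
  by (simp add: ml_fun_def powr_add powr_diff)

text \<open>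
  Termwise this is \<open>(\<gamma> * j + \<mu> - 1) / \<Gamma>(\<gamma> * j + \<mu>) = 1 / \<Gamma>(\<gamma> * j + \<mu> - 1)\<close>.  As the functional
  equation of \<open>1 / \<Gamma>\<close> it also holds at the poles of \<open>\<Gamma>\<close>.
\<close>

lemma mittag_leffler_derivative:
  assumes "1 < \<gamma>" "\<gamma> < 2"
  obtains D where "\<And>z. (mittag_leffler \<gamma> \<mu> has_real_derivative D z) (at z)"
    "\<And>z. (\<mu> - 1) * mittag_leffler \<gamma> \<mu> z + \<gamma> * z * D z = mittag_leffler \<gamma> (\<mu> - 1) z"
proof -
  define c where "c = (\<lambda>j. 1 / Gamma (\<gamma> * real j + \<mu>))"
  have E: "mittag_leffler \<gamma> \<mu> = (\<lambda>z. \<Sum>j. c j * z ^ j)" by (simp add: fun_eq_iff mittag_leffler_def c_def)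
  have sm: "summable (\<lambda>j. c j * z ^ j)" for z
    using mittag_leffler_summable[OF assms, of z \<mu>] by (simp add: c_def)
  define D where "D = (\<lambda>z. \<Sum>j. diffs c j * z ^ j)"
  have D: "(mittag_leffler \<gamma> \<mu> has_real_derivative D z) (at z)" for z
    unfolding E D_def by (rule termdiffs_strong_converges_everywhere[OF sm])
  have "(\<mu> - 1) * mittag_leffler \<gamma> \<mu> z + \<gamma> * z * D z = mittag_leffler \<gamma> (\<mu> - 1) z" for z
  proof -
    have "summable (\<lambda>j. diffs c j * z ^ j)" by (rule termdiff_converges_all[OF sm])
    then have 1: "(\<lambda>j. real j * c j * z ^ (j - Suc 0)) sums D z"
      unfolding D_def by (rule diffs_equiv)
    have "(\<lambda>j. (\<mu> - 1) * (c j * z ^ j) + \<gamma> * z * (real j * c j * z ^ (j - Suc 0))) sums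
        ((\<mu> - 1) * mittag_leffler \<gamma> \<mu> z + \<gamma> * z * D z)"
      unfolding E by (intro sums_add sums_mult 1 summable_sums[OF sm])
    moreover have "(\<mu> - 1) * (c j * z ^ j) + \<gamma> * z * (real j * c j * z ^ (j - Suc 0)) =
        z ^ j / Gamma (\<gamma> * real j + (\<mu> - 1))" for j
    proof -
      have "z * (real j * c j * z ^ (j - Suc 0)) = real j * c j * z ^ j" by (cases j) auto
      then have "(\<mu> - 1) * (c j * z ^ j) + \<gamma> * z * (real j * c j * z ^ (j - Suc 0)) =
          (\<mu> - 1) * (c j * z ^ j) + \<gamma> * (real j * c j * z ^ j)"
        by (simp only: mult.assoc)
      also have "\<dots> = ((\<gamma> * real j + \<mu> - 1) * rGamma ((\<gamma> * real j + \<mu> - 1) + 1)) * z ^ j"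
        by (simp add: c_def rGamma_inverse_Gamma divide_inverse algebra_simps)
      also have "\<dots> = rGamma (\<gamma> * real j + \<mu> - 1) * z ^ j" by (simp only: rGamma_plus1)
      finally show ?thesis by (simp add: rGamma_inverse_Gamma divide_inverse add_diff_eq)
    qed
    ultimately show ?thesis by (simp add: mittag_leffler_def sums_iff)
  qed
  with D that show thesis by blast
qed

lemma ml_fun_has_derivative:
  assumes "1 < \<gamma>" "\<gamma> < 2" "0 < t"
  shows "(ml_fun \<gamma> \<mu> m has_real_derivative ml_fun \<gamma> (\<mu> - 1) m t) (at t)"
proof -
  obtain D where D: "\<And>z. (mittag_leffler \<gamma> \<mu> has_real_derivative D z) (at z)"
    "\<And>z. (\<mu> - 1) * mittag_leffler \<gamma> \<mu> z + \<gamma> * z * D z = mittag_leffler \<gamma> (\<mu> - 1) z"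
    using mittag_leffler_derivative[OF assms(1,2)] by metis
  let ?z = "- m * t powr \<gamma>"
  have p: "((\<lambda>t. t powr a) has_real_derivative a * t powr (a - 1)) (at t)" for a
    using has_real_derivative_powr[OF assms(3)] by simp
  have "((\<lambda>t. mittag_leffler \<gamma> \<mu> (- m * t powr \<gamma>)) has_real_derivative D ?z * (- m * (\<gamma> * t powr (\<gamma> - 1)))) (at t)"
    by (intro DERIV_chain2[OF D(1)] DERIV_cmult p)
  from DERIV_mult[OF p[of "\<mu> - 1"] this]
  have "((\<lambda>t. t powr (\<mu> - 1) * mittag_leffler \<gamma> \<mu> (- m * t powr \<gamma>)) has_real_derivative
     (\<mu> - 1) * t powr (\<mu> - 1 - 1) * mittag_leffler \<gamma> \<mu> ?z + D ?z * (- m * (\<gamma> * t powr (\<gamma> - 1))) * t powr (\<mu> - 1)) (at t)" .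
  also have "(\<mu> - 1) * t powr (\<mu> - 1 - 1) * mittag_leffler \<gamma> \<mu> ?z + D ?z * (- m * (\<gamma> * t powr (\<gamma> - 1))) * t powr (\<mu> - 1)
      = t powr (\<mu> - 1 - 1) * ((\<mu> - 1) * mittag_leffler \<gamma> \<mu> ?z + \<gamma> * ?z * D ?z)"
    using assms(3) by (simp add: powr_diff field_simps eval_nat_numeral)
  also have "\<dots> = ml_fun \<gamma> (\<mu> - 1) m t" using assms(3) D(2)[of ?z] by (simp add: ml_fun_def)
  finally show ?thesis
    by (rule has_field_derivative_transform_within_open[of _ _ _ "{0<..}"])
      (use assms in \<open>auto simp: ml_fun_def\<close>)
qed

lemma ml_fun_bound:
  assumes "1 < \<gamma>" "\<gamma> < 2"
  obtains B where "0 < B" "\<And>m t. 0 \<le> m \<Longrightarrow> 0 < t \<Longrightarrow> \<bar>ml_fun \<gamma> \<mu> m t\<bar> \<le> B * t powr (\<mu> - 1) / (1 + m * t powr \<gamma>)"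
proof -
  obtain B where B: "0 < B" "\<And>x. 0 \<le> x \<Longrightarrow> \<bar>mittag_leffler \<gamma> \<mu> (- x)\<bar> \<le> B / (1 + x)"
    using mittag_leffler_bound[OF assms] by metis
  show thesis
  proof (rule that[OF B(1)])
    fix m t :: real assume "0 \<le> m" "0 < t"
    then show "\<bar>ml_fun \<gamma> \<mu> m t\<bar> \<le> B * t powr (\<mu> - 1) / (1 + m * t powr \<gamma>)"
      using mult_left_mono[OF B(2)[of "m * t powr \<gamma>"], of "t powr (\<mu> - 1)"]
      by (simp add: ml_fun_def abs_mult mult.commute)
  qed
qed

lemma ml_fun_bound':
  assumes "1 < \<gamma>" "\<gamma> < 2"
  obtains B where "0 < B" "\<And>m t. 0 \<le> m \<Longrightarrow> \<bar>ml_fun \<gamma> \<mu> m t\<bar> \<le> B * (if 0 < t then t powr (\<mu> - 1) else 0)"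
proof -
  obtain B where B: "0 < B" "\<And>m t. 0 \<le> m \<Longrightarrow> 0 < t \<Longrightarrow> \<bar>ml_fun \<gamma> \<mu> m t\<bar> \<le> B * t powr (\<mu> - 1) / (1 + m * t powr \<gamma>)"
    using ml_fun_bound[OF assms] by metis
  show thesis
  proof (rule that[OF B(1)])
    fix m t :: real assume m: "0 \<le> m"
    show "\<bar>ml_fun \<gamma> \<mu> m t\<bar> \<le> B * (if 0 < t then t powr (\<mu> - 1) else 0)"
    proof (cases "0 < t")
      case True
      have "B * t powr (\<mu> - 1) / (1 + m * t powr \<gamma>) \<le> B * t powr (\<mu> - 1) / 1"
        using B(1) m by (intro divide_left_mono) (auto intro: add_pos_nonneg)
      then show ?thesis using B(2)[OF m True] True by simp
    qed (simp add: ml_fun_def)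
  qed
qed

lemma ml_fun_nonpos [simp]: "t \<le> 0 \<Longrightarrow> ml_fun \<gamma> \<mu> m t = 0"
  by (simp add: ml_fun_def)

lemma continuous_on_ml_fun_pos:
  assumes "1 < \<gamma>" "\<gamma> < 2"
  shows "continuous_on {0<..} (ml_fun \<gamma> \<mu> m)"
  by (rule DERIV_continuous_on) (auto intro: has_field_derivative_at_within ml_fun_has_derivative[OF assms])

lemma continuous_on_ml_fun:
  assumes "1 < \<gamma>" "\<gamma> < 2" "1 < \<mu>" "0 \<le> m"
  shows "continuous_on UNIV (ml_fun \<gamma> \<mu> m)"
proof -
  have "isCont (ml_fun \<gamma> \<mu> m) t" for t
  proof -
    consider "t < 0" | "t = 0" | "0 < t" by linarith
    then show ?thesis
    proof cases
      case 1
      have "\<forall>\<^sub>F x in at t. ml_fun \<gamma> \<mu> m x = ml_fun \<gamma> \<mu> m t"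
        using eventually_at_in_open'[of "{..<0}" t] 1 by (auto elim!: eventually_mono)
      then show ?thesis unfolding isCont_def by (rule tendsto_eventually)
    next
      case 2
      obtain B where B: "0 < B" "\<And>t. \<bar>ml_fun \<gamma> \<mu> m t\<bar> \<le> B * (if 0 < t then t powr (\<mu> - 1) else 0)"
        using ml_fun_bound'[OF assms(1,2)] assms(4) by metis
      have "((\<lambda>x. B * \<bar>x\<bar> powr (\<mu> - 1)) \<longlongrightarrow> 0) (at 0)"
        using assms(3) tendsto_mult_right_zero[OF tendsto_zero_powrI[OF tendsto_rabs_zero[OF tendsto_ident_at] tendsto_const]]
        by simp
      moreover have "\<forall>\<^sub>F x in at 0. norm (ml_fun \<gamma> \<mu> m x) \<le> B * \<bar>x\<bar> powr (\<mu> - 1)"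
        using B order_trans[OF B(2)] by (intro always_eventually allI) (fastforce intro: order_trans[OF B(2)])
      ultimately have "(ml_fun \<gamma> \<mu> m \<longlongrightarrow> 0) (at 0)" by (rule Lim_null_comparison[rotated])
      then show ?thesis using 2 by (simp add: isCont_def)
    next
      case 3
      then show ?thesis by (rule DERIV_isCont[OF ml_fun_has_derivative[OF assms(1,2)]])
    qed
  qed
  then show ?thesis by (simp add: continuous_on_eq_continuous_at)
qed

lemma borel_measurable_ml_fun [measurable]:
  assumes "1 < \<gamma>" "\<gamma> < 2"
  shows "ml_fun \<gamma> \<mu> m \<in> borel_measurable borel"
proof -
  have "(\<lambda>t. indicator {0<..} t *\<^sub>R ml_fun \<gamma> \<mu> m t) \<in> borel_measurable borel"
    by (rule borel_measurable_continuous_on_indicator[OF _ continuous_on_ml_fun_pos[OF assms]]) simp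
  also have "(\<lambda>t. indicator {0<..} t *\<^sub>R ml_fun \<gamma> \<mu> m t) = ml_fun \<gamma> \<mu> m"
    by (auto simp: indicator_def fun_eq_iff not_less)
  finally show ?thesis .
qed

section \<open>Convolutions on a time interval\<close>

lemma integrable_lebesgue_on_nonneg:
  fixes f :: "'a::euclidean_space \<Rightarrow> real"
  assumes "(f has_integral v) S" "\<And>x. x \<in> S \<Longrightarrow> 0 \<le> f x" "S \<in> sets lebesgue"
  shows "integrable (lebesgue_on S) f" "(\<integral>x. f x \<partial>lebesgue_on S) = v"
proof -
  have "f absolutely_integrable_on S"
    using assms by (intro nonnegative_absolutely_integrable_1) auto
  then show i: "integrable (lebesgue_on S) f"
    using assms by (simp add: set_integrable_def integrable_restrict_space)
  show "(\<integral>x. f x \<partial>lebesgue_on S) = v"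
    using lebesgue_integral_eq_integral[OF i assms(3)] integral_unique[OF assms(1)] by simp
qed

lemma DERIV_translate:
  "(F has_real_derivative d) (at (t - r)) \<Longrightarrow> ((\<lambda>t. F (t - r)) has_real_derivative d) (at t)"
  using DERIV_shift[of F d t "- r"] by simp

lemma DERIV_reflect:
  assumes "(F has_real_derivative d) (at (t - r))"
  shows "((\<lambda>r. F (t - r)) has_real_derivative - d) (at r)"
proof -
  have "((\<lambda>r. t - r) has_real_derivative - 1) (at r)" by (auto intro!: derivative_eq_intros)
  from DERIV_chain[of F d "\<lambda>r. t - r", OF assms this] show ?thesis by (simp add: o_def)
qed

lemma integral_Ioo_eq_diff:
  fixes F f :: "real \<Rightarrow> real"
  assumes "a \<le> b" "finite S" "continuous_on {a..b} F"
    and "\<And>x. x \<in> {a<..<b} - S \<Longrightarrow> (F has_real_derivative f x) (at x)"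
    and "integrable (lebesgue_on {a<..<b}) f"
  shows "(\<integral>x. f x \<partial>lebesgue_on {a<..<b}) = F b - F a"
proof -
  have "(f has_integral (F b - F a)) {a..b}"
    using assms by (intro fundamental_theorem_of_calculus_interior_strong[of S])
      (auto simp: has_real_derivative_iff_has_vector_derivative)
  then have "(f has_integral (F b - F a)) {a<..<b}" by (simp add: has_integral_Icc_iff_Ioo)
  then show ?thesis using lebesgue_integral_eq_integral[OF assms(5)] by (simp add: integral_unique)
qed

text \<open>
  The prototype of a kernel of fractional integration, up to the factor \<open>1 / \<Gamma>(a)\<close>.
\<close>

definition pow_kernel :: "real \<Rightarrow> real \<Rightarrow> real" where
  "pow_kernel a x = (if 0 < x then x powr (a - 1) else 0)"

lemma pow_kernel_nonneg: "0 \<le> pow_kernel a x"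
  by (simp add: pow_kernel_def)

lemma borel_measurable_pow_kernel [measurable]: "pow_kernel a \<in> borel_measurable borel"
  unfolding pow_kernel_def by measurable

lemma pow_kernel_primitive:
  assumes "x \<noteq> 0" "0 < a"
  shows "((\<lambda>x. pow_kernel (a + 1) x / a) has_real_derivative pow_kernel a x) (at x)"
proof (cases "0 < x")
  case True
  have "((\<lambda>x. x powr a / a) has_real_derivative pow_kernel a x) (at x)"
    using DERIV_cdivide[OF has_real_derivative_powr[OF True, of a], of a] assms True
    by (simp add: pow_kernel_def)
  then show ?thesis
    by (rule has_field_derivative_transform_within_open[where S = "{0<..}"])
      (use True in \<open>simp_all add: pow_kernel_def\<close>)
next
  case False
  have "((\<lambda>x. 0) has_real_derivative pow_kernel a x) (at x)" using False by (simp add: pow_kernel_def)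
  then show ?thesis
    by (rule has_field_derivative_transform_within_open[where S = "{..<0}"])
      (use False assms in \<open>simp_all add: pow_kernel_def\<close>)
qed

lemma continuous_on_pow_kernel:
  assumes "0 < a"
  shows "continuous_on UNIV (pow_kernel (a + 1))"
proof -
  have "pow_kernel (a + 1) = (\<lambda>x. max 0 x powr a)" using assms by (auto simp: pow_kernel_def fun_eq_iff)
  moreover have "continuous_on UNIV (\<lambda>x. max 0 x powr a)"
    using assms by (intro continuous_on_powr' continuous_intros) auto
  ultimately show ?thesis by simp
qed

lemma pow_kernel_mono: "0 < a \<Longrightarrow> x \<le> y \<Longrightarrow> pow_kernel (a + 1) x \<le> pow_kernel (a + 1) y"
  by (auto simp: pow_kernel_def intro: powr_mono2)

lemma pow_kernel_integral:
  assumes "0 < a" "0 < T"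
  shows "integrable (lebesgue_on {0<..<T}) (\<lambda>t. pow_kernel a (t - r))"
    and "0 \<le> r \<Longrightarrow> (\<integral>t. pow_kernel a (t - r) \<partial>lebesgue_on {0<..<T}) \<le> T powr a / a"
    and "integrable (lebesgue_on {0<..<T}) (\<lambda>r. pow_kernel a (t - r))"
    and "t \<le> T \<Longrightarrow> (\<integral>r. pow_kernel a (t - r) \<partial>lebesgue_on {0<..<T}) \<le> T powr a / a"
proof -
  have le: "pow_kernel (a + 1) x / a \<le> T powr a / a" if "x \<le> T" for x
    using pow_kernel_mono[OF assms(1) that] assms by (simp add: pow_kernel_def divide_right_mono)
  have ge: "0 \<le> pow_kernel (a + 1) x / a" for x using assms by (simp add: pow_kernel_nonneg)
  have cont: "continuous_on A (\<lambda>x. pow_kernel (a + 1) (f x) / a)" if "continuous_on A f" for A and f :: "real \<Rightarrow> real"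
    using assms by (intro continuous_on_divide continuous_on_const continuous_on_compose2[OF continuous_on_pow_kernel that]) auto
  have "((\<lambda>t. pow_kernel a (t - r)) has_integral (pow_kernel (a + 1) (T - r) / a - pow_kernel (a + 1) (0 - r) / a)) {0..T}"
  proof (rule fundamental_theorem_of_calculus_interior_strong[of "{r}"])
    fix t assume "t \<in> {0<..<T} - {r}"
    then have "((\<lambda>x. pow_kernel (a + 1) x / a) has_real_derivative pow_kernel a (t - r)) (at (t - r))"
      using assms by (intro pow_kernel_primitive) auto
    then show "((\<lambda>t. pow_kernel (a + 1) (t - r) / a) has_vector_derivative pow_kernel a (t - r)) (at t)"
      unfolding has_real_derivative_iff_has_vector_derivative[symmetric] by (rule DERIV_translate)
  qed (use assms in \<open>auto intro!: cont continuous_intros\<close>)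
  then have "((\<lambda>t. pow_kernel a (t - r)) has_integral (pow_kernel (a + 1) (T - r) / a - pow_kernel (a + 1) (0 - r) / a)) {0<..<T}"
    by (simp add: has_integral_Icc_iff_Ioo)
  note 1 = integrable_lebesgue_on_nonneg[OF this pow_kernel_nonneg]
  show "integrable (lebesgue_on {0<..<T}) (\<lambda>t. pow_kernel a (t - r))" using 1(1) by simp
  show "(\<integral>t. pow_kernel a (t - r) \<partial>lebesgue_on {0<..<T}) \<le> T powr a / a" if "0 \<le> r"
    using 1(2) le[of "T - r"] ge[of "0 - r"] that by simp
  have "((\<lambda>r. pow_kernel a (t - r)) has_integral (- (pow_kernel (a + 1) (t - T) / a) - - (pow_kernel (a + 1) (t - 0) / a))) {0..T}"
  proof (rule fundamental_theorem_of_calculus_interior_strong[of "{t}"])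
    fix r assume "r \<in> {0<..<T} - {t}"
    then have "((\<lambda>x. pow_kernel (a + 1) x / a) has_real_derivative pow_kernel a (t - r)) (at (t - r))"
      using assms by (intro pow_kernel_primitive) auto
    from DERIV_minus[OF DERIV_reflect[OF this]]
    show "((\<lambda>r. - (pow_kernel (a + 1) (t - r) / a)) has_vector_derivative pow_kernel a (t - r)) (at r)"
      unfolding has_real_derivative_iff_has_vector_derivative[symmetric] by simp
  qed (use assms in \<open>auto intro!: cont continuous_intros\<close>)
  then have "((\<lambda>r. pow_kernel a (t - r)) has_integral (- (pow_kernel (a + 1) (t - T) / a) - - (pow_kernel (a + 1) (t - 0) / a))) {0<..<T}"
    by (simp add: has_integral_Icc_iff_Ioo)
  note 2 = integrable_lebesgue_on_nonneg[OF this pow_kernel_nonneg]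
  show "integrable (lebesgue_on {0<..<T}) (\<lambda>r. pow_kernel a (t - r))" using 2(1) by simp
  show "(\<integral>r. pow_kernel a (t - r) \<partial>lebesgue_on {0<..<T}) \<le> T powr a / a" if "t \<le> T"
    using 2(2) le[of t] ge[of "t - T"] that by simp
qed

text \<open>
  Kernels that vanish for negative arguments and have at worst an integrable power singularity at \<open>0\<close>.
\<close>

definition dominated_kernel :: "real \<Rightarrow> real \<Rightarrow> (real \<Rightarrow> real) \<Rightarrow> bool" where
  "dominated_kernel B a K \<longleftrightarrow> 0 < a \<and> 0 \<le> B \<and> K \<in> borel_measurable borel \<and> (\<forall>x. \<bar>K x\<bar> \<le> B * pow_kernel a x)"

text \<open>
  For a kernel that vanishes on \<open>x \<le> 0\<close> this is the usual causal convolution, the integral over \<open>(0, t)\<close>.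
\<close>

definition conv :: "real \<Rightarrow> (real \<Rightarrow> real) \<Rightarrow> (real \<Rightarrow> real) \<Rightarrow> real \<Rightarrow> real" where
  "conv T K w t = (\<integral>r. K (t - r) * w r \<partial>lebesgue_on {0<..<T})"

lemma id_measurable_lebesgue_on [measurable]: "(\<lambda>x. x) \<in> lebesgue_on S \<rightarrow>\<^sub>M (borel :: 'a::euclidean_space measure)"
  by (rule measurable_restrict_space1) (simp add: measurable_completion)

locale time_interval =
  fixes T :: real
  assumes T: "0 < T"
begin

abbreviation "M \<equiv> lebesgue_on {0<..<T}"

sublocale M: finite_measure M
  by (rule finite_measure_lebesgue_on) simp

sublocale MM: pair_sigma_finite M M ..

lemma integrable_mult_bounded:
  fixes f g :: "real \<Rightarrow> real"
  assumes "integrable M f" "g \<in> borel_measurable M" "\<And>x. x \<in> {0<..<T} \<Longrightarrow> \<bar>g x\<bar> \<le> C"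
  shows "integrable M (\<lambda>x. g x * f x)"
proof (rule Bochner_Integration.integrable_bound)
  show "integrable M (\<lambda>x. C * f x)" using assms(1) by simp
  show "(\<lambda>x. g x * f x) \<in> borel_measurable M" using assms by measurable
  show "AE x in M. norm (g x * f x) \<le> norm (C * f x)"
  proof (rule AE_I2)
    fix x assume "x \<in> space M"
    then have "\<bar>g x\<bar> \<le> C" using assms(3) by simp
    then have "\<bar>g x\<bar> * \<bar>f x\<bar> \<le> \<bar>C\<bar> * \<bar>f x\<bar>" by (intro mult_right_mono) auto
    then show "norm (g x * f x) \<le> norm (C * f x)" by (simp add: abs_mult)
  qed
qed

lemma kernel_integrable:
  assumes "dominated_kernel B a K"
  shows "integrable M (\<lambda>t. K (t - r))" "0 \<le> r \<Longrightarrow> (\<integral>t. \<bar>K (t - r)\<bar> \<partial>M) \<le> B * (T powr a / a)"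
    "integrable M (\<lambda>r. K (t - r))" "t \<le> T \<Longrightarrow> (\<integral>r. \<bar>K (t - r)\<bar> \<partial>M) \<le> B * (T powr a / a)"
proof -
  have a: "0 < a" "0 \<le> B" and [measurable]: "K \<in> borel_measurable borel" and K: "\<And>x. \<bar>K x\<bar> \<le> B * pow_kernel a x"
    using assms by (auto simp: dominated_kernel_def)
  note p = pow_kernel_integral[OF a(1) T]
  have K': "\<bar>K x\<bar> \<le> \<bar>B * pow_kernel a x\<bar>" for x by (rule order_trans[OF K]) simp
  show i: "integrable M (\<lambda>t. K (t - r))" for r
    by (rule Bochner_Integration.integrable_bound[OF integrable_mult_right[OF p(1), of B]]) (use K' in auto)
  show j: "integrable M (\<lambda>r. K (t - r))" for t
    by (rule Bochner_Integration.integrable_bound[OF integrable_mult_right[OF p(3), of B]]) (use K' in auto)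
  show "(\<integral>t. \<bar>K (t - r)\<bar> \<partial>M) \<le> B * (T powr a / a)" if "0 \<le> r"
  proof -
    have "(\<integral>t. \<bar>K (t - r)\<bar> \<partial>M) \<le> (\<integral>t. B * pow_kernel a (t - r) \<partial>M)"
      using i p by (intro integral_mono K) auto
    also have "\<dots> \<le> B * (T powr a / a)" using mult_left_mono[OF p(2)[OF that] a(2)] by simp
    finally show ?thesis .
  qed
  show "(\<integral>r. \<bar>K (t - r)\<bar> \<partial>M) \<le> B * (T powr a / a)" if "t \<le> T"
  proof -
    have "(\<integral>r. \<bar>K (t - r)\<bar> \<partial>M) \<le> (\<integral>r. B * pow_kernel a (t - r) \<partial>M)"
      using j p by (intro integral_mono K) auto
    also have "\<dots> \<le> B * (T powr a / a)" using mult_left_mono[OF p(4)[OF that] a(2)] by simp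
    finally show ?thesis .
  qed
qed

lemma kernel_product_integrable:
  assumes K: "dominated_kernel B a K" and W: "integrable M W"
    and \<psi>: "\<psi> \<in> borel_measurable M" "\<And>x. x \<in> {0<..<T} \<Longrightarrow> \<bar>\<psi> x\<bar> \<le> C"
  shows "integrable (M \<Otimes>\<^sub>M M) (\<lambda>(r, t). \<psi> t * (K (t - r) * W r))"
proof (rule MM.Fubini_integrable)
  note [measurable] = \<psi>(1)
  have [measurable]: "K \<in> borel_measurable borel" "W \<in> borel_measurable M"
    using K W by (auto simp: dominated_kernel_def)
  show "(\<lambda>(r, t). \<psi> t * (K (t - r) * W r)) \<in> borel_measurable (M \<Otimes>\<^sub>M M)" by measurable
  have bd: "integrable M (\<lambda>t. \<psi> t * K (t - r))" for r
    by (rule integrable_mult_bounded[OF kernel_integrable(1)[OF K] \<psi>])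
  have C: "0 \<le> C" using \<psi>(2)[of "T / 2"] T by auto
  have in1: "(\<integral>t. \<bar>\<psi> t * K (t - r)\<bar> \<partial>M) \<le> C * (B * (T powr a / a))" if "r \<in> {0<..<T}" for r
  proof -
    have "(\<integral>t. \<bar>\<psi> t * K (t - r)\<bar> \<partial>M) \<le> (\<integral>t. C * \<bar>K (t - r)\<bar> \<partial>M)"
    proof (rule integral_mono)
      show "integrable M (\<lambda>t. \<bar>\<psi> t * K (t - r)\<bar>)" using bd by (rule integrable_abs)
      show "integrable M (\<lambda>t. C * \<bar>K (t - r)\<bar>)" using kernel_integrable(1)[OF K] by simp
      show "\<bar>\<psi> t * K (t - r)\<bar> \<le> C * \<bar>K (t - r)\<bar>" if "t \<in> space M" for t
        using that \<psi>(2)[of t] by (simp add: abs_mult mult_right_mono)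
    qed
    also have "\<dots> \<le> C * (B * (T powr a / a))"
      using mult_left_mono[OF kernel_integrable(2)[OF K, of r] C] that by simp
    finally show ?thesis .
  qed
  show "integrable M (\<lambda>r. \<integral>t. norm (case (r, t) of (r, t) \<Rightarrow> \<psi> t * (K (t - r) * W r)) \<partial>M)"
  proof (rule Bochner_Integration.integrable_bound)
    show "integrable M (\<lambda>r. C * (B * (T powr a / a)) * W r)" using W by simp
    show "AE r in M. norm (\<integral>t. norm (case (r, t) of (r, t) \<Rightarrow> \<psi> t * (K (t - r) * W r)) \<partial>M)
        \<le> norm (C * (B * (T powr a / a)) * W r)"
    proof (rule AE_I2)
      fix r assume "r \<in> space M"
      then have r: "r \<in> {0<..<T}" by simp
      have "(\<integral>t. norm (case (r, t) of (r, t) \<Rightarrow> \<psi> t * (K (t - r) * W r)) \<partial>M) = (\<integral>t. \<bar>\<psi> t * K (t - r)\<bar> \<partial>M) * \<bar>W r\<bar>"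
        by (subst integral_mult_left_zero[symmetric]) (simp add: abs_mult mult.assoc)
      also have "\<dots> \<le> C * (B * (T powr a / a)) * \<bar>W r\<bar>" by (intro mult_right_mono in1 r) auto
      also have "\<dots> \<le> \<bar>C * (B * (T powr a / a))\<bar> * \<bar>W r\<bar>"
        by (intro mult_right_mono abs_ge_self abs_ge_zero)
      finally have "(\<integral>t. norm (case (r, t) of (r, t) \<Rightarrow> \<psi> t * (K (t - r) * W r)) \<partial>M)
        \<le> norm (C * (B * (T powr a / a)) * W r)" unfolding real_norm_def abs_mult[of _ "W r"] .
      then show "norm (\<integral>t. norm (case (r, t) of (r, t) \<Rightarrow> \<psi> t * (K (t - r) * W r)) \<partial>M)
        \<le> norm (C * (B * (T powr a / a)) * W r)"
        by (subst real_norm_def, subst abs_of_nonneg) auto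
    qed
  qed measurable
  show "AE r in M. integrable M (\<lambda>t. case (r, t) of (r, t) \<Rightarrow> \<psi> t * (K (t - r) * W r))"
    using integrable_mult_left[OF bd] by (simp add: mult.assoc)
qed

text \<open>
  Convolution is tested against bounded functions by moving it to the other factor (Fubini).
\<close>

lemma conv_swap:
  assumes K: "dominated_kernel B a K" and W: "integrable M W"
    and \<psi>: "\<psi> \<in> borel_measurable M" "\<And>x. x \<in> {0<..<T} \<Longrightarrow> \<bar>\<psi> x\<bar> \<le> C"
  shows "integrable M (\<lambda>t. \<psi> t * conv T K W t)"
    and "(\<integral>t. \<psi> t * conv T K W t \<partial>M) = (\<integral>r. W r * (\<integral>t. \<psi> t * K (t - r) \<partial>M) \<partial>M)"
proof -
  note i = kernel_product_integrable[OF assms]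
  show "integrable M (\<lambda>t. \<psi> t * conv T K W t)"
    using MM.integrable_snd[OF i] by (simp add: conv_def)
  have "(\<integral>t. \<psi> t * conv T K W t \<partial>M) = (\<integral>t. (\<integral>r. \<psi> t * (K (t - r) * W r) \<partial>M) \<partial>M)"
    by (simp add: conv_def)
  also have "\<dots> = (\<integral>r. (\<integral>t. \<psi> t * (K (t - r) * W r) \<partial>M) \<partial>M)"
    by (rule MM.Fubini_integral[OF i])
  also have "\<dots> = (\<integral>r. W r * (\<integral>t. \<psi> t * K (t - r) \<partial>M) \<partial>M)"
    by (subst integral_mult_right_zero[symmetric]) (simp add: mult_ac)
  finally show "(\<integral>t. \<psi> t * conv T K W t \<partial>M) = (\<integral>r. W r * (\<integral>t. \<psi> t * K (t - r) \<partial>M) \<partial>M)" .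
qed

lemma conv_integrable:
  assumes "dominated_kernel B a K" "integrable M W"
  shows "integrable M (conv T K W)"
  using conv_swap(1)[OF assms, of "\<lambda>_. 1" 1] by simp

lemma square_integrable_imp_integrable:
  assumes "W \<in> borel_measurable M" "integrable M (\<lambda>t. (W t)\<^sup>2 :: real)"
  shows "integrable M W"
proof (rule Bochner_Integration.integrable_bound)
  show "integrable M (\<lambda>t. 1 + (W t)\<^sup>2)" using assms by simp
  have "\<bar>x\<bar> \<le> \<bar>1 + x\<^sup>2\<bar>" for x :: real
  proof -
    have "0 \<le> (\<bar>x\<bar> - 1)\<^sup>2" by simp
    then show ?thesis unfolding power2_diff power2_abs by (simp add: power2_eq_square)
  qed
  then show "AE t in M. norm (W t) \<le> norm (1 + (W t)\<^sup>2)" by simp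
qed (use assms in auto)

text \<open>
  Cauchy-Schwarz for the weight \<open>\<bar>k\<bar>\<close>, obtained from \<open>2 * s * \<bar>w\<bar> \<le> s\<^sup>2 + w\<^sup>2\<close> with the number \<open>s\<close> that
  optimises the result.
\<close>

lemma square_integral_le:
  fixes k w :: "real \<Rightarrow> real"
  assumes k: "integrable M k" "(\<integral>r. \<bar>k r\<bar> \<partial>M) \<le> \<kappa>" "0 < \<kappa>"
    and kw: "integrable M (\<lambda>r. \<bar>k r\<bar> * (w r)\<^sup>2)" and w: "w \<in> borel_measurable M"
  shows "(\<integral>r. k r * w r \<partial>M)\<^sup>2 \<le> \<kappa> * (\<integral>r. \<bar>k r\<bar> * (w r)\<^sup>2 \<partial>M)"
proof -
  have i: "integrable M (\<lambda>r. \<bar>k r\<bar> * \<bar>w r\<bar>)"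
  proof (rule Bochner_Integration.integrable_bound)
    show "integrable M (\<lambda>r. \<bar>k r\<bar> + \<bar>k r\<bar> * (w r)\<^sup>2)" using k kw by simp
    have "x * \<bar>y\<bar> \<le> x + x * y\<^sup>2" if "0 \<le> x" for x y :: real
    proof -
      have "0 \<le> (\<bar>y\<bar> - 1)\<^sup>2" by simp
      then have "\<bar>y\<bar> \<le> 1 + y\<^sup>2" unfolding power2_diff power2_abs by (simp add: power2_eq_square)
      from mult_left_mono[OF this that] show ?thesis by (simp add: algebra_simps)
    qed
    then show "AE r in M. norm (\<bar>k r\<bar> * \<bar>w r\<bar>) \<le> norm (\<bar>k r\<bar> + \<bar>k r\<bar> * (w r)\<^sup>2)" by (simp add: abs_mult)
  qed (use k w in auto)
  define S where "S = (\<integral>r. \<bar>k r\<bar> * \<bar>w r\<bar> \<partial>M)"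
  define s where "s = S / \<kappa>"
  have "2 * s * S = (\<integral>r. 2 * s * (\<bar>k r\<bar> * \<bar>w r\<bar>) \<partial>M)" by (simp add: S_def)
  also have "\<dots> \<le> (\<integral>r. s\<^sup>2 * \<bar>k r\<bar> + \<bar>k r\<bar> * (w r)\<^sup>2 \<partial>M)"
  proof (rule integral_mono)
    show "2 * s * (\<bar>k r\<bar> * \<bar>w r\<bar>) \<le> s\<^sup>2 * \<bar>k r\<bar> + \<bar>k r\<bar> * (w r)\<^sup>2" for r
    proof -
      have "0 \<le> \<bar>k r\<bar> * (s - \<bar>w r\<bar>)\<^sup>2" by simp
      then show ?thesis unfolding power2_diff power2_abs by (simp add: algebra_simps)
    qed
  qed (use i k kw in auto)
  also have "\<dots> = s\<^sup>2 * (\<integral>r. \<bar>k r\<bar> \<partial>M) + (\<integral>r. \<bar>k r\<bar> * (w r)\<^sup>2 \<partial>M)"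
    using k kw by simp
  also have "\<dots> \<le> s\<^sup>2 * \<kappa> + (\<integral>r. \<bar>k r\<bar> * (w r)\<^sup>2 \<partial>M)"
    using k by (intro add_right_mono mult_left_mono) auto
  finally have "S\<^sup>2 \<le> \<kappa> * (\<integral>r. \<bar>k r\<bar> * (w r)\<^sup>2 \<partial>M)"
    using k(3) by (simp add: s_def power2_eq_square field_simps)
  moreover have "\<bar>\<integral>r. k r * w r \<partial>M\<bar> \<le> S"
    unfolding S_def using integral_norm_bound[of M "\<lambda>r. k r * w r"] by (simp add: abs_mult)
  then have "(\<integral>r. k r * w r \<partial>M)\<^sup>2 \<le> S\<^sup>2" by (metis abs_ge_zero power2_abs power_mono)
  ultimately show ?thesis by linarith
qed

text \<open>
  Young's inequality \<open>\<parallel>K * W\<parallel>\<^sub>2 \<le> \<parallel>K\<parallel>\<^sub>1 \<parallel>W\<parallel>\<^sub>2\<close>: integrate the weighted Cauchy-Schwarz inequality over \<open>t\<close>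
  and exchange the integrals.
\<close>

lemma conv_square_integral:
  assumes K: "dominated_kernel B a K" and W: "W \<in> borel_measurable M" "integrable M (\<lambda>t. (W t)\<^sup>2)" and "0 < B"
  shows "integrable M (\<lambda>t. (conv T K W t)\<^sup>2)"
    and "(\<integral>t. (conv T K W t)\<^sup>2 \<partial>M) \<le> (B * (T powr a / a))\<^sup>2 * (\<integral>t. (W t)\<^sup>2 \<partial>M)"
proof -
  let ?\<kappa> = "B * (T powr a / a)" and ?A = "\<lambda>x. \<bar>K x\<bar>"
  have \<kappa>: "0 < ?\<kappa>" using K T \<open>0 < B\<close> by (simp add: dominated_kernel_def)
  have KA: "dominated_kernel B a ?A" using K by (auto simp: dominated_kernel_def)
  let ?g = "conv T ?A (\<lambda>t. (W t)\<^sup>2)"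
  note i = kernel_product_integrable[OF KA W(2), of "\<lambda>_. 1" 1, simplified]
  have ae: "AE t in M. integrable M (\<lambda>r. \<bar>K (t - r)\<bar> * (W r)\<^sup>2)"
    using MM.AE_integrable_snd[OF i] by simp
  have g: "integrable M ?g" by (rule conv_integrable[OF KA W(2)])
  have le: "AE t in M. (conv T K W t)\<^sup>2 \<le> ?\<kappa> * ?g t"
    using ae AE_space
  proof eventually_elim
    case (elim t)
    then show ?case unfolding conv_def
      by (intro square_integral_le kernel_integrable[OF K] \<kappa> W) auto
  qed
  have cm: "conv T K W \<in> borel_measurable M"
    using conv_integrable[OF K square_integrable_imp_integrable[OF W]] by simp
  show 1: "integrable M (\<lambda>t. (conv T K W t)\<^sup>2)"
  proof (rule Bochner_Integration.integrable_bound[of _ "\<lambda>t. ?\<kappa> * ?g t"])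
    show "AE t in M. norm ((conv T K W t)\<^sup>2) \<le> norm (?\<kappa> * ?g t)" using le
    proof eventually_elim
      case (elim t)
      then show ?case unfolding real_norm_def abs_power2 using abs_ge_self[of "?\<kappa> * ?g t"] by linarith
    qed
  qed (use g cm in auto)
  have "(\<integral>t. (conv T K W t)\<^sup>2 \<partial>M) \<le> (\<integral>t. ?\<kappa> * ?g t \<partial>M)"
    using 1 g le by (intro integral_mono_AE) auto
  also have "\<dots> = ?\<kappa> * (\<integral>r. (W r)\<^sup>2 * (\<integral>t. \<bar>K (t - r)\<bar> \<partial>M) \<partial>M)"
    using conv_swap(2)[OF KA W(2), of "\<lambda>_. 1" 1] by simp
  also have "\<dots> \<le> ?\<kappa> * (\<integral>r. (W r)\<^sup>2 * ?\<kappa> \<partial>M)"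
  proof (intro mult_left_mono integral_mono_AE')
    show "integrable M (\<lambda>r. (W r)\<^sup>2 * ?\<kappa>)" using W(2) by simp
    show "AE r in M. (W r)\<^sup>2 * (\<integral>t. \<bar>K (t - r)\<bar> \<partial>M) \<le> (W r)\<^sup>2 * ?\<kappa>"
      by (intro AE_I2 mult_left_mono kernel_integrable[OF K]) auto
    show "AE r in M. 0 \<le> (W r)\<^sup>2 * ?\<kappa>"
      by (intro AE_I2 mult_nonneg_nonneg less_imp_le[OF \<kappa>]) simp
  qed (use \<kappa> in auto)
  also have "\<dots> = ?\<kappa>\<^sup>2 * (\<integral>t. (W t)\<^sup>2 \<partial>M)" by (simp add: power2_eq_square)
  finally show "(\<integral>t. (conv T K W t)\<^sup>2 \<partial>M) \<le> ?\<kappa>\<^sup>2 * (\<integral>t. (W t)\<^sup>2 \<partial>M)" .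
qed

end

section \<open>Test functions on the line\<close>

lemma frechet_derivative_real:
  assumes "(f has_real_derivative d) (at x)"
  shows "frechet_derivative f (at x) h = d * h"
  using frechet_derivative_at[OF assms[unfolded has_field_derivative_def]] by metis

lemma Cm_Suc_real:
  fixes f :: "real \<Rightarrow> real"
  shows "Cm (Suc m) f \<longleftrightarrow> (\<forall>x. (f has_real_derivative deriv f x) (at x)) \<and> Cm m (deriv f)"
proof -
  have 1: "f differentiable (at x) \<longleftrightarrow> (f has_real_derivative deriv f x) (at x)" for x
    using DERIV_deriv_iff_real_differentiable[of f x] by simp
  have "(\<lambda>x. frechet_derivative f (at x) 1) = deriv f" if "\<forall>x. (f has_real_derivative deriv f x) (at x)"
    using frechet_derivative_real[OF that[rule_format]] by simp
  then show ?thesis by (auto simp: 1)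
qed

lemma Cm_Suc_DERIV:
  fixes f :: "real \<Rightarrow> real"
  assumes "\<And>x. (f has_real_derivative f' x) (at x)" "Cm m f'"
  shows "Cm (Suc m) f"
proof -
  have "deriv f = f'" using assms(1) by (auto intro: DERIV_imp_deriv)
  then show ?thesis using assms by (simp only: Cm_Suc_real) simp
qed

lemma Cm_pred: "Cm (Suc m) f \<Longrightarrow> Cm m f" for f :: "real \<Rightarrow> real"
proof (induction m arbitrary: f)
  case 0
  then show ?case by (auto simp: continuous_on_eq_continuous_at dest: differentiable_imp_continuous_within)
next
  case (Suc m)
  then show ?case using Cm_Suc_real by blast
qed

lemma Cm_const: "Cm m (\<lambda>x::real. c :: real)"
proof (induction m arbitrary: c)
  case (Suc m)
  show ?case by (rule Cm_Suc_DERIV[OF _ Suc[of 0]]) simp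
qed simp

lemma Cm_add: "Cm m f \<Longrightarrow> Cm m g \<Longrightarrow> Cm m (\<lambda>x. f x + g x)" for f g :: "real \<Rightarrow> real"
proof (induction m arbitrary: f g)
  case (Suc m)
  then have "Cm m (\<lambda>x. deriv f x + deriv g x)" by (intro Suc.IH) (simp_all only: Cm_Suc_real)
  with Suc.prems show ?case
    by (intro Cm_Suc_DERIV[of _ "\<lambda>x. deriv f x + deriv g x"] DERIV_add) (simp_all only: Cm_Suc_real)
qed (simp add: continuous_on_add)

lemma Cm_mult: "Cm m f \<Longrightarrow> Cm m g \<Longrightarrow> Cm m (\<lambda>x. f x * g x)" for f g :: "real \<Rightarrow> real"
proof (induction m arbitrary: f g)
  case (Suc m)
  have "Cm m f" "Cm m g" using Suc.prems by (auto intro: Cm_pred)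
  moreover have "Cm m (deriv f)" "Cm m (deriv g)" using Suc.prems by (simp_all only: Cm_Suc_real)
  ultimately have "Cm m (\<lambda>x. deriv f x * g x + deriv g x * f x)" by (intro Cm_add Suc.IH)
  with Suc.prems show ?case
    by (intro Cm_Suc_DERIV[of _ "\<lambda>x. deriv f x * g x + deriv g x * f x"] DERIV_mult) (simp_all only: Cm_Suc_real)
qed (simp add: continuous_on_mult)

lemma Cm_affine: "Cm m f \<Longrightarrow> Cm m (\<lambda>x. f (a * x + b))" for f :: "real \<Rightarrow> real"
proof (induction m arbitrary: f)
  case 0
  then show ?case by (auto intro!: continuous_on_compose2[of UNIV f] continuous_intros)
next
  case (Suc m)
  have d: "((\<lambda>x. f (a * x + b)) has_real_derivative a * deriv f (a * x + b)) (at x)" for x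
  proof -
    have "(f has_real_derivative deriv f (a * x + b)) (at (a * x + b))" using Suc.prems by (simp only: Cm_Suc_real)
    moreover have "((\<lambda>x. a * x + b) has_real_derivative a) (at x)" by (auto intro!: derivative_eq_intros)
    ultimately have "(f \<circ> (\<lambda>x. a * x + b) has_real_derivative deriv f (a * x + b) * a) (at x)" by (rule DERIV_chain)
    then show ?thesis unfolding o_def by (subst mult.commute)
  qed
  have "Cm m (\<lambda>x. deriv f (a * x + b))" using Suc.prems by (intro Suc.IH) (simp only: Cm_Suc_real)
  then show ?case by (intro Cm_Suc_DERIV[OF d] Cm_mult Cm_const)
qed

text \<open>
  The smooth functions \<open>exp (- 1 / x)\<close>, extended by \<open>0\<close>, times polynomials in \<open>1 / x\<close>.  The polynomial factors
  make the class closed under differentiation.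
\<close>

definition flat :: "real poly \<Rightarrow> real \<Rightarrow> real" where
  "flat p x = (if 0 < x then poly p (1 / x) * exp (- (1 / x)) else 0)"

lemma tendsto_poly_exp_0: "((\<lambda>y. y ^ k * poly p y * exp (- y)) \<longlongrightarrow> (0::real)) at_top"
proof (induction p arbitrary: k)
  case (pCons a p)
  have "((\<lambda>y. a * (y ^ k / exp y) + y ^ Suc k * poly p y * exp (- y)) \<longlongrightarrow> a * 0 + 0) at_top"
    by (intro tendsto_intros tendsto_power_div_exp_0 pCons.IH)
  then show ?case by (simp add: algebra_simps exp_minus divide_inverse)
qed simp

lemma tendsto_flat_at_0: "(flat p \<longlongrightarrow> 0) (at 0)"
proof (rule filterlim_split_at)
  show "(flat p \<longlongrightarrow> 0) (at_left 0)"
    by (rule tendsto_eventually) (auto simp: flat_def eventually_at_filter)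
  have "((\<lambda>x. poly p (inverse x) * exp (- (inverse x))) \<longlongrightarrow> 0) (at_right 0)"
    using filterlim_compose[OF tendsto_poly_exp_0[of 0 p] filterlim_inverse_at_top_right] by simp
  then show "(flat p \<longlongrightarrow> 0) (at_right 0)"
    by (rule Lim_transform_eventually) (auto simp: flat_def eventually_at_filter divide_inverse)
qed

lemma DERIV_flat: "(flat p has_real_derivative flat ([:0, 0, 1:] * (p - pderiv p)) x) (at x)"
proof -
  consider "x < 0" | "x = 0" | "0 < x" by linarith
  then show ?thesis
  proof cases
    case 1
    have "((\<lambda>x. 0) has_real_derivative flat ([:0, 0, 1:] * (p - pderiv p)) x) (at x)"
      using 1 by (simp add: flat_def)
    then show ?thesis
      by (rule has_field_derivative_transform_within_open[where S = "{..<0}"]) (use 1 in \<open>simp_all add: flat_def\<close>)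
  next
    case 2
    \<comment> \<open>The difference quotient at \<open>0\<close> is again a function of the class: dividing by \<open>h\<close> multiplies the
      polynomial by \<open>1 / h\<close>.\<close>
    have "(flat ([:0, 1:] * p) \<longlongrightarrow> 0) (at 0)" by (rule tendsto_flat_at_0)
    then have "((\<lambda>h. (flat p (0 + h) - flat p 0) / h) \<longlongrightarrow> 0) (at 0)"
      by (rule Lim_transform_eventually) (auto simp: flat_def eventually_at_filter divide_inverse)
    moreover have "flat ([:0, 0, 1:] * (p - pderiv p)) 0 = 0" by (simp add: flat_def)
    ultimately show ?thesis using 2 by (simp add: DERIV_def)
  next
    case 3
    have "((\<lambda>x. 1 / x) has_real_derivative - (1 / x)\<^sup>2) (at x)"
      using 3 by (auto intro!: derivative_eq_intros simp: power2_eq_square)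
    note i = this
    have "((\<lambda>x. poly p (1 / x) * exp (- (1 / x))) has_real_derivative
      poly (pderiv p) (1 / x) * - (1 / x)\<^sup>2 * exp (- (1 / x)) + exp (- (1 / x)) * - (- (1 / x)\<^sup>2) * poly p (1 / x)) (at x)"
      by (intro DERIV_mult DERIV_chain2[OF poly_DERIV i] DERIV_chain2[OF DERIV_exp] DERIV_minus i)
    also have "poly (pderiv p) (1 / x) * - (1 / x)\<^sup>2 * exp (- (1 / x)) + exp (- (1 / x)) * - (- (1 / x)\<^sup>2) * poly p (1 / x)
       = flat ([:0, 0, 1:] * (p - pderiv p)) x"
      using 3 by (simp add: flat_def algebra_simps power2_eq_square)
    finally show ?thesis
      by (rule has_field_derivative_transform_within_open[where S = "{0<..}"]) (use 3 in \<open>simp_all add: flat_def\<close>)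
  qed
qed

lemma Cm_flat: "Cm m (flat p)"
proof (induction m arbitrary: p)
  case 0
  show ?case using DERIV_continuous_on[of UNIV "flat p"] DERIV_flat by auto
next
  case (Suc m)
  show ?case by (rule Cm_Suc_DERIV[OF DERIV_flat Suc])
qed

text \<open>
  The product of \<open>exp (- 1 / y)\<close> for \<open>y = n * (x - c) - 1\<close> and \<open>y = n * (d - x) - 1\<close>, written with affine
  arguments.  The shift by \<open>1\<close> keeps the support at a distance \<open>1 / n\<close> from \<open>c\<close> and \<open>d\<close>.
\<close>

definition bump :: "real \<Rightarrow> real \<Rightarrow> nat \<Rightarrow> real \<Rightarrow> real" where
  "bump c d n x = flat [:1:] (real n * x + (- real n * c - 1)) * flat [:1:] (- real n * x + (real n * d - 1))"

lemma flat_one: "flat [:1:] x = (if 0 < x then exp (- (1 / x)) else 0)"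
  by (simp add: flat_def)

lemma bump_nonneg: "0 \<le> bump c d n x" and bump_le_1: "bump c d n x \<le> 1"
  by (auto simp: bump_def flat_one intro!: mult_le_one)

lemma bump_nonzeroD: assumes "bump c d n x \<noteq> 0" shows "0 < real n" "c + 1 / real n < x" "x < d - 1 / real n"
proof -
  have *: "0 < real n * x + (- real n * c - 1)" "0 < - real n * x + (real n * d - 1)"
    using assms by (auto simp: bump_def flat_one split: if_splits)
  then show n: "0 < real n" by (cases "n = 0") auto
  show "c + 1 / real n < x" "x < d - 1 / real n" using * n by (auto simp: field_simps)
qed

lemma bump_pos:
  assumes "c < x" "x < d" "1 / (x - c) < real n" "1 / (d - x) < real n"
  shows "0 < bump c d n x"
proof -
  have "0 < real n * x + (- real n * c - 1)" "0 < - real n * x + (real n * d - 1)"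
    using assms by (auto simp: field_simps)
  then show ?thesis by (simp add: bump_def flat_one)
qed

lemma test_functionI:
  fixes \<psi> :: "real \<Rightarrow> real"
  assumes "\<And>m. Cm m \<psi>" "\<And>x. \<psi> x \<noteq> 0 \<Longrightarrow> a \<le> x \<and> x \<le> b" "{a..b} \<subseteq> S"
  shows "test_function S \<psi>"
proof -
  have "closure {x. \<psi> x \<noteq> 0} \<subseteq> {a..b}" using assms(2) by (intro closure_minimal) auto
  moreover have "bounded {x. \<psi> x \<noteq> 0}"
    by (rule bounded_subset[OF bounded_closed_interval[of a b]]) (use assms(2) in auto)
  ultimately show ?thesis unfolding test_function_def using assms(1,3) by (simp add: order_trans)
qed

lemma test_function_bump:
  assumes "0 \<le> c" "d \<le> T"
  shows "test_function {0<..<T} (bump c d n)"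
proof (cases "n = 0")
  case True
  then have "bump c d n = (\<lambda>x. 0)" by (simp add: fun_eq_iff bump_def flat_one)
  then show ?thesis by (intro test_functionI[of _ 1 0]) (auto intro: Cm_const)
next
  case False
  show ?thesis
  proof (rule test_functionI)
    show "Cm m (bump c d n)" for m unfolding bump_def by (intro Cm_mult Cm_affine Cm_flat)
    show "c + 1 / real n \<le> x \<and> x \<le> d - 1 / real n" if "bump c d n x \<noteq> 0" for x
      using bump_nonzeroD[OF that] by auto
    have n: "0 < 1 / real n" using False by simp
    show "{c + 1 / real n..d - 1 / real n} \<subseteq> {0<..<T}"
    proof
      fix x assume "x \<in> {c + 1 / real n..d - 1 / real n}"
      then have "c + 1 / real n \<le> x" "x \<le> d - 1 / real n" by simp_all
      with n assms have "0 < x" "x < T" by linarith+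
      then show "x \<in> {0<..<T}" by simp
    qed
  qed
qed

lemma LIMSEQ_bump: "(\<lambda>n. bump c d n x) \<longlonglongrightarrow> indicator {c<..<d} x"
proof (cases "c < x \<and> x < d")
  case True
  have lim: "(\<lambda>n. flat [:1:] (real n * a - 1)) \<longlonglongrightarrow> 1" if "0 < a" for a
  proof -
    have *: "filterlim (\<lambda>n. - 1 + real n * a) at_top sequentially"
      using that by (intro filterlim_tendsto_add_at_top[OF tendsto_const]
        filterlim_at_top_mult_tendsto_pos[OF tendsto_const] filterlim_real_sequentially)
    have "(\<lambda>n. exp (- inverse (- 1 + real n * a))) \<longlonglongrightarrow> exp (- 0)"
      by (intro tendsto_intros tendsto_inverse_0_at_top *)
    moreover have "\<forall>\<^sub>F n in sequentially. 0 < - 1 + real n * a" using * unfolding filterlim_at_top_dense by blast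
    then have "\<forall>\<^sub>F n in sequentially. exp (- inverse (- 1 + real n * a)) = flat [:1:] (real n * a - 1)"
      by eventually_elim (simp add: flat_one divide_inverse)
    ultimately show ?thesis by (simp add: Lim_transform_eventually)
  qed
  have "(\<lambda>n. flat [:1:] (real n * (x - c) - 1) * flat [:1:] (real n * (d - x) - 1)) \<longlonglongrightarrow> 1 * 1"
    using True by (intro tendsto_mult lim) auto
  then show ?thesis using True by (simp add: bump_def algebra_simps)
next
  case False
  have "bump c d n x = 0" for n
  proof (rule ccontr)
    assume "bump c d n x \<noteq> 0"
    note * = bump_nonzeroD[OF this]
    have "0 < 1 / real n" using * by simp
    with * False show False by auto
  qed
  then show ?thesis using False by (auto simp: indicator_def)
qed

lemma test_function_real:
  fixes \<psi> :: "real \<Rightarrow> real"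
  assumes "test_function {0<..<T} \<psi>" "0 < T"
  shows test_function_DERIV: "(\<psi> has_real_derivative deriv \<psi> x) (at x)"
    and test_function_deriv: "test_function {0<..<T} (deriv \<psi>)"
    and test_function_continuous: "continuous_on UNIV \<psi>"
    and test_function_support: "\<exists>a b. 0 < a \<and> a \<le> b \<and> b < T \<and> (\<forall>x. x \<notin> {a..b} \<longrightarrow> \<psi> x = 0)"
    and test_function_bounded: "\<exists>C. \<forall>x. \<bar>\<psi> x\<bar> \<le> C"
proof -
  have C: "Cm m \<psi>" for m using assms by (simp add: test_function_def)
  show D: "(\<psi> has_real_derivative deriv \<psi> x) (at x)" for x using C[of "Suc 0"] by (simp only: Cm_Suc_real)
  show cont: "continuous_on UNIV \<psi>" using C[of 0] by simp
  let ?S = "closure {x. \<psi> x \<noteq> 0}"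
  have S: "compact ?S" "?S \<subseteq> {0<..<T}" using assms by (auto simp: test_function_def)
  have "\<exists>a b. 0 < a \<and> a \<le> b \<and> b < T \<and> ?S \<subseteq> {a..b}"
  proof (cases "?S = {}")
    case True
    then show ?thesis using assms(2) by (intro exI[of _ "T / 2"]) auto
  next
    case False
    obtain a where a: "a \<in> ?S" "\<forall>x\<in>?S. a \<le> x" using compact_attains_inf[OF S(1) False] by blast
    obtain b where b: "b \<in> ?S" "\<forall>x\<in>?S. x \<le> b" using compact_attains_sup[OF S(1) False] by blast
    have "0 < a" "a \<le> b" "b < T" "?S \<subseteq> {a..b}" using a b S(2) by auto
    then show ?thesis by blast
  qed
  then obtain a b where ab: "0 < a" "a \<le> b" "b < T" "?S \<subseteq> {a..b}" by blast
  have z: "\<psi> x = 0" if "x \<notin> {a..b}" for x using that ab(4) closure_subset[of "{x. \<psi> x \<noteq> 0}"] by blast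
  then show "\<exists>a b. 0 < a \<and> a \<le> b \<and> b < T \<and> (\<forall>x. x \<notin> {a..b} \<longrightarrow> \<psi> x = 0)" using ab by blast
  show "test_function {0<..<T} (deriv \<psi>)"
  proof (rule test_functionI)
    show "Cm m (deriv \<psi>)" for m using C[of "Suc m"] by (simp only: Cm_Suc_real)
    show "a \<le> x \<and> x \<le> b" if "deriv \<psi> x \<noteq> 0" for x
    proof (rule ccontr)
      assume "\<not> (a \<le> x \<and> x \<le> b)"
      then have x: "x \<in> - {a..b}" by auto
      have "((\<lambda>x. 0) has_real_derivative 0) (at x)" by simp
      then have "(\<psi> has_real_derivative 0) (at x)"
        by (rule has_field_derivative_transform_within_open[where S = "- {a..b}"]) (use x z in auto)
      then show False using that DERIV_imp_deriv by blast
    qed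
    show "{a..b} \<subseteq> {0<..<T}" using ab by auto
  qed
  have "compact (\<psi> ` {a..b})" by (intro compact_continuous_image continuous_on_subset[OF cont]) auto
  then obtain C where "\<forall>y\<in>\<psi> ` {a..b}. norm y \<le> C" using compact_imp_bounded bounded_iff by metis
  then have "\<bar>\<psi> x\<bar> \<le> max C 0" for x using z[of x] by (cases "x \<in> {a..b}") (auto simp: le_max_iff_disj)
  then show "\<exists>C. \<forall>x. \<bar>\<psi> x\<bar> \<le> C" by blast
qed

text \<open>
  The open intervals are stable under intersection and generate the Borel sets, and the sets over
  which \<open>Y\<close> integrates to \<open>0\<close> form a Dynkin system.  The whole line belongs to it as a limit of intervals.
\<close>

lemma AE_zero_of_interval_integrals:
  fixes Y :: "real \<Rightarrow> real"
  assumes Y: "integrable lborel Y" and z: "\<And>a b. (\<integral>x. indicator {a<..<b} x * Y x \<partial>lborel) = 0"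
  shows "AE x in lborel. Y x = 0"
proof (rule density_unique_real[OF Y, of "\<lambda>_. 0"])
  have i: "integrable lborel (\<lambda>x. indicator A x * Y x)" if "A \<in> sets borel" for A
    using integrable_mult_indicator[OF _ Y, of A] that by simp
  have tot: "(\<integral>x. Y x \<partial>lborel) = 0"
  proof (rule LIMSEQ_unique)
    show "(\<lambda>n. \<integral>x. indicator {- real n<..<real n} x * Y x \<partial>lborel) \<longlonglongrightarrow> (\<integral>x. Y x \<partial>lborel)"
    proof (rule integral_dominated_convergence[where w = "\<lambda>x. \<bar>Y x\<bar>"])
      show "AE x in lborel. (\<lambda>n. indicator {- real n<..<real n} x * Y x) \<longlonglongrightarrow> Y x"
      proof (rule AE_I2)
        fix x :: real
        have "\<forall>\<^sub>F n in sequentially. \<bar>x\<bar> < real n"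
          using filterlim_real_sequentially unfolding filterlim_at_top_dense by blast
        then have "\<forall>\<^sub>F n in sequentially. indicator {- real n<..<real n} x * Y x = Y x"
          by eventually_elim (auto simp: indicator_def)
        then show "(\<lambda>n. indicator {- real n<..<real n} x * Y x) \<longlonglongrightarrow> Y x" by (rule tendsto_eventually)
      qed
    qed (use Y in \<open>auto simp: indicator_def\<close>)
    show "(\<lambda>n. \<integral>x. indicator {- real n<..<real n} x * Y x \<partial>lborel) \<longlonglongrightarrow> 0" by (simp add: z)
  qed
  let ?G = "range (\<lambda>(a, b). {a<..<b}) :: real set set"
  have sets: "sets borel = sigma_sets UNIV ?G"
  proof -
    have "(\<lambda>(a, b). box a b) = (\<lambda>(a, b). {a<..<b} :: real set)" by auto
    then have "(borel :: real measure) = sigma UNIV ?G" using borel_eq_box[where 'a = real] by simp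
    then have "sets (borel :: real measure) = sets (sigma UNIV ?G)" by simp
    also have "\<dots> = sigma_sets UNIV ?G" by (rule sets_measure_of) simp
    finally show ?thesis .
  qed
  have "Int_stable ?G" unfolding Int_stable_def
  proof (safe)
    fix a b a' b' :: real
    have "{a<..<b} \<inter> {a'<..<b'} = (\<lambda>(a, b). {a<..<b}) (max a a', min b b')" by auto
    then show "{a<..<b} \<inter> {a'<..<b'} \<in> ?G" by blast
  qed
  show "integrable lborel (\<lambda>_. 0 :: real)" by simp
  fix A :: "real set" assume "A \<in> sets lborel"
  then have A: "A \<in> sigma_sets UNIV ?G" by (simp add: sets)
  have "?G \<subseteq> Pow UNIV" by simp
  with \<open>Int_stable ?G\<close> have "(\<integral>x. indicator A x * Y x \<partial>lborel) = 0" using A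
  proof (induction A rule: sigma_sets_induct_disjoint)
    case (basic A)
    then show ?case using z by auto
  next
    case (compl A)
    then have A: "A \<in> sets borel" by (simp add: sets)
    have "(\<integral>x. indicator (UNIV - A) x * Y x \<partial>lborel) = (\<integral>x. Y x - indicator A x * Y x \<partial>lborel)"
      by (rule Bochner_Integration.integral_cong) (auto simp: indicator_def)
    also have "\<dots> = 0" using Y i[OF A] tot compl by simp
    finally show ?case .
  next
    case (union A)
    then have A: "A n \<in> sets borel" for n using sets by auto
    have "(LINT x:(\<Union>n. A n)|lborel. Y x) = (\<Sum>n. LINT x:(A n)|lborel. Y x)"
    proof (rule lebesgue_integral_countable_add)
      show "set_integrable lborel (\<Union>n. A n) Y"
        using i[of "\<Union>n. A n"] A by (simp add: set_integrable_def)
    qed (use A union(1) in \<open>auto simp: disjoint_family_on_def\<close>)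
    then show ?case using union(3) by (simp add: set_lebesgue_integral_def)
  qed simp
  then show "set_lebesgue_integral lborel A Y = set_lebesgue_integral lborel A (\<lambda>_. 0)"
    by (simp add: set_lebesgue_integral_def)
qed

section \<open>Weak derivatives on a time interval\<close>

context time_interval
begin

abbreviation "test \<equiv> test_function {0<..<T}"

lemmas test_DERIV = test_function_DERIV[OF _ T]
  and test_deriv = test_function_deriv[OF _ T]
  and test_continuous = test_function_continuous[OF _ T]
  and test_support = test_function_support[OF _ T]
  and test_bounded = test_function_bounded[OF _ T]

lemma test_measurable: "test \<psi> \<Longrightarrow> \<psi> \<in> borel_measurable M"
  by (rule continuous_imp_measurable_on_sets_lebesgue[OF continuous_on_subset[OF test_continuous]]) auto

lemma test_boundary: assumes "test \<psi>" shows "\<psi> 0 = 0" "\<psi> T = 0"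
  using test_support[OF assms] by force+

lemma test_mult_integrable:
  assumes "test \<psi>" "integrable M Y"
  shows "integrable M (\<lambda>t. \<psi> t * (Y t :: real))"
  using test_bounded[OF assms(1)] integrable_mult_bounded[OF assms(2) test_measurable[OF assms(1)]] by blast

text \<open>
  Primitives are treated as convolutions with the Heaviside function, so that the results on kernels
  apply to them.
\<close>

abbreviation heaviside :: "real \<Rightarrow> real" where "heaviside \<equiv> pow_kernel 1"

lemma heaviside_eq: "heaviside x = (if 0 < x then 1 else 0)"
  by (simp add: pow_kernel_def)

lemma dominated_heaviside: "dominated_kernel 1 1 heaviside"
  by (simp add: dominated_kernel_def pow_kernel_nonneg)

lemma integral_test_deriv_heaviside:
  assumes "test \<psi>" "r \<in> {0<..<T}"
  shows "(\<integral>t. deriv \<psi> t * heaviside (t - r) \<partial>M) = - \<psi> r"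
proof -
  have "(\<integral>t. deriv \<psi> t * heaviside (t - r) \<partial>M) = \<psi> (max T r) - \<psi> (max 0 r)"
  proof (rule integral_Ioo_eq_diff[where S = "{r}" and F = "\<lambda>t. \<psi> (max t r)"])
    show "continuous_on {0..T} (\<lambda>t. \<psi> (max t r))"
      by (rule continuous_on_compose2[OF test_continuous[OF assms(1)]]) (auto intro!: continuous_intros)
    show "integrable M (\<lambda>t. deriv \<psi> t * heaviside (t - r))"
      by (intro test_mult_integrable test_deriv assms kernel_integrable(1)[OF dominated_heaviside])
    fix t assume t: "t \<in> {0<..<T} - {r}"
    then consider "t < r" | "r < t" by fastforce
    then show "((\<lambda>t. \<psi> (max t r)) has_real_derivative deriv \<psi> t * heaviside (t - r)) (at t)"
    proof cases
      case 1
      have "((\<lambda>t. \<psi> r) has_real_derivative deriv \<psi> t * heaviside (t - r)) (at t)"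
        using 1 by (simp add: heaviside_eq)
      then show ?thesis
        by (rule has_field_derivative_transform_within_open[where S = "{..<r}"]) (use 1 in auto)
    next
      case 2
      have "(\<psi> has_real_derivative deriv \<psi> t * heaviside (t - r)) (at t)"
        using 2 test_DERIV[OF assms(1), of t] by (simp add: heaviside_eq)
      then show ?thesis
        by (rule has_field_derivative_transform_within_open[where S = "{r<..}"]) (use 2 in auto)
    qed
  qed (use T in auto)
  then show ?thesis using assms(2) test_boundary[OF assms(1)] by simp
qed

lemma integral_test_deriv_primitive:
  assumes "test \<psi>" "integrable M W"
  shows "(\<integral>t. deriv \<psi> t * conv T heaviside W t \<partial>M) = - (\<integral>t. \<psi> t * W t \<partial>M)"
proof -
  obtain C where "\<And>x. \<bar>deriv \<psi> x\<bar> \<le> C" using test_bounded[OF test_deriv[OF assms(1)]] by blast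
  then have "(\<integral>t. deriv \<psi> t * conv T heaviside W t \<partial>M) = (\<integral>r. W r * (\<integral>t. deriv \<psi> t * heaviside (t - r) \<partial>M) \<partial>M)"
    by (intro conv_swap[OF dominated_heaviside assms(2)] test_measurable test_deriv assms)
  also have "\<dots> = (\<integral>r. - (\<psi> r * W r) \<partial>M)"
    by (rule Bochner_Integration.integral_cong) (auto simp: integral_test_deriv_heaviside[OF assms(1)])
  finally show ?thesis by simp
qed

lemma test_primitive:
  assumes g: "test g" "(\<integral>t. g t \<partial>M) = 0"
  obtains \<psi> where "test \<psi>" "deriv \<psi> = g"
proof -
  obtain a b where ab: "0 < a" "a \<le> b" "b < T" and z: "\<And>x. x \<notin> {a..b} \<Longrightarrow> g x = 0"
    using test_support[OF g(1)] by blast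
  have cont: "continuous_on S g" for S using continuous_on_subset[OF test_continuous[OF g(1)]] by blast
  define \<psi> where "\<psi> = (\<lambda>x. integral {0..x} g)"
  have \<psi>0: "\<psi> x = 0" if "x < a" for x
  proof -
    have "\<psi> x = integral {0..x} (\<lambda>_. 0)" unfolding \<psi>_def by (rule integral_cong) (use that z in auto)
    then show ?thesis by simp
  qed
  have \<psi>1: "\<psi> x = 0" if "b < x" for x
  proof -
    have "integrable M g" using test_mult_integrable[OF g(1), of "\<lambda>_. 1"] by simp
    then have "integral {0<..<T} g = 0" using g(2) lebesgue_integral_eq_integral[of "{0<..<T}" g] by simp
    then have 0: "integral {0..T} g = 0" by (simp add: integral_open_interval_real)
    have gi: "g integrable_on {u..v}" for u v by (intro integrable_continuous_interval cont)
    have tail: "integral {0..y} g = integral {0..b} g" if "b \<le> y" for y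
    proof -
      have "integral {0..y} g = integral {0..b} g + integral {b..y} g"
        using that ab by (intro Henstock_Kurzweil_Integration.integral_combine[symmetric] gi) auto
      also have "integral {b..y} g = integral {b..y} (\<lambda>_. 0)"
        by (rule integral_spike[of "{b}"]) (use z in auto)
      finally show ?thesis by simp
    qed
    show ?thesis using tail[of x] tail[of T] 0 that ab by (simp add: \<psi>_def)
  qed
  have D: "(\<psi> has_real_derivative g x) (at x)" for x
  proof (cases "0 < x")
    case True
    have "(\<psi> has_real_derivative g x) (at x within {0..x + 1})"
      unfolding \<psi>_def by (rule integral_has_real_derivative[OF cont]) (use True in auto)
    moreover have "at x within {0..x + 1} = at x" using True by (intro at_within_interior) simp
    ultimately show ?thesis by simp
  next
    case False
    then have "x < a" using ab by simp
    have "((\<lambda>x. 0) has_real_derivative g x) (at x)" using z[of x] \<open>x < a\<close> by simp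
    then show ?thesis
      by (rule has_field_derivative_transform_within_open[where S = "{..<a}"]) (use \<open>x < a\<close> \<psi>0 in auto)
  qed
  have "test \<psi>"
  proof (rule test_functionI)
    fix m
    have "Cm (Suc m) \<psi>" using g(1) by (intro Cm_Suc_DERIV[OF D]) (simp add: test_function_def)
    then show "Cm m \<psi>" by (rule Cm_pred)
  next
    show "a \<le> x \<and> x \<le> b" if "\<psi> x \<noteq> 0" for x using that \<psi>0[of x] \<psi>1[of x] by (meson not_less)
    show "{a..b} \<subseteq> {0<..<T}" using ab by auto
  qed
  moreover have "deriv \<psi> = g" using D by (auto intro: DERIV_imp_deriv)
  ultimately show thesis by (rule that)
qed

text \<open>
  The bumps converge boundedly to indicators of intervals.  As \<open>M\<close> is a Lebesgue measure, a Borel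
  representative \<open>Y\<close> of \<open>Z\<close> is needed first.
\<close>

lemma AE_zero_of_test_integrals:
  assumes Z: "integrable M Z" and z: "\<And>c d n. 0 \<le> c \<Longrightarrow> d \<le> T \<Longrightarrow> (\<integral>t. bump c d n t * Z t \<partial>M) = (0 :: real)"
  shows "AE t in M. Z t = 0"
proof -
  let ?Z = "\<lambda>t. if t \<in> {0<..<T} then Z t else 0"
  have iZ: "integrable lebesgue ?Z" using Z by (subst Lebesgue_Measure.integrable_restrict_UNIV) auto
  obtain Y where Y: "Y \<in> borel_measurable lborel" "AE t in lborel. ?Z t = Y t"
    using completion_ex_borel_measurable_real[of ?Z lborel] borel_measurable_integrable[OF iZ] by blast
  have ae: "AE t in lebesgue. ?Z t = Y t" using Y(2) by (rule AE_completion)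
  have mY: "Y \<in> borel_measurable lebesgue" using Y(1) by (simp add: measurable_completion)
  have "integrable lebesgue Y" using iZ mY ae by (simp add: integrable_cong_AE[OF _ mY ae, THEN iffD1] borel_measurable_integrable)
  then have iY: "integrable lborel Y" using integrable_completion Y(1) by blast
  have "(\<integral>x. indicator {a<..<b} x * Y x \<partial>lborel) = 0" for a b
  proof -
    let ?c = "max a 0" and ?d = "min b T"
    have "(\<integral>x. indicator {a<..<b} x * Y x \<partial>lborel) = (\<integral>x. indicator {a<..<b} x * Y x \<partial>lebesgue)"
      by (intro integral_completion[symmetric] borel_measurable_times borel_measurable_indicator Y(1)) simp
    also have "\<dots> = (\<integral>x. indicator {a<..<b} x * ?Z x \<partial>lebesgue)"
      using ae mY borel_measurable_integrable[OF iZ]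
      by (intro integral_cong_AE borel_measurable_times borel_measurable_indicator) (auto elim!: eventually_mono)
    also have "\<dots> = (\<integral>x. (if x \<in> {0<..<T} then indicator {?c<..<?d} x * Z x else 0) \<partial>lebesgue)"
      by (rule Bochner_Integration.integral_cong) (auto simp: indicator_def)
    also have "\<dots> = (\<integral>x. indicator {?c<..<?d} x * Z x \<partial>M)"
      by (subst Lebesgue_Measure.integral_restrict_UNIV) auto
    also have "\<dots> = 0"
    proof (rule LIMSEQ_unique)
      show "(\<lambda>n. \<integral>t. bump ?c ?d n t * Z t \<partial>M) \<longlonglongrightarrow> (\<integral>x. indicator {?c<..<?d} x * Z x \<partial>M)"
      proof (rule integral_dominated_convergence[where w = "\<lambda>t. \<bar>Z t\<bar>"])
        show "AE t in M. (\<lambda>n. bump ?c ?d n t * Z t) \<longlonglongrightarrow> indicator {?c<..<?d} t * Z t"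
          by (intro AE_I2 tendsto_intros LIMSEQ_bump)
        show "AE t in M. norm (bump ?c ?d n t * Z t) \<le> \<bar>Z t\<bar>" for n
          by (intro AE_I2) (simp add: abs_mult mult_left_le_one_le bump_nonneg bump_le_1)
        show "(\<lambda>t. bump ?c ?d n t * Z t) \<in> borel_measurable M" for n
          by (intro borel_measurable_times test_measurable[OF test_function_bump] borel_measurable_integrable[OF Z]) auto
        show "(\<lambda>x. indicator {?c<..<?d} x * Z x) \<in> borel_measurable M"
          by (intro borel_measurable_times borel_measurable_indicator borel_measurable_integrable[OF Z])
            (auto simp: sets_restrict_space_iff)
      qed (use Z in auto)
      show "(\<lambda>n. \<integral>t. bump ?c ?d n t * Z t \<partial>M) \<longlonglongrightarrow> 0" by (simp add: z)
    qed
    finally show ?thesis .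
  qed
  then have "AE t in lborel. Y t = 0" by (rule AE_zero_of_interval_integrals[OF iY])
  then have "AE t in lebesgue. Y t = 0" by (rule AE_completion)
  with ae have "AE t in lebesgue. t \<in> {0<..<T} \<longrightarrow> Z t = 0" by eventually_elim auto
  then show ?thesis by (simp add: AE_restrict_space_iff)
qed

text \<open>
  Test functions with integral \<open>0\<close> are derivatives of test functions.  Subtracting from any bump a
  multiple of a fixed one with nonzero integral \<open>J\<close> shows that \<open>Z\<close> and the constant
  \<open>c\<close>, the average of \<open>Z\<close> against the fixed bump, have the same integral against every bump.
\<close>

lemma du_Bois_Reymond:
  assumes Z: "integrable M Z" and z: "\<And>\<psi>. test \<psi> \<Longrightarrow> (\<integral>t. deriv \<psi> t * Z t \<partial>M) = (0 :: real)"
  obtains c where "AE t in M. Z t = c"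
proof -
  \<comment> \<open>For this \<open>n\<close> the bump is positive on the middle third of the interval, hence \<open>J \<noteq> 0\<close>.\<close>
  obtain n :: nat where n: "6 / T < real n" using reals_Archimedean2 by blast
  let ?b = "bump 0 T n"
  have b: "test ?b" by (rule test_function_bump) auto
  have i1: "integrable M \<psi>" if "test \<psi>" for \<psi> using test_mult_integrable[OF that, of "\<lambda>_. 1"] by simp
  define J where "J = (\<integral>t. ?b t \<partial>M)"
  have "J \<noteq> 0"
  proof
    assume "J = 0"
    then have "AE t in M. ?b t = 0"
      using integral_nonneg_eq_0_iff_AE[OF i1[OF b]] by (simp add: J_def bump_nonneg)
    then have "AE t in lebesgue. t \<in> {0<..<T} \<longrightarrow> ?b t = 0" by (simp add: AE_restrict_space_iff)
    then have "AE t in lebesgue. t \<notin> {T / 3<..<2 * T / 3}"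
    proof eventually_elim
      case (elim t)
      show ?case
      proof
        assume t: "t \<in> {T / 3<..<2 * T / 3}"
        have "1 / (t - 0) < real n"
        proof -
          have "1 / (t - 0) < 1 / (T / 6)" using t T by (intro divide_strict_left_mono) auto
          then show ?thesis using n by simp
        qed
        moreover have "1 / (T - t) < real n"
        proof -
          have "1 / (T - t) < 1 / (T / 6)" using t T by (intro divide_strict_left_mono) auto
          then show ?thesis using n by simp
        qed
        ultimately have "0 < ?b t" using t T by (intro bump_pos) auto
        with elim t T show False by auto
      qed
    qed
    then have "{T / 3<..<2 * T / 3} \<in> null_sets lebesgue" by (subst (asm) AE_iff_null_sets[symmetric]) auto
    then have "emeasure lborel {T / 3<..<2 * T / 3} = 0" by (simp add: null_sets_def)
    then show False using T by simp
  qed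
  define c where "c = (\<integral>t. ?b t * Z t \<partial>M) / J"
  have "AE t in M. Z t - c = 0"
  proof (rule AE_zero_of_test_integrals)
    show "integrable M (\<lambda>t. Z t - c)" using Z by simp
    fix e d :: real and k assume ed: "0 \<le> e" "d \<le> T"
    let ?h = "bump e d k"
    have h: "test ?h" using ed by (intro test_function_bump)
    define q where "q = (\<integral>t. ?h t \<partial>M) / J"
    let ?g = "\<lambda>t. ?h t + - q * ?b t"
    have "test ?g"
    proof -
      obtain a1 b1 where 1: "0 < a1" "a1 \<le> b1" "b1 < T" "\<And>x. x \<notin> {a1..b1} \<Longrightarrow> ?h x = 0" using test_support[OF h] by blast
      obtain a2 b2 where 2: "0 < a2" "a2 \<le> b2" "b2 < T" "\<And>x. x \<notin> {a2..b2} \<Longrightarrow> ?b x = 0" using test_support[OF b] by blast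
      show ?thesis
      proof (rule test_functionI)
        show "Cm m ?g" for m using h b by (intro Cm_add Cm_mult Cm_const) (auto simp: test_function_def)
        show "min a1 a2 \<le> x \<and> x \<le> max b1 b2" if "?g x \<noteq> 0" for x
        proof -
          have "x \<in> {a1..b1} \<or> x \<in> {a2..b2}" using that 1(4)[of x] 2(4)[of x] by fastforce
          then show ?thesis by auto
        qed
        show "{min a1 a2..max b1 b2} \<subseteq> {0<..<T}" using 1 2 by auto
      qed
    qed
    moreover have "(\<integral>t. ?g t \<partial>M) = 0"
      using i1[OF h] i1[OF b] \<open>J \<noteq> 0\<close> by (simp add: q_def flip: J_def)
    ultimately obtain \<psi> where "test \<psi>" "deriv \<psi> = ?g" using test_primitive by blast
    then have "(\<integral>t. ?g t * Z t \<partial>M) = 0" using z[of \<psi>] by simp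
    moreover have "(\<integral>t. ?g t * Z t \<partial>M) = (\<integral>t. ?h t * Z t \<partial>M) - q * (\<integral>t. ?b t * Z t \<partial>M)"
      using test_mult_integrable[OF h Z] test_mult_integrable[OF b Z] by (simp add: algebra_simps)
    ultimately have "(\<integral>t. ?h t * Z t \<partial>M) = (\<integral>t. ?h t \<partial>M) * c" by (simp add: q_def c_def)
    then show "(\<integral>t. ?h t * (Z t - c) \<partial>M) = 0"
      using test_mult_integrable[OF h Z] i1[OF h] by (simp add: right_diff_distrib)
  qed
  then show thesis by (intro that[of c]) simp
qed

lemma weak_derivative_imp_primitive:
  assumes Y: "integrable M Y" and W: "integrable M W"
    and YW: "\<And>\<psi>. test \<psi> \<Longrightarrow> (\<integral>t. deriv \<psi> t * Y t \<partial>M) = - (\<integral>t. \<psi> t * W t \<partial>M)"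
  obtains c where "AE t in M. Y t = c + conv T heaviside W t"
proof -
  let ?P = "conv T heaviside W"
  have P: "integrable M ?P" by (rule conv_integrable[OF dominated_heaviside W])
  have "(\<integral>t. deriv \<psi> t * (Y t - ?P t) \<partial>M) = 0" if "test \<psi>" for \<psi>
    using integral_test_deriv_primitive[OF that W] YW[OF that]
      test_mult_integrable[OF test_deriv[OF that] Y] test_mult_integrable[OF test_deriv[OF that] P]
    by (simp add: right_diff_distrib)
  then obtain c where "AE t in M. Y t - ?P t = c"
    using du_Bois_Reymond[of "\<lambda>t. Y t - ?P t"] Y P by auto
  then show thesis by (intro that[of c]) (auto elim!: eventually_mono)
qed

text \<open>
  A trace estimate: the constant is the difference of two functions whose \<open>L\<^sup>2\<close> norms are known.
\<close>

lemma primitive_constant_bound: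
  assumes Y: "Y \<in> borel_measurable M" "integrable M (\<lambda>t. (Y t)\<^sup>2)" and W: "W \<in> borel_measurable M" "integrable M (\<lambda>t. (W t)\<^sup>2)"
    and ae: "AE t in M. Y t = c + conv T heaviside W t"
  shows "T * c\<^sup>2 \<le> 2 * (\<integral>t. (Y t)\<^sup>2 \<partial>M) + 2 * T\<^sup>2 * (\<integral>t. (W t)\<^sup>2 \<partial>M)"
proof -
  note sq = conv_square_integral[OF dominated_heaviside W, simplified]
  have "T * c\<^sup>2 = (\<integral>t. c\<^sup>2 \<partial>M)" using T by (simp add: measure_restrict_space)
  also have "\<dots> \<le> (\<integral>t. 2 * (Y t)\<^sup>2 + 2 * (conv T heaviside W t)\<^sup>2 \<partial>M)"
  proof (rule integral_mono_AE)
    show "integrable M (\<lambda>t. 2 * (Y t)\<^sup>2 + 2 * (conv T heaviside W t)\<^sup>2)" using Y sq by simp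
    show "AE t in M. c\<^sup>2 \<le> 2 * (Y t)\<^sup>2 + 2 * (conv T heaviside W t)\<^sup>2" using ae
    proof eventually_elim
      case (elim t)
      have "0 \<le> (Y t + conv T heaviside W t)\<^sup>2" by simp
      moreover have "c = Y t - conv T heaviside W t" using elim by simp
      then have "c\<^sup>2 = (Y t)\<^sup>2 + (conv T heaviside W t)\<^sup>2 - 2 * Y t * conv T heaviside W t"
        by (simp only: power2_diff)
      ultimately show ?case unfolding power2_sum by linarith
    qed
  qed simp
  also have "\<dots> = 2 * (\<integral>t. (Y t)\<^sup>2 \<partial>M) + 2 * (\<integral>t. (conv T heaviside W t)\<^sup>2 \<partial>M)" using Y sq by simp
  also have "\<dots> \<le> 2 * (\<integral>t. (Y t)\<^sup>2 \<partial>M) + 2 * (T\<^sup>2 * (\<integral>t. (W t)\<^sup>2 \<partial>M))" using sq T by simp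
  finally show ?thesis by simp
qed

lemma continuous_on_compose_UNIV:
  "continuous_on UNIV K \<Longrightarrow> continuous_on S f \<Longrightarrow> continuous_on S (\<lambda>x. K (f x))"
  by (rule continuous_on_compose2) auto

text \<open>
  \<open>K1\<close> is the continuous primitive of \<open>K\<close> that vanishes at \<open>0\<close>; \<open>K\<close> may be singular there.
\<close>

definition primitive_kernel :: "(real \<Rightarrow> real) \<Rightarrow> (real \<Rightarrow> real) \<Rightarrow> bool" where
  "primitive_kernel K1 K \<longleftrightarrow> continuous_on UNIV K1 \<and> (\<forall>x\<le>0. K1 x = 0) \<and>
    (\<forall>x. x \<noteq> 0 \<longrightarrow> (K1 has_real_derivative K x) (at x)) \<and>
    (\<exists>B a. dominated_kernel B a K) \<and> (\<exists>B a. dominated_kernel B a K1)"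

text \<open>
  Integrability is only required after multiplication with test functions.  This admits functions such
  as \<open>t powr (\<gamma> - 3)\<close>, which is not integrable at \<open>0\<close>, and lets weak derivatives be added.
\<close>

definition weak_derivative_pair :: "(real \<Rightarrow> real) \<Rightarrow> (real \<Rightarrow> real) \<Rightarrow> bool" where
  "weak_derivative_pair u w \<longleftrightarrow> (\<forall>\<psi>. test \<psi> \<longrightarrow> integrable M (\<lambda>t. deriv \<psi> t * u t) \<and>
     integrable M (\<lambda>t. \<psi> t * w t) \<and> (\<integral>t. deriv \<psi> t * u t \<partial>M) = - (\<integral>t. \<psi> t * w t \<partial>M))"

lemma weak_derivative_pair_add:
  "weak_derivative_pair u w \<Longrightarrow> weak_derivative_pair u' w' \<Longrightarrow> weak_derivative_pair (\<lambda>t. u t + u' t) (\<lambda>t. w t + w' t)"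
  by (simp add: weak_derivative_pair_def distrib_left)

lemma weak_derivative_pair_cmult:
  assumes "weak_derivative_pair u w"
  shows "weak_derivative_pair (\<lambda>t. c * u t) (\<lambda>t. c * w t)"
proof -
  have e: "a t * (c * b t) = c * (a t * b t)" for a b :: "real \<Rightarrow> real" and t by simp
  show ?thesis using assms unfolding weak_derivative_pair_def e by simp
qed

text \<open>
  Convolution moves to the test function, so this is integration by parts for \<open>\<psi> * K1 (\<cdot> - r)\<close>.  There
  is no boundary term at the jump \<open>t = r\<close> because \<open>K1\<close> is continuous.
\<close>

lemma weak_derivative_pair_conv:
  assumes K: "primitive_kernel K1 K" and W: "integrable M W"
  shows "weak_derivative_pair (conv T K1 W) (conv T K W)"
  unfolding weak_derivative_pair_def
proof (intro allI impI)
  fix \<psi> assume \<psi>: "test \<psi>"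
  obtain B a B1 a1 where d: "dominated_kernel B a K" "dominated_kernel B1 a1 K1" using K by (auto simp: primitive_kernel_def)
  obtain C where C: "\<And>x. \<bar>\<psi> x\<bar> \<le> C" using test_bounded[OF \<psi>] by blast
  obtain C1 where C1: "\<And>x. \<bar>deriv \<psi> x\<bar> \<le> C1" using test_bounded[OF test_deriv[OF \<psi>]] by blast
  note s1 = conv_swap[OF d(2) W test_measurable[OF test_deriv[OF \<psi>]] C1]
  note s = conv_swap[OF d(1) W test_measurable[OF \<psi>] C]
  have "(\<integral>t. deriv \<psi> t * K1 (t - r) \<partial>M) = - (\<integral>t. \<psi> t * K (t - r) \<partial>M)" if r: "r \<in> {0<..<T}" for r
  proof -
    have i: "integrable M (\<lambda>t. deriv \<psi> t * K1 (t - r))" "integrable M (\<lambda>t. \<psi> t * K (t - r))"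
      by (rule test_mult_integrable[OF test_deriv[OF \<psi>] kernel_integrable(1)[OF d(2)]],
          rule test_mult_integrable[OF \<psi> kernel_integrable(1)[OF d(1)]])
    have "(\<integral>t. deriv \<psi> t * K1 (t - r) + \<psi> t * K (t - r) \<partial>M) = \<psi> T * K1 (T - r) - \<psi> 0 * K1 (0 - r)"
    proof (rule integral_Ioo_eq_diff[where S = "{r}" and F = "\<lambda>t. \<psi> t * K1 (t - r)"])
      have "continuous_on UNIV K1" using K by (simp add: primitive_kernel_def)
      then have "continuous_on {0..T} (\<lambda>t. K1 (t - r))"
        by (rule continuous_on_compose_UNIV) (intro continuous_intros)
      moreover have "continuous_on {0..T} \<psi>" by (rule continuous_on_subset[OF test_continuous[OF \<psi>]]) simp
      ultimately show "continuous_on {0..T} (\<lambda>t. \<psi> t * K1 (t - r))" by (intro continuous_on_mult)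
      show "integrable M (\<lambda>t. deriv \<psi> t * K1 (t - r) + \<psi> t * K (t - r))"
        by (intro Bochner_Integration.integrable_add i)
      fix t assume "t \<in> {0<..<T} - {r}"
      then have "(K1 has_real_derivative K (t - r)) (at (t - r))" using K by (simp add: primitive_kernel_def)
      from DERIV_mult[OF test_DERIV[OF \<psi>] DERIV_translate[OF this]]
      show "((\<lambda>t. \<psi> t * K1 (t - r)) has_real_derivative deriv \<psi> t * K1 (t - r) + \<psi> t * K (t - r)) (at t)"
        by (simp add: mult.commute)
    qed (use T in simp_all)
    then show ?thesis using i test_boundary[OF \<psi>] by simp
  qed
  then have "(\<integral>r. W r * (\<integral>t. deriv \<psi> t * K1 (t - r) \<partial>M) \<partial>M) = (\<integral>r. - (W r * (\<integral>t. \<psi> t * K (t - r) \<partial>M)) \<partial>M)"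
    by (intro Bochner_Integration.integral_cong) auto
  then show "integrable M (\<lambda>t. deriv \<psi> t * conv T K1 W t) \<and> integrable M (\<lambda>t. \<psi> t * conv T K W t) \<and>
      (\<integral>t. deriv \<psi> t * conv T K1 W t \<partial>M) = - (\<integral>t. \<psi> t * conv T K W t \<partial>M)"
    using s s1 by simp
qed

lemma test_mult_continuous:
  assumes \<psi>: "test \<psi>" and K: "continuous_on {0<..} (K :: real \<Rightarrow> real)"
  shows "integrable M (\<lambda>t. \<psi> t * K t)" "continuous_on {0..T} (\<lambda>t. \<psi> t * K t)"
proof -
  obtain a b where ab: "0 < a" "a \<le> b" "b < T" and z: "\<And>x. x \<notin> {a..b} \<Longrightarrow> \<psi> x = 0"
    using test_support[OF \<psi>] by blast
  have "continuous_on ({0<..} \<union> {..<a}) (\<lambda>t. \<psi> t * K t)"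
  proof (rule continuous_on_open_Un)
    show "continuous_on {0<..} (\<lambda>t. \<psi> t * K t)"
      by (intro continuous_on_mult K continuous_on_subset[OF test_continuous[OF \<psi>]]) simp
    show "continuous_on {..<a} (\<lambda>t. \<psi> t * K t)"
      by (rule continuous_on_eq[of _ "\<lambda>_. 0"]) (use z in auto)
  qed auto
  then show c: "continuous_on {0..T} (\<lambda>t. \<psi> t * K t)" by (rule continuous_on_subset) (use ab in auto)
  have "bounded ((\<lambda>t. \<psi> t * K t) ` {0..T})" by (intro compact_imp_bounded compact_continuous_image c) auto
  then obtain C where C: "\<forall>t\<in>{0..T}. norm (\<psi> t * K t) \<le> C" by (auto simp: bounded_iff)
  show "integrable M (\<lambda>t. \<psi> t * K t)"
  proof (rule M.integrable_const_bound)
    show "AE t in M. norm (\<psi> t * K t) \<le> C" using C by (intro AE_I2) auto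
    show "(\<lambda>t. \<psi> t * K t) \<in> borel_measurable M"
      by (intro continuous_imp_measurable_on_sets_lebesgue continuous_on_subset[OF c]) auto
  qed
qed

text \<open>
  Test functions vanish near \<open>0\<close> and \<open>T\<close>, so the behaviour of \<open>K1\<close> at \<open>0\<close> is arbitrary.
\<close>

lemma weak_derivative_pair_smooth:
  assumes D: "\<And>t. 0 < t \<Longrightarrow> (K1 has_real_derivative K t) (at t)" and K: "continuous_on {0<..} K"
  shows "weak_derivative_pair K1 K"
  unfolding weak_derivative_pair_def
proof (intro allI impI)
  fix \<psi> assume \<psi>: "test \<psi>"
  have K1: "continuous_on {0<..} K1"
    by (rule DERIV_continuous_on) (auto intro: has_field_derivative_at_within D)
  note i = test_mult_continuous(1)[OF test_deriv[OF \<psi>] K1] test_mult_continuous(1)[OF \<psi> K]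
  have "(\<integral>t. deriv \<psi> t * K1 t + \<psi> t * K t \<partial>M) = \<psi> T * K1 T - \<psi> 0 * K1 0"
  proof (rule integral_Ioo_eq_diff[where S = "{}" and F = "\<lambda>t. \<psi> t * K1 t"])
    show "continuous_on {0..T} (\<lambda>t. \<psi> t * K1 t)" by (rule test_mult_continuous(2)[OF \<psi> K1])
    fix t assume "t \<in> {0<..<T} - {}"
    then show "((\<lambda>t. \<psi> t * K1 t) has_real_derivative deriv \<psi> t * K1 t + \<psi> t * K t) (at t)"
      using DERIV_mult[OF test_DERIV[OF \<psi>] D, of t] by (simp add: mult.commute)
  qed (use T i in auto)
  then show "integrable M (\<lambda>t. deriv \<psi> t * K1 t) \<and> integrable M (\<lambda>t. \<psi> t * K t) \<and>
      (\<integral>t. deriv \<psi> t * K1 t \<partial>M) = - (\<integral>t. \<psi> t * K t \<partial>M)"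
    using i test_boundary[OF \<psi>] by simp
qed

lemma weak_derivative_pair_3:
  assumes "weak_derivative_pair u0 u1" "weak_derivative_pair u1 u2" "weak_derivative_pair u2 u3" "test \<psi>"
  shows "(\<integral>t. (deriv ^^ 3) \<psi> t * u0 t \<partial>M) = - (\<integral>t. \<psi> t * u3 t \<partial>M)"
  using assms test_deriv by (simp add: weak_derivative_pair_def eval_nat_numeral)

lemma conv_const:
  assumes K: "primitive_kernel K1 K" and t: "0 < t" "t < T"
  shows "(\<integral>r. K (t - r) \<partial>M) = K1 t"
proof -
  obtain B a where d: "dominated_kernel B a K" using K by (auto simp: primitive_kernel_def)
  have "(\<integral>r. K (t - r) \<partial>M) = - K1 (t - T) - - K1 (t - 0)"
  proof (rule integral_Ioo_eq_diff[where S = "{t}" and F = "\<lambda>r. - K1 (t - r)"])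
    have "continuous_on UNIV K1" using K by (simp add: primitive_kernel_def)
    then show "continuous_on {0..T} (\<lambda>r. - K1 (t - r))"
      by (intro continuous_on_minus, elim continuous_on_compose_UNIV) (intro continuous_intros)
    fix r assume "r \<in> {0<..<T} - {t}"
    then have "(K1 has_real_derivative K (t - r)) (at (t - r))" using K by (simp add: primitive_kernel_def)
    from DERIV_minus[OF DERIV_reflect[OF this]]
    show "((\<lambda>r. - K1 (t - r)) has_real_derivative K (t - r)) (at r)" by simp
  qed (use T kernel_integrable(3)[OF d] in auto)
  then show ?thesis using K t by (simp add: primitive_kernel_def)
qed

lemma conv_heaviside_kernel:
  assumes K: "primitive_kernel K1 K" and t: "0 < t" "t < T" and r: "r \<in> {0<..<T}"
  shows "(\<integral>x. K (t - x) * heaviside (x - r) \<partial>M) = K1 (t - r)"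
proof -
  obtain B a where d: "dominated_kernel B a K" using K by (auto simp: primitive_kernel_def)
  have "(\<integral>x. K (t - x) * heaviside (x - r) \<partial>M) = - K1 (t - max T r) - - K1 (t - max 0 r)"
  proof (rule integral_Ioo_eq_diff[where S = "{t, r}" and F = "\<lambda>x. - K1 (t - max x r)"])
    have "continuous_on UNIV K1" using K by (simp add: primitive_kernel_def)
    then show "continuous_on {0..T} (\<lambda>x. - K1 (t - max x r))"
      by (intro continuous_on_minus, elim continuous_on_compose_UNIV) (intro continuous_intros)
    have "integrable M (\<lambda>x. heaviside (x - r) * K (t - x))"
      by (rule integrable_mult_bounded[OF kernel_integrable(3)[OF d], where C = 1]) (auto simp: heaviside_eq)
    then show "integrable M (\<lambda>x. K (t - x) * heaviside (x - r))" by (simp add: mult.commute)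
    fix x assume x: "x \<in> {0<..<T} - {t, r}"
    then consider "x < r" | "r < x" by fastforce
    then show "((\<lambda>x. - K1 (t - max x r)) has_real_derivative K (t - x) * heaviside (x - r)) (at x)"
    proof cases
      case 1
      have "((\<lambda>x. - K1 (t - r)) has_real_derivative K (t - x) * heaviside (x - r)) (at x)"
        using 1 by (simp add: heaviside_eq)
      then show ?thesis
        by (rule has_field_derivative_transform_within_open[where S = "{..<r}"]) (use 1 in auto)
    next
      case 2
      have "(K1 has_real_derivative K (t - x)) (at (t - x))" using K x by (simp add: primitive_kernel_def)
      from DERIV_minus[OF DERIV_reflect[OF this]]
      have "((\<lambda>x. - K1 (t - x)) has_real_derivative K (t - x) * heaviside (x - r)) (at x)"
        using 2 by (simp add: heaviside_eq)
      then show ?thesis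
        by (rule has_field_derivative_transform_within_open[where S = "{r<..}"]) (use 2 in auto)
    qed
  qed (use T in auto)
  then show ?thesis using K t r by (simp add: primitive_kernel_def)
qed

text \<open>
  Associativity of convolution: \<open>K * (H * W) = (K * H) * W = K1 * W\<close> with the Heaviside function \<open>H\<close>.
\<close>

lemma conv_of_primitive:
  assumes K: "primitive_kernel K1 K" and bd: "\<And>x. x < T \<Longrightarrow> \<bar>K x\<bar> \<le> C"
    and W: "integrable M W" and w: "w \<in> borel_measurable M" "AE t in M. w t = c + conv T heaviside W t"
    and t: "0 < t" "t < T"
  shows "conv T K w t = c * K1 t + conv T K1 W t"
proof -
  obtain B a where d: "dominated_kernel B a K" using K by (auto simp: primitive_kernel_def)
  have [measurable]: "K \<in> borel_measurable borel" using d by (simp add: dominated_kernel_def)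
  have m: "(\<lambda>r. K (t - r)) \<in> borel_measurable M" by measurable
  note sw = conv_swap[OF dominated_heaviside W m, where C = C]
  have P: "conv T heaviside W \<in> borel_measurable M" using conv_integrable[OF dominated_heaviside W] by simp
  have i: "integrable M (\<lambda>r. K (t - r) * conv T heaviside W r)" using t by (intro sw bd) auto
  have "conv T K w t = (\<integral>r. K (t - r) * (c + conv T heaviside W r) \<partial>M)"
    unfolding conv_def[of T K] using w(2) w(1) P m by (intro integral_cong_AE) (auto elim!: eventually_mono)
  also have "\<dots> = (\<integral>r. K (t - r) * c + K (t - r) * conv T heaviside W r \<partial>M)" by (simp add: distrib_left)
  also have "\<dots> = K1 t * c + (\<integral>r. K (t - r) * conv T heaviside W r \<partial>M)"
    using i kernel_integrable(3)[OF d, of t] by (simp add: conv_const[OF K t])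
  also have "(\<integral>r. K (t - r) * conv T heaviside W r \<partial>M) = (\<integral>r. W r * (\<integral>x. K (t - x) * heaviside (x - r) \<partial>M) \<partial>M)"
    using t by (intro sw bd) auto
  also have "\<dots> = conv T K1 W t"
    unfolding conv_def by (intro Bochner_Integration.integral_cong) (auto simp: conv_heaviside_kernel[OF K t] mult.commute)
  finally show ?thesis by (simp add: mult.commute)
qed

end

section \<open>Poincare's inequality and the spectral gap\<close>

lemma integral_lborel_translate: "integral\<^sup>L lborel (\<lambda>x. f (x + a)) = integral\<^sup>L lborel (f :: 'a::euclidean_space \<Rightarrow> real)"
  if "f \<in> borel_measurable borel"
proof -
  have "integral\<^sup>L lborel f = integral\<^sup>L (distr lborel borel ((+) a)) f" by (simp add: lborel_distr_plus)
  also have "\<dots> = integral\<^sup>L lborel (\<lambda>x. f (a + x))" by (rule integral_distr) (use that in auto)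
  finally show ?thesis by (simp add: add.commute)
qed

lemma integrable_continuous_bounded_support:
  fixes f :: "'a::euclidean_space \<Rightarrow> real"
  assumes cF: "continuous_on UNIV f" and supp: "\<And>x. R < norm x \<Longrightarrow> f x = 0"
  shows "integrable lborel f"
proof -
  have "compact (f ` cball 0 R)" by (intro compact_continuous_image continuous_on_subset[OF cF]) auto
  then obtain C where C: "\<forall>y\<in>f ` cball 0 R. norm y \<le> C" using compact_imp_bounded bounded_iff by metis
  have i: "integrable lborel (\<lambda>x. C * indicator (cball 0 R) x :: real)"
    by (intro integrable_mult_right integrable_real_indicator emeasure_bounded_finite bounded_cball) simp
  have "norm (f x) \<le> norm (C * indicator (cball 0 R) x)" for x
    using C supp[of x] by (cases "norm x \<le> R") (auto simp: indicator_def intro: order_trans[OF _ abs_ge_self])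
  then show ?thesis
    by (intro Bochner_Integration.integrable_bound[OF i]) (use borel_measurable_continuous_onI[OF cF] in simp_all)
qed

text \<open>
  The integral of each difference quotient vanishes, as Lebesgue measure is invariant under translations.
  The quotients are dominated by the mean value theorem and the bounded support.
\<close>

lemma integral_directional_derivative_eq_0:
  fixes F :: "'a::euclidean_space \<Rightarrow> real" and D :: "'a \<Rightarrow> real"
  assumes D: "\<And>x. ((\<lambda>s. F (x + s *\<^sub>R i)) has_real_derivative D x) (at 0)"
    and cF: "continuous_on UNIV F" and cD: "continuous_on UNIV D"
    and supp: "\<And>x. R < norm x \<Longrightarrow> F x = 0" and i: "norm i = 1"
  shows "(\<integral>x. D x \<partial>lborel) = 0"
proof (rule LIMSEQ_unique)
  let ?h = "\<lambda>n::nat. 1 / real (Suc n)"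
  let ?q = "\<lambda>n x. (F (x + ?h n *\<^sub>R i) - F x) / ?h n"
  have h: "?h \<longlonglongrightarrow> 0" by (rule LIMSEQ_Suc[OF lim_1_over_n])
  have mF: "F \<in> borel_measurable borel" using cF by (rule borel_measurable_continuous_onI)
  have mD: "D \<in> borel_measurable borel" using cD by (rule borel_measurable_continuous_onI)
  have D': "((\<lambda>s. F (x + s *\<^sub>R i)) has_real_derivative D (x + s *\<^sub>R i)) (at s)" for x s
    using DERIV_shift[of "\<lambda>s. F (x + s *\<^sub>R i)" "D (x + s *\<^sub>R i)" 0 s] D[of "x + s *\<^sub>R i"]
    by (simp add: scaleR_left_distrib add_ac)
  have "compact (D ` cball 0 (R + 2))" by (intro compact_continuous_image continuous_on_subset[OF cD]) auto
  then obtain B where "\<forall>y\<in>D ` cball 0 (R + 2). norm y \<le> B" using compact_imp_bounded bounded_iff by metis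
  then have B: "\<bar>D x\<bar> \<le> B" if "norm x \<le> R + 2" for x using that by auto
  have q: "\<bar>?q n x\<bar> \<le> \<bar>B\<bar> * indicator (cball 0 (R + 1)) x" for n x
  proof (cases "norm x \<le> R + 1")
    case True
    obtain z where z: "0 < z" "z < ?h n" "F (x + ?h n *\<^sub>R i) - F (x + 0 *\<^sub>R i) = (?h n - 0) * D (x + z *\<^sub>R i)"
      using MVT2[of 0 "?h n" "\<lambda>s. F (x + s *\<^sub>R i)" "\<lambda>s. D (x + s *\<^sub>R i)"] D' by auto
    have "?h n \<le> 1" by simp
    then have "z \<le> 1" using z(2) by linarith
    then have "norm (z *\<^sub>R i) \<le> 1" using z(1) i by simp
    then have "norm (x + z *\<^sub>R i) \<le> R + 2" using True norm_triangle_ineq[of x "z *\<^sub>R i"] by linarith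
    moreover have "?q n x = D (x + z *\<^sub>R i)" using z(3) by simp
    ultimately show ?thesis using B[of "x + z *\<^sub>R i"] True by (simp add: indicator_def)
  next
    case False
    have "?h n \<le> 1" by simp
    then have "norm (?h n *\<^sub>R i) \<le> 1" using i by simp
    moreover have "norm x \<le> norm (x + ?h n *\<^sub>R i) + norm (?h n *\<^sub>R i)"
      using norm_triangle_ineq4[of "x + ?h n *\<^sub>R i" "?h n *\<^sub>R i"] by simp
    ultimately have "R < norm (x + ?h n *\<^sub>R i)" "R < norm x" using False by linarith+
    then show ?thesis using supp by simp
  qed
  have mq: "?q n \<in> borel_measurable lborel" for n
  proof -
    have "(\<lambda>x. F (x + ?h n *\<^sub>R i)) \<in> borel_measurable borel"
      by (rule measurable_compose[OF _ mF]) simp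
    then show ?thesis using mF by simp
  qed
  show "(\<lambda>n. \<integral>x. ?q n x \<partial>lborel) \<longlonglongrightarrow> (\<integral>x. D x \<partial>lborel)"
  proof (rule integral_dominated_convergence[where w = "\<lambda>x. \<bar>B\<bar> * indicator (cball 0 (R + 1)) x"])
    show "AE x in lborel. (\<lambda>n. ?q n x) \<longlonglongrightarrow> D x"
    proof (rule AE_I2)
      fix x
      have "((\<lambda>h. (F (x + (0 + h) *\<^sub>R i) - F (x + 0 *\<^sub>R i)) / h) \<longlongrightarrow> D x) (at 0)" using D[of x] by (simp add: DERIV_def)
      moreover have "filterlim ?h (at 0) sequentially" using h by (intro filterlim_atI) auto
      ultimately have "(\<lambda>n. (F (x + (0 + ?h n) *\<^sub>R i) - F (x + 0 *\<^sub>R i)) / ?h n) \<longlonglongrightarrow> D x"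
        by (rule filterlim_compose)
      then show "(\<lambda>n. ?q n x) \<longlonglongrightarrow> D x" by simp
    qed
    show "integrable lborel (\<lambda>x. \<bar>B\<bar> * indicator (cball 0 (R + 1)) x :: real)"
      by (intro integrable_mult_right integrable_real_indicator emeasure_bounded_finite bounded_cball) simp
    show "AE x in lborel. norm (?q n x) \<le> \<bar>B\<bar> * indicator (cball 0 (R + 1)) x" for n
      unfolding real_norm_def by (intro AE_I2 q)
  qed (use mq mD in auto)
  have iF: "integrable lborel F" by (rule integrable_continuous_bounded_support[OF cF supp])
  have "(\<integral>x. ?q n x \<partial>lborel) = 0" for n
  proof -
    let ?a = "?h n *\<^sub>R i"
    have "integrable lborel (\<lambda>x. F (x + ?a))"
    proof -
      have "integrable (distr lborel borel ((+) ?a)) F" using iF by (simp add: lborel_distr_plus)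
      then have "integrable lborel (\<lambda>x. F (?a + x))" by (subst (asm) integrable_distr_eq) (use mF in auto)
      then show ?thesis by (simp add: add.commute)
    qed
    then have "(\<integral>x. F (x + ?a) - F x \<partial>lborel) = 0" using iF integral_lborel_translate[OF mF, of ?a] by simp
    then show ?thesis by simp
  qed
  then show "(\<lambda>n. \<integral>x. ?q n x \<partial>lborel) \<longlonglongrightarrow> 0" by simp
qed

lemma test_function_grad:
  fixes \<psi> :: "'a::euclidean_space \<Rightarrow> real"
  assumes "test_function S \<psi>"
  shows test_function_has_derivative: "(\<psi> has_derivative (\<lambda>v. grad \<psi> x \<bullet> v)) (at x)"
    and continuous_on_grad: "continuous_on UNIV (grad \<psi>)"
    and test_function_cont: "continuous_on UNIV \<psi>"
    and test_function_outside: "x \<notin> S \<Longrightarrow> \<psi> x = 0"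
    and grad_outside: "x \<notin> S \<Longrightarrow> grad \<psi> x = 0"
proof -
  have C: "Cm m \<psi>" for m using assms by (simp add: test_function_def)
  show "continuous_on UNIV \<psi>" using C[of 0] by simp
  have d: "\<psi> differentiable (at x)" for x using C[of "Suc 0"] by simp
  have fd: "(\<psi> has_derivative frechet_derivative \<psi> (at x)) (at x)" for x
    using d[of x] by (simp only: frechet_derivative_works[symmetric])
  have "grad \<psi> x \<bullet> v = frechet_derivative \<psi> (at x) v" for v x
  proof -
    interpret linear "frechet_derivative \<psi> (at x)" using linear_frechet_derivative[OF d] .
    have "grad \<psi> x \<bullet> v = (\<Sum>i\<in>Basis. frechet_derivative \<psi> (at x) i * (i \<bullet> v))"
      by (simp add: grad_def inner_sum_left)
    also have "\<dots> = frechet_derivative \<psi> (at x) (\<Sum>i\<in>Basis. (v \<bullet> i) *\<^sub>R i)"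
      by (simp add: sum scale inner_commute mult.commute)
    finally show ?thesis by (simp add: euclidean_representation)
  qed
  then show hd: "(\<psi> has_derivative (\<lambda>v. grad \<psi> x \<bullet> v)) (at x)" for x using fd[of x] by simp
  have "continuous_on UNIV (\<lambda>x. frechet_derivative \<psi> (at x) i)" if "i \<in> Basis" for i
    using C[of "Suc 0"] that by simp
  then show "continuous_on UNIV (grad \<psi>)"
    unfolding grad_def by (intro continuous_on_sum continuous_on_scaleR continuous_on_const)
  show "\<psi> x = 0" if "x \<notin> S" for x
    using assms that closure_subset[of "{x. \<psi> x \<noteq> 0}"] unfolding test_function_def by blast
  show "grad \<psi> x = 0" if "x \<notin> S"
  proof -
    let ?U = "- closure {x. \<psi> x \<noteq> 0}"
    have x: "x \<in> ?U" using assms that by (auto simp: test_function_def)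
    have z: "0 = \<psi> y" if "y \<in> ?U" for y using that closure_subset[of "{x. \<psi> x \<noteq> 0}"] by auto
    have "((\<lambda>_. 0) has_derivative (\<lambda>v. 0)) (at x)" by simp
    then have "(\<psi> has_derivative (\<lambda>v. 0)) (at x)"
      by (rule has_derivative_transform_within_open[OF _ _ x z]) (simp_all add: open_Compl)
    from has_derivative_unique[OF hd this] have "grad \<psi> x \<bullet> grad \<psi> x = 0" by (rule fun_cong)
    then show ?thesis by simp
  qed
qed

lemma integral_lebesgue_on_eq_lborel:
  fixes f :: "'a::euclidean_space \<Rightarrow> real"
  assumes "f \<in> borel_measurable borel" "S \<in> sets lebesgue" "\<And>x. x \<notin> S \<Longrightarrow> f x = 0"
  shows "(\<integral>x. f x \<partial>lebesgue_on S) = (\<integral>x. f x \<partial>lborel)"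
    and "integrable (lebesgue_on S) f \<longleftrightarrow> integrable lborel f"
proof -
  have e: "(\<lambda>x. if x \<in> S then f x else 0) = f" using assms(3) by auto
  have "(\<integral>x. f x \<partial>lebesgue_on S) = (\<integral>x. f x \<partial>lebesgue)"
    using Lebesgue_Measure.integral_restrict_UNIV[OF assms(2), of f] e by simp
  then show "(\<integral>x. f x \<partial>lebesgue_on S) = (\<integral>x. f x \<partial>lborel)" using assms(1) by (simp add: integral_completion)
  have "integrable (lebesgue_on S) f \<longleftrightarrow> integrable lebesgue f"
    using Lebesgue_Measure.integrable_restrict_UNIV[OF assms(2), of f] e by simp
  then show "integrable (lebesgue_on S) f \<longleftrightarrow> integrable lborel f" using assms(1) by (simp add: integrable_completion)
qed

text \<open>
  Since \<open>x \<bullet> i\<close> has derivative \<open>1\<close> in the direction \<open>i\<close>, the integral of \<open>\<partial>\<^sub>i ((x \<bullet> i) * \<psi>\<^sup>2)\<close>, which is \<open>0\<close>,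
  expresses \<open>\<integral>\<psi>\<^sup>2\<close> by \<open>\<integral>(x \<bullet> i) * \<psi> * \<partial>\<^sub>i\<psi>\<close>; half of \<open>\<integral>\<psi>\<^sup>2\<close> is then absorbed into the left-hand side.
\<close>

lemma Poincare_test_function:
  fixes \<psi> :: "'a::euclidean_space \<Rightarrow> real"
  assumes \<psi>: "test_function S \<psi>" and R: "\<And>x. x \<in> S \<Longrightarrow> norm x \<le> R"
  shows "(\<integral>x. (\<psi> x)\<^sup>2 \<partial>lborel) \<le> 4 * R\<^sup>2 * (\<integral>x. (norm (grad \<psi> x))\<^sup>2 \<partial>lborel)"
proof -
  obtain i :: 'a where i: "i \<in> Basis" using nonempty_Basis by blast
  note c = test_function_cont[OF \<psi>] continuous_on_grad[OF \<psi>]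
  have z: "\<psi> x = 0" "grad \<psi> x = 0" if "R < norm x" for x
    using that R[of x] test_function_outside[OF \<psi>, of x] grad_outside[OF \<psi>, of x] by force+
  let ?D = "\<lambda>x. (\<psi> x)\<^sup>2 + (x \<bullet> i) * (2 * \<psi> x * (grad \<psi> x \<bullet> i))"
  have zero: "(\<integral>x. ?D x \<partial>lborel) = 0"
  proof (rule integral_directional_derivative_eq_0[where F = "\<lambda>x. (x \<bullet> i) * (\<psi> x)\<^sup>2" and R = R and i = i])
    fix x
    have "((\<lambda>s. x + s *\<^sub>R i) has_derivative (\<lambda>s. s *\<^sub>R i)) (at 0)"
      by (auto intro!: derivative_eq_intros)
    from has_derivative_compose[OF this, of \<psi> "\<lambda>v. grad \<psi> x \<bullet> v"] test_function_has_derivative[OF \<psi>, of x]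
    have "((\<lambda>s. \<psi> (x + s *\<^sub>R i)) has_derivative (\<lambda>s. grad \<psi> x \<bullet> (s *\<^sub>R i))) (at 0)" by simp
    then have 1: "((\<lambda>s. \<psi> (x + s *\<^sub>R i)) has_real_derivative grad \<psi> x \<bullet> i) (at 0)"
      by (simp add: has_field_derivative_def mult.commute[of _ "grad \<psi> x \<bullet> i"])
    have 2: "((\<lambda>s. (x + s *\<^sub>R i) \<bullet> i) has_real_derivative 1) (at 0)"
      using i by (auto intro!: derivative_eq_intros simp: inner_add_left)
    from DERIV_mult[OF 2 DERIV_power[OF 1, of 2]]
    show "((\<lambda>s. ((x + s *\<^sub>R i) \<bullet> i) * (\<psi> (x + s *\<^sub>R i))\<^sup>2) has_real_derivative ?D x) (at 0)"
      by (simp add: algebra_simps)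
  next
    show "continuous_on UNIV (\<lambda>x. (x \<bullet> i) * (\<psi> x)\<^sup>2)" "continuous_on UNIV ?D"
      using c by (auto intro!: continuous_intros)
  qed (use z i in auto)
  have int: "integrable lborel (\<lambda>x. (\<psi> x)\<^sup>2)" "integrable lborel (\<lambda>x. (x \<bullet> i) * (2 * \<psi> x * (grad \<psi> x \<bullet> i)))"
    "integrable lborel (\<lambda>x. (norm (grad \<psi> x))\<^sup>2)"
    by (intro integrable_continuous_bounded_support[where R = R] continuous_intros c, simp add: z)+
  have "(\<integral>x. (\<psi> x)\<^sup>2 \<partial>lborel) = (\<integral>x. - ((x \<bullet> i) * (2 * \<psi> x * (grad \<psi> x \<bullet> i))) \<partial>lborel)"
    using zero int by simp
  also have "\<dots> \<le> (\<integral>x. (\<psi> x)\<^sup>2 / 2 + 2 * R\<^sup>2 * (norm (grad \<psi> x))\<^sup>2 \<partial>lborel)"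
  proof (rule integral_mono)
    fix x
    show "- ((x \<bullet> i) * (2 * \<psi> x * (grad \<psi> x \<bullet> i))) \<le> (\<psi> x)\<^sup>2 / 2 + 2 * R\<^sup>2 * (norm (grad \<psi> x))\<^sup>2"
    proof (cases "R < norm x")
      case False
      let ?y = "(x \<bullet> i) * (grad \<psi> x \<bullet> i)"
      have "0 \<le> (\<psi> x + 2 * ?y)\<^sup>2" by simp
      then have 1: "- (2 * \<psi> x * ?y) \<le> (\<psi> x)\<^sup>2 / 2 + 2 * ?y\<^sup>2"
        unfolding power2_sum by (simp add: power2_eq_square)
      have "\<bar>?y\<bar> \<le> R * norm (grad \<psi> x)"
        unfolding abs_mult using Basis_le_norm[OF i, of x] Basis_le_norm[OF i, of "grad \<psi> x"] False
        by (intro mult_mono) auto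
      then have "?y\<^sup>2 \<le> (R * norm (grad \<psi> x))\<^sup>2" by (metis abs_ge_zero power2_abs power_mono)
      then show ?thesis using 1 by (simp add: power_mult_distrib algebra_simps)
    qed (simp add: z)
  qed (use int in auto)
  also have "\<dots> = (\<integral>x. (\<psi> x)\<^sup>2 \<partial>lborel) / 2 + 2 * R\<^sup>2 * (\<integral>x. (norm (grad \<psi> x))\<^sup>2 \<partial>lborel)"
    using int by simp
  finally show ?thesis by simp
qed

lemma L2_norm_sq: "(L2_norm N v)\<^sup>2 = (\<integral>x. (norm (v x))\<^sup>2 \<partial>N)"
  by (simp add: L2_norm_def)

lemma norm_add_sq_le: "(norm (x + y))\<^sup>2 \<le> 2 * (norm x)\<^sup>2 + 2 * (norm (y :: 'a::real_normed_vector))\<^sup>2"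
proof -
  have "(norm (x + y))\<^sup>2 \<le> (norm x + norm y)\<^sup>2" by (intro power_mono norm_triangle_ineq) simp
  moreover have "0 \<le> (norm x - norm y)\<^sup>2" by simp
  ultimately show ?thesis unfolding power2_sum power2_diff by linarith
qed

lemma L2_diff_integrable:
  assumes "u \<in> L2 N" "v \<in> L2 N"
  shows "integrable N (\<lambda>x. (norm (u x - v x))\<^sup>2)"
proof (rule Bochner_Integration.integrable_bound)
  show "integrable N (\<lambda>x. 2 * (norm (u x))\<^sup>2 + 2 * (norm (v x))\<^sup>2)" using assms by (simp add: L2_def)
  show "(\<lambda>x. (norm (u x - v x))\<^sup>2) \<in> borel_measurable N"
    by (intro borel_measurable_power borel_measurable_norm borel_measurable_diff) (use assms in \<open>auto simp: L2_def\<close>)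
  show "AE x in N. norm ((norm (u x - v x))\<^sup>2) \<le> norm (2 * (norm (u x))\<^sup>2 + 2 * (norm (v x))\<^sup>2)"
    using norm_add_sq_le[of "u _" "- v _"] by (intro AE_I2) simp
qed

lemma L2_norm_sq_le:
  assumes "u \<in> L2 N" "v \<in> L2 N"
  shows "(\<integral>x. (norm (v x))\<^sup>2 \<partial>N) \<le> 2 * (\<integral>x. (norm (u x))\<^sup>2 \<partial>N) + 2 * (L2_norm N (\<lambda>x. u x - v x))\<^sup>2"
proof -
  note d = L2_diff_integrable[OF assms]
  have "(\<integral>x. (norm (v x))\<^sup>2 \<partial>N) \<le> (\<integral>x. 2 * (norm (u x))\<^sup>2 + 2 * (norm (u x - v x))\<^sup>2 \<partial>N)"
  proof (rule integral_mono)
    show "(norm (v x))\<^sup>2 \<le> 2 * (norm (u x))\<^sup>2 + 2 * (norm (u x - v x))\<^sup>2" for x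
      using norm_add_sq_le[of "u x" "v x - u x"] by (simp add: norm_minus_commute)
  qed (use assms d in \<open>auto simp: L2_def\<close>)
  also have "\<dots> = 2 * (\<integral>x. (norm (u x))\<^sup>2 \<partial>N) + 2 * (L2_norm N (\<lambda>x. u x - v x))\<^sup>2"
    using assms d by (simp add: L2_def L2_norm_sq)
  finally show ?thesis .
qed

lemma weak_grad_in_L2:
  assumes "w \<in> H01 \<Omega>"
  shows "weak_grad \<Omega> w \<in> L2 (lebesgue_on \<Omega>)"
proof -
  have "\<exists>G. G \<in> L2 (lebesgue_on \<Omega>) \<and> has_weak_grad \<Omega> w G" using assms by (auto simp: H01_def)
  from someI_ex[OF this] show ?thesis by (simp add: weak_grad_def)
qed

text \<open>
  By density.  Each of the two passages to the limit is done with \<open>(x + y)\<^sup>2 \<le> 2 * x\<^sup>2 + 2 * y\<^sup>2\<close>, which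
  costs a factor \<open>2\<close>.
\<close>

lemma Poincare_H01:
  fixes w :: "'a::euclidean_space \<Rightarrow> real"
  assumes w: "w \<in> H01 \<Omega>" and \<Omega>: "open \<Omega>" and R: "\<And>x. x \<in> \<Omega> \<Longrightarrow> norm x \<le> R"
  shows "(\<integral>x. (w x)\<^sup>2 \<partial>lebesgue_on \<Omega>) \<le> 16 * R\<^sup>2 * (\<integral>x. (norm (weak_grad \<Omega> w x))\<^sup>2 \<partial>lebesgue_on \<Omega>)"
proof -
  let ?N = "lebesgue_on \<Omega>" and ?G = "weak_grad \<Omega> w"
  have wL: "w \<in> L2 ?N" using w by (simp add: H01_def)
  have GL: "?G \<in> L2 ?N" by (rule weak_grad_in_L2[OF w])
  obtain \<psi> where \<psi>: "\<And>m::nat. test_function \<Omega> (\<psi> m)"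
    and l1: "(\<lambda>m. L2_norm ?N (\<lambda>x. \<psi> m x - w x)) \<longlonglongrightarrow> 0"
    and l2: "(\<lambda>m. L2_norm ?N (\<lambda>x. grad (\<psi> m) x - ?G x)) \<longlonglongrightarrow> 0"
    using w by (auto simp: H01_def)
  let ?a = "\<lambda>m. (L2_norm ?N (\<lambda>x. \<psi> m x - w x))\<^sup>2" and ?b = "\<lambda>m. (L2_norm ?N (\<lambda>x. grad (\<psi> m) x - ?G x))\<^sup>2"
  have S: "\<Omega> \<in> sets lebesgue" using \<Omega> by simp
  have "(\<integral>x. (w x)\<^sup>2 \<partial>?N) \<le> 16 * R\<^sup>2 * (\<integral>x. (norm (?G x))\<^sup>2 \<partial>?N) + (2 * ?a m + 16 * R\<^sup>2 * ?b m)" for m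
  proof -
    let ?p = "\<psi> m" and ?g = "grad (\<psi> m)"
    note c = test_function_cont[OF \<psi>[of m]] continuous_on_grad[OF \<psi>[of m]]
    have z: "\<And>x. x \<notin> \<Omega> \<Longrightarrow> (?p x)\<^sup>2 = 0" "\<And>x. x \<notin> \<Omega> \<Longrightarrow> (norm (?g x))\<^sup>2 = 0"
      using test_function_outside[OF \<psi>] grad_outside[OF \<psi>] by auto
    have mb: "(\<lambda>x. (?p x)\<^sup>2) \<in> borel_measurable borel" "(\<lambda>x. (norm (?g x))\<^sup>2) \<in> borel_measurable borel"
      using c by (auto intro!: borel_measurable_continuous_onI continuous_intros)
    have ib: "integrable lborel (\<lambda>x. (?p x)\<^sup>2)" "integrable lborel (\<lambda>x. (norm (?g x))\<^sup>2)"
      using z R by (intro integrable_continuous_bounded_support[where R = R] continuous_intros c, force)+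
    have pL: "?p \<in> L2 ?N" "?g \<in> L2 ?N"
      using c ib integral_lebesgue_on_eq_lborel(2)[OF mb(1) S z(1)] integral_lebesgue_on_eq_lborel(2)[OF mb(2) S z(2)]
      by (auto simp: L2_def intro!: continuous_imp_measurable_on_sets_lebesgue[OF _ S] intro: continuous_on_subset)
    have "(\<integral>x. (w x)\<^sup>2 \<partial>?N) \<le> 2 * (\<integral>x. (?p x)\<^sup>2 \<partial>?N) + 2 * ?a m" using L2_norm_sq_le[OF pL(1) wL] by simp
    moreover have "(\<integral>x. (?p x)\<^sup>2 \<partial>?N) \<le> 4 * R\<^sup>2 * (\<integral>x. (norm (?g x))\<^sup>2 \<partial>?N)"
      using Poincare_test_function[OF \<psi> R] integral_lebesgue_on_eq_lborel(1)[OF mb(1) S z(1)]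
        integral_lebesgue_on_eq_lborel(1)[OF mb(2) S z(2)] by simp
    moreover have "(\<integral>x. (norm (?g x))\<^sup>2 \<partial>?N) \<le> 2 * (\<integral>x. (norm (?G x))\<^sup>2 \<partial>?N) + 2 * ?b m"
      using L2_norm_sq_le[OF GL pL(2)] by (simp add: L2_norm_def norm_minus_commute)
    then have "4 * R\<^sup>2 * (\<integral>x. (norm (?g x))\<^sup>2 \<partial>?N) \<le> 4 * R\<^sup>2 * (2 * (\<integral>x. (norm (?G x))\<^sup>2 \<partial>?N) + 2 * ?b m)"
      by (intro mult_left_mono) auto
    ultimately show ?thesis by (simp add: algebra_simps)
  qed
  moreover have "(\<lambda>m. 16 * R\<^sup>2 * (\<integral>x. (norm (?G x))\<^sup>2 \<partial>?N) + (2 * ?a m + 16 * R\<^sup>2 * ?b m))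
     \<longlonglongrightarrow> 16 * R\<^sup>2 * (\<integral>x. (norm (?G x))\<^sup>2 \<partial>?N) + (2 * 0\<^sup>2 + 16 * R\<^sup>2 * 0\<^sup>2)"
    by (intro tendsto_intros l1 l2)
  ultimately show ?thesis by (intro LIMSEQ_le_const[of _ _ "\<integral>x. (w x)\<^sup>2 \<partial>?N"]) auto
qed

text \<open>
  Testing the eigenvalue equation with \<open>w\<close> itself gives
  \<open>\<mu> = \<integral>(A \<nabla>w) \<bullet> \<nabla>w + c * w\<^sup>2 \<ge> \<alpha> * \<integral>\<bar>\<nabla>w\<bar>\<^sup>2\<close>, and Poincare's inequality bounds the right-hand side below.
\<close>

lemma eigenvalue_lower_bound:
  fixes \<Omega> :: "(real^'n) set"
  assumes \<Omega>: "open \<Omega>" "bounded \<Omega>"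
    and A: "0 < \<alpha>" "\<forall>x\<in>\<Omega>. \<forall>\<xi>. \<xi> \<bullet> (A x *v \<xi>) \<ge> \<alpha> * (norm \<xi>)\<^sup>2"
    and c: "AE x in lebesgue_on \<Omega>. 0 \<le> c x \<and> c x \<le> K"
  obtains l0 where "0 < l0"
    "\<And>\<mu> w. 0 < \<mu> \<Longrightarrow> eigenpair \<Omega> A c \<mu> w \<Longrightarrow> (\<integral>x. w x * w x \<partial>lebesgue_on \<Omega>) = 1 \<Longrightarrow> l0 \<le> \<mu>"
proof -
  let ?N = "lebesgue_on \<Omega>"
  obtain R where R: "0 < R" "\<And>x. x \<in> \<Omega> \<Longrightarrow> norm x \<le> R" using \<Omega>(2) unfolding bounded_pos by blast
  show thesis
  proof (rule that)
    show "0 < \<alpha> / (16 * R\<^sup>2)" using A R by simp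
    fix \<mu> w assume \<mu>: "0 < \<mu>" and e: "eigenpair \<Omega> A c \<mu> w" and n: "(\<integral>x. w x * w x \<partial>?N) = 1"
    let ?G = "weak_grad \<Omega> w"
    have w: "w \<in> H01 \<Omega>" using e by (simp add: eigenpair_def)
    let ?f = "\<lambda>x. (A x *v ?G x) \<bullet> ?G x + c x * w x * w x"
    have E: "(\<integral>x. ?f x \<partial>?N) = \<mu>" using e w n by (simp add: eigenpair_def energy_form_def)
    \<comment> \<open>The integral of a function that is not integrable would be \<open>0\<close>, but \<open>\<mu> > 0\<close>.\<close>
    then have fi: "integrable ?N ?f" using \<mu> not_integrable_integral_eq by fastforce
    have G: "integrable ?N (\<lambda>x. (norm (?G x))\<^sup>2)" using weak_grad_in_L2[OF w] by (simp add: L2_def)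
    have "\<alpha> * (\<integral>x. (norm (?G x))\<^sup>2 \<partial>?N) = (\<integral>x. \<alpha> * (norm (?G x))\<^sup>2 \<partial>?N)" by simp
    also have "\<dots> \<le> (\<integral>x. ?f x \<partial>?N)"
    proof (rule integral_mono_AE[OF _ fi])
      show "AE x in ?N. \<alpha> * (norm (?G x))\<^sup>2 \<le> ?f x" using c AE_space
      proof eventually_elim
        case (elim x)
        then have "\<alpha> * (norm (?G x))\<^sup>2 \<le> (A x *v ?G x) \<bullet> ?G x" using A(2) by (simp add: inner_commute)
        moreover have "0 \<le> c x * (w x * w x)" by (rule mult_nonneg_nonneg) (use elim in auto)
        ultimately show ?case by (simp add: mult.assoc)
      qed
    qed (use G in simp)
    finally have 1: "\<alpha> * (\<integral>x. (norm (?G x))\<^sup>2 \<partial>?N) \<le> \<mu>" using E by simp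
    have "1 \<le> 16 * R\<^sup>2 * (\<integral>x. (norm (?G x))\<^sup>2 \<partial>?N)"
      using Poincare_H01[OF w \<Omega>(1) R(2)] n by (simp add: power2_eq_square)
    then have "\<alpha> * 1 \<le> \<alpha> * (16 * R\<^sup>2 * (\<integral>x. (norm (?G x))\<^sup>2 \<partial>?N))" using A by (intro mult_left_mono) auto
    also have "\<dots> = 16 * R\<^sup>2 * (\<alpha> * (\<integral>x. (norm (?G x))\<^sup>2 \<partial>?N))" by simp
    also have "\<dots> \<le> 16 * R\<^sup>2 * \<mu>" using 1 by (intro mult_left_mono) auto
    finally show "\<alpha> / (16 * R\<^sup>2) \<le> \<mu>" using R by (simp add: field_simps)
  qed
qed

lemma L2_mult_integrable:
  fixes u v :: "'a \<Rightarrow> real"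
  assumes "u \<in> L2 N" "v \<in> L2 N"
  shows "integrable N (\<lambda>x. u x * v x)"
proof (rule Bochner_Integration.integrable_bound)
  show "integrable N (\<lambda>x. (u x)\<^sup>2 + (v x)\<^sup>2)" using assms by (simp add: L2_def)
  show "(\<lambda>x. u x * v x) \<in> borel_measurable N"
    by (intro borel_measurable_times) (use assms in \<open>auto simp: L2_def\<close>)
  have "\<bar>a * b\<bar> \<le> a\<^sup>2 + b\<^sup>2" for a b :: real
  proof -
    have "0 \<le> (\<bar>a\<bar> - \<bar>b\<bar>)\<^sup>2" "0 \<le> \<bar>a\<bar> * \<bar>b\<bar>" by auto
    then show ?thesis unfolding power2_diff abs_mult power2_abs by linarith
  qed
  then show "AE x in N. norm (u x * v x) \<le> norm ((u x)\<^sup>2 + (v x)\<^sup>2)" by simp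
qed

lemma Bessel_inequality:
  assumes \<phi>: "orthonormal_basis \<Omega> \<phi>" and h: "h \<in> L2 (lebesgue_on \<Omega>)"
  shows "summable (\<lambda>k. (fourier_coeff \<Omega> \<phi> h k)\<^sup>2)"
    and "(\<Sum>k. (fourier_coeff \<Omega> \<phi> h k)\<^sup>2) \<le> (L2_norm (lebesgue_on \<Omega>) h)\<^sup>2"
proof -
  let ?N = "lebesgue_on \<Omega>" and ?c = "fourier_coeff \<Omega> \<phi> h"
  have L: "\<phi> k \<in> L2 ?N" for k using \<phi> by (simp add: orthonormal_basis_def)
  have on: "(\<integral>x. \<phi> j x * \<phi> k x \<partial>?N) = (if j = k then 1 else 0)" for j k
    using \<phi> by (simp add: orthonormal_basis_def)
  have b: "(\<Sum>k<n. (?c k)\<^sup>2) \<le> (L2_norm ?N h)\<^sup>2" for n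
  proof -
    let ?S = "\<lambda>x. \<Sum>k<n. ?c k * \<phi> k x"
    have hh: "integrable ?N (\<lambda>x. h x * h x)" by (rule L2_mult_integrable[OF h h])
    have hp: "integrable ?N (\<lambda>x. h x * \<phi> k x)" for k by (rule L2_mult_integrable[OF h L])
    have pp: "integrable ?N (\<lambda>x. \<phi> j x * \<phi> k x)" for j k by (rule L2_mult_integrable[OF L L])
    have e1: "h x * ?S x = (\<Sum>k<n. ?c k * (h x * \<phi> k x))" for x by (simp add: sum_distrib_left mult_ac)
    have e2: "?S x * ?S x = (\<Sum>j<n. \<Sum>k<n. ?c j * ?c k * (\<phi> j x * \<phi> k x))" for x
      by (simp add: sum_product mult_ac)
    have hS: "integrable ?N (\<lambda>x. h x * ?S x)" "(\<integral>x. h x * ?S x \<partial>?N) = (\<Sum>k<n. (?c k)\<^sup>2)"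
      unfolding e1 using hp by (auto simp: fourier_coeff_def power2_eq_square)
    have SS: "integrable ?N (\<lambda>x. ?S x * ?S x)" "(\<integral>x. ?S x * ?S x \<partial>?N) = (\<Sum>k<n. (?c k)\<^sup>2)"
      unfolding e2 using pp by (auto simp: on power2_eq_square if_distrib sum.If_cases cong: if_cong)
    have "0 \<le> (\<integral>x. (h x - ?S x)\<^sup>2 \<partial>?N)" by simp
    also have "(\<integral>x. (h x - ?S x)\<^sup>2 \<partial>?N) = (\<integral>x. h x * h x - 2 * (h x * ?S x) + ?S x * ?S x \<partial>?N)"
      by (simp add: power2_eq_square algebra_simps)
    also have "\<dots> = (\<integral>x. h x * h x \<partial>?N) - (\<Sum>k<n. (?c k)\<^sup>2)" using hh hS SS by simp
    also have "(\<integral>x. h x * h x \<partial>?N) = (L2_norm ?N h)\<^sup>2"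
      by (simp only: L2_norm_sq real_norm_def power2_abs) (simp add: power2_eq_square)
    finally show ?thesis by simp
  qed
  show s: "summable (\<lambda>k. (?c k)\<^sup>2)" by (rule summableI_nonneg_bounded[OF _ b]) simp
  show "(\<Sum>k. (?c k)\<^sup>2) \<le> (L2_norm ?N h)\<^sup>2" by (rule suminf_le_const[OF s b])
qed

section \<open>Functions with values in \<open>\<ell>\<^sup>2\<close>\<close>

definition unit_vec :: "nat \<Rightarrow> ell2" where
  "unit_vec k = Ell2 (\<lambda>j. if j = k then 1 else 0)"

lemma coord_unit_vec: "coord (unit_vec k) j = (if j = k then 1 else 0)"
  unfolding unit_vec_def by (subst coord_Ell2, rule summable_finite[of "{k}"]) auto

lemma coord_sum: "coord (\<Sum>i\<in>I. f i) k = (\<Sum>i\<in>I. coord (f i) k)"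
  by (induction I rule: infinite_finite_induct) (auto simp: coord_zero coord_plus)

lemma LIMSEQ_coord_expansion: "(\<lambda>n. \<Sum>k<n. coord x k *\<^sub>R unit_vec k) \<longlonglongrightarrow> x"
proof -
  have c: "coord (x - (\<Sum>k<n. coord x k *\<^sub>R unit_vec k)) j = (if j < n then 0 else coord x j)" for n j
    by (auto simp: coord_minus coord_sum coord_scaleR coord_unit_vec if_distrib sum.If_cases cong: if_cong)
  have "(norm (x - (\<Sum>k<n. coord x k *\<^sub>R unit_vec k)))\<^sup>2 = (\<Sum>k. (coord x k)\<^sup>2) - (\<Sum>k<n. (coord x k)\<^sup>2)" for n
  proof -
    have "(norm (x - (\<Sum>k<n. coord x k *\<^sub>R unit_vec k)))\<^sup>2 = (\<Sum>j. (coord x j)\<^sup>2 - (if j \<in> {..<n} then (coord x j)\<^sup>2 else 0))"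
      unfolding norm_ell2_sq c by (intro suminf_cong) auto
    also have "\<dots> = (\<Sum>k. (coord x k)\<^sup>2) - (\<Sum>j. if j \<in> {..<n} then (coord x j)\<^sup>2 else 0)"
      by (intro suminf_diff[symmetric] summable_coord summable_finite[of "{..<n}"]) auto
    also have "(\<Sum>j. if j \<in> {..<n} then (coord x j)\<^sup>2 else 0) = (\<Sum>k<n. (coord x k)\<^sup>2)"
      using sums_If_finite_set[of "{..<n}" "\<lambda>j. (coord x j)\<^sup>2"] by (simp add: sums_iff)
    finally show ?thesis .
  qed
  moreover have "(\<lambda>n. (\<Sum>k. (coord x k)\<^sup>2) - (\<Sum>k<n. (coord x k)\<^sup>2)) \<longlonglongrightarrow> (\<Sum>k. (coord x k)\<^sup>2) - (\<Sum>k. (coord x k)\<^sup>2)"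
    by (intro tendsto_intros summable_LIMSEQ summable_coord)
  ultimately have "(\<lambda>n. (norm (x - (\<Sum>k<n. coord x k *\<^sub>R unit_vec k)))\<^sup>2) \<longlonglongrightarrow> 0" by simp
  from tendsto_real_sqrt[OF this]
  have "(\<lambda>n. norm (x - (\<Sum>k<n. coord x k *\<^sub>R unit_vec k))) \<longlonglongrightarrow> 0" by simp
  then have "(\<lambda>n. x - (\<Sum>k<n. coord x k *\<^sub>R unit_vec k)) \<longlonglongrightarrow> 0" by (rule tendsto_norm_zero_cancel)
  from tendsto_diff[OF tendsto_const[of x] this] show ?thesis by simp
qed

lemma ell2_borel_measurableI:
  assumes "\<And>k. (\<lambda>t. coord (V t) k) \<in> borel_measurable N"
  shows "V \<in> borel_measurable N"
proof (rule borel_measurable_LIMSEQ_metric)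
  show "(\<lambda>t. \<Sum>k<n. coord (V t) k *\<^sub>R unit_vec k) \<in> borel_measurable N" for n
    by (intro borel_measurable_sum borel_measurable_scaleR assms) simp
  show "(\<lambda>n. \<Sum>k<n. coord (V t) k *\<^sub>R unit_vec k) \<longlonglongrightarrow> V t" for t
    by (rule LIMSEQ_coord_expansion)
qed

lemma coord_borel_measurable: "V \<in> borel_measurable N \<Longrightarrow> (\<lambda>t. coord (V t) k) \<in> borel_measurable N"
  by (rule measurable_compose[OF _ borel_measurable_continuous_onI[OF
    linear_continuous_on[OF bounded_linear_coord]]])

lemma coord_square_integrals:
  assumes "V \<in> L2 N"
  shows "integrable N (\<lambda>t. (coord (V t) k)\<^sup>2)" "summable (\<lambda>k. \<integral>t. (coord (V t) k)\<^sup>2 \<partial>N)"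
    "(\<Sum>k. \<integral>t. (coord (V t) k)\<^sup>2 \<partial>N) \<le> (L2_norm N V)\<^sup>2"
proof -
  have V: "V \<in> borel_measurable N" "integrable N (\<lambda>t. (norm (V t))\<^sup>2)" using assms by (auto simp: L2_def)
  show i: "integrable N (\<lambda>t. (coord (V t) k)\<^sup>2)" for k
  proof (rule Bochner_Integration.integrable_bound[OF V(2)])
    show "AE t in N. norm ((coord (V t) k)\<^sup>2) \<le> norm ((norm (V t))\<^sup>2)"
    proof (rule AE_I2)
      fix t
      have "\<bar>coord (V t) k\<bar>\<^sup>2 \<le> (norm (V t))\<^sup>2" by (intro power_mono abs_coord_le) simp
      then show "norm ((coord (V t) k)\<^sup>2) \<le> norm ((norm (V t))\<^sup>2)" by simp
    qed
  qed (use coord_borel_measurable[OF V(1)] in simp)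
  have b: "(\<Sum>k<n. \<integral>t. (coord (V t) k)\<^sup>2 \<partial>N) \<le> (L2_norm N V)\<^sup>2" for n
  proof -
    have "(\<Sum>k<n. \<integral>t. (coord (V t) k)\<^sup>2 \<partial>N) = (\<integral>t. (\<Sum>k<n. (coord (V t) k)\<^sup>2) \<partial>N)" using i by simp
    also have "\<dots> \<le> (L2_norm N V)\<^sup>2" unfolding L2_norm_sq
      using i V by (intro integral_mono sum_coord_le) auto
    finally show ?thesis .
  qed
  show s: "summable (\<lambda>k. \<integral>t. (coord (V t) k)\<^sup>2 \<partial>N)" by (rule summableI_nonneg_bounded[OF _ b]) simp
  show "(\<Sum>k. \<integral>t. (coord (V t) k)\<^sup>2 \<partial>N) \<le> (L2_norm N V)\<^sup>2" by (rule suminf_le_const[OF s b])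
qed

text \<open>
  The value \<open>0\<close> at points where the coordinates are not square summable is immaterial when these points
  form a null set.  The series of extended reals exhibits this set as measurable.
\<close>

definition ell2_of_coords :: "(nat \<Rightarrow> 'a \<Rightarrow> real) \<Rightarrow> 'a \<Rightarrow> ell2" where
  "ell2_of_coords w x = (if (\<Sum>k. ennreal ((w k x)\<^sup>2)) < \<infinity> then Ell2 (\<lambda>k. w k x) else 0)"

lemma summable_iff_ennreal:
  "(\<Sum>k. ennreal ((w k)\<^sup>2)) < \<infinity> \<longleftrightarrow> summable (\<lambda>k. (w k)\<^sup>2)" for w :: "nat \<Rightarrow> real"
proof
  assume "(\<Sum>k. ennreal ((w k)\<^sup>2)) < \<infinity>"
  then show "summable (\<lambda>k. (w k)\<^sup>2)" by (intro summable_suminf_not_top) auto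
next
  assume "summable (\<lambda>k. (w k)\<^sup>2)"
  then have "(\<Sum>k. ennreal ((w k)\<^sup>2)) = ennreal (\<Sum>k. (w k)\<^sup>2)" by (intro suminf_ennreal2) auto
  then show "(\<Sum>k. ennreal ((w k)\<^sup>2)) < \<infinity>" by simp
qed

lemma coord_ell2_of_coords:
  "coord (ell2_of_coords w x) k = (if summable (\<lambda>k. (w k x)\<^sup>2) then w k x else 0)"
  unfolding ell2_of_coords_def summable_iff_ennreal by (simp add: coord_Ell2 coord_zero)

lemma measurable_ell2_of_coords:
  assumes [measurable]: "\<And>k. w k \<in> borel_measurable N"
  shows "ell2_of_coords w \<in> borel_measurable N"
proof (rule ell2_borel_measurableI)
  fix k
  have "(\<lambda>x. if (\<Sum>k. ennreal ((w k x)\<^sup>2)) < \<infinity> then w k x else 0) \<in> borel_measurable N" by measurable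
  then show "(\<lambda>x. coord (ell2_of_coords w x) k) \<in> borel_measurable N"
    unfolding coord_ell2_of_coords summable_iff_ennreal .
qed

text \<open>
  By monotone convergence the weighted sum \<open>\<Sum>k. r * (w k)\<^sup>2\<close> is integrable, hence finite almost everywhere.
\<close>

lemma ell2_of_coords_weighted:
  assumes w: "\<And>k. w k \<in> borel_measurable N"
    and r: "\<And>x. x \<in> space N \<Longrightarrow> 0 < r x" "r \<in> borel_measurable N"
    and i: "\<And>k. integrable N (\<lambda>x. r x * (w k x)\<^sup>2)" and q: "\<And>k. (\<integral>x. r x * (w k x)\<^sup>2 \<partial>N) \<le> q k" and sq: "summable q"
  shows "AE x in N. summable (\<lambda>k. (w k x)\<^sup>2)"
    and "integrable N (\<lambda>x. r x * (norm (ell2_of_coords w x))\<^sup>2)"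
    and "(\<integral>x. r x * (norm (ell2_of_coords w x))\<^sup>2 \<partial>N) \<le> suminf q"
proof -
  have nn: "0 \<le> r x * (w k x)\<^sup>2" if "x \<in> space N" for x k using r(1)[OF that] by simp
  have s: "summable (\<lambda>k. \<integral>x. r x * (w k x)\<^sup>2 \<partial>N)"
    using q nn by (intro summable_comparison_test'[OF sq, of 0]) (simp add: integral_nonneg)
  have "(\<integral>\<^sup>+x. (\<Sum>k. ennreal (r x * (w k x)\<^sup>2)) \<partial>N) = (\<Sum>k. \<integral>\<^sup>+x. ennreal (r x * (w k x)\<^sup>2) \<partial>N)"
    using i by (intro nn_integral_suminf) auto
  also have "\<dots> = (\<Sum>k. ennreal (\<integral>x. r x * (w k x)\<^sup>2 \<partial>N))"
    using i nn by (intro suminf_cong nn_integral_eq_integral) auto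
  also have "\<dots> < \<infinity>" using s nn by (simp add: suminf_ennreal2 integral_nonneg)
  finally have "AE x in N. (\<Sum>k. ennreal (r x * (w k x)\<^sup>2)) \<noteq> \<infinity>"
    using i by (intro nn_integral_PInf_AE) auto
  then have ae: "AE x in N. summable (\<lambda>k. r x * (w k x)\<^sup>2)" using AE_space
  proof eventually_elim
    case (elim x)
    show ?case by (rule summable_suminf_not_top) (use elim nn in auto)
  qed
  then show ae': "AE x in N. summable (\<lambda>k. (w k x)\<^sup>2)" using AE_space
  proof eventually_elim
    case (elim x)
    from summable_mult[OF elim(1), of "inverse (r x)"] r(1)[OF elim(2)] show ?case
      by (simp add: mult.assoc[symmetric])
  qed
  have eq: "AE x in N. (\<Sum>k. r x * (w k x)\<^sup>2) = r x * (norm (ell2_of_coords w x))\<^sup>2" using ae'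
    by eventually_elim (simp add: norm_ell2_sq coord_ell2_of_coords suminf_mult)
  have ae2: "AE x in N. summable (\<lambda>k. norm (r x * (w k x)\<^sup>2))" using ae AE_space
    by eventually_elim (use nn in simp)
  have s2: "summable (\<lambda>k. \<integral>x. norm (r x * (w k x)\<^sup>2) \<partial>N)"
  proof -
    have "(\<integral>x. norm (r x * (w k x)\<^sup>2) \<partial>N) = (\<integral>x. r x * (w k x)\<^sup>2 \<partial>N)" for k
      using nn by (intro Bochner_Integration.integral_cong) auto
    then show ?thesis using s by simp
  qed
  \<comment> \<open>Sum and integral may now be exchanged for real-valued functions.\<close>
  note S = integrable_suminf[OF i ae2 s2] integral_suminf[OF i ae2 s2]
  have m: "(\<lambda>x. r x * (norm (ell2_of_coords w x))\<^sup>2) \<in> borel_measurable N"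
    using measurable_ell2_of_coords[OF w] r(2) by simp
  show "integrable N (\<lambda>x. r x * (norm (ell2_of_coords w x))\<^sup>2)"
    by (rule integrable_cong_AE_imp[OF S(1) m]) (use eq in \<open>auto elim!: eventually_mono\<close>)
  have "(\<integral>x. r x * (norm (ell2_of_coords w x))\<^sup>2 \<partial>N) = (\<integral>x. (\<Sum>k. r x * (w k x)\<^sup>2) \<partial>N)"
    using m S(1) eq by (intro integral_cong_AE) (auto elim!: eventually_mono)
  also have "\<dots> \<le> suminf q" unfolding S(2) by (intro suminf_le q s sq)
  finally show "(\<integral>x. r x * (norm (ell2_of_coords w x))\<^sup>2 \<partial>N) \<le> suminf q" .
qed

section \<open>The estimate for one mode\<close>

context time_interval
begin

definition weighted_sq :: "real \<Rightarrow> real \<Rightarrow> (real \<Rightarrow> real) \<Rightarrow> bool" where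
  "weighted_sq \<rho> c u \<longleftrightarrow> u \<in> borel_measurable M \<and> integrable M (\<lambda>t. t powr \<rho> * (u t)\<^sup>2) \<and>
     (\<integral>t. t powr \<rho> * (u t)\<^sup>2 \<partial>M) \<le> c"

lemma powr_measurable_M [measurable]: "(\<lambda>t. t powr \<rho>) \<in> borel_measurable M"
  by (intro continuous_imp_measurable_on_sets_lebesgue continuous_intros) auto

lemma weighted_sq_add:
  assumes "weighted_sq \<rho> c u" "weighted_sq \<rho> d w"
  shows "weighted_sq \<rho> (2 * c + 2 * d) (\<lambda>t. u t + w t)"
proof -
  have m[measurable]: "u \<in> borel_measurable M" "w \<in> borel_measurable M" using assms by (auto simp: weighted_sq_def)
  have i: "integrable M (\<lambda>t. t powr \<rho> * (u t)\<^sup>2)" "integrable M (\<lambda>t. t powr \<rho> * (w t)\<^sup>2)"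
    using assms by (auto simp: weighted_sq_def)
  have le: "t powr \<rho> * (u t + w t)\<^sup>2 \<le> 2 * (t powr \<rho> * (u t)\<^sup>2) + 2 * (t powr \<rho> * (w t)\<^sup>2)" for t
    using mult_left_mono[OF norm_add_sq_le[of "u t" "w t"], of "t powr \<rho>"] by (simp add: algebra_simps)
  have I: "integrable M (\<lambda>t. t powr \<rho> * (u t + w t)\<^sup>2)"
  proof (rule Bochner_Integration.integrable_bound)
    show "integrable M (\<lambda>t. 2 * (t powr \<rho> * (u t)\<^sup>2) + 2 * (t powr \<rho> * (w t)\<^sup>2))" using i by simp
    show "AE t in M. norm (t powr \<rho> * (u t + w t)\<^sup>2) \<le> norm (2 * (t powr \<rho> * (u t)\<^sup>2) + 2 * (t powr \<rho> * (w t)\<^sup>2))"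
      using le by (intro AE_I2) simp
  qed measurable
  have "(\<integral>t. t powr \<rho> * (u t + w t)\<^sup>2 \<partial>M) \<le> (\<integral>t. 2 * (t powr \<rho> * (u t)\<^sup>2) + 2 * (t powr \<rho> * (w t)\<^sup>2) \<partial>M)"
    using I i le by (intro integral_mono) auto
  also have "\<dots> \<le> 2 * c + 2 * d" using i assms by (simp add: weighted_sq_def)
  finally show ?thesis using I by (simp add: weighted_sq_def)
qed

lemma weighted_sq_cmult:
  assumes "weighted_sq \<rho> c u"
  shows "weighted_sq \<rho> (k\<^sup>2 * c) (\<lambda>t. k * u t)"
proof -
  have e: "t powr \<rho> * (k * u t)\<^sup>2 = k\<^sup>2 * (t powr \<rho> * (u t)\<^sup>2)" for t by (simp add: power_mult_distrib)
  show ?thesis using assms unfolding weighted_sq_def e by (auto intro: mult_left_mono)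
qed

lemma weighted_sq_power_bound:
  assumes u: "u \<in> borel_measurable M" and B: "0 \<le> B" and a: "0 < a"
    and le: "\<And>t. 0 < t \<Longrightarrow> t < T \<Longrightarrow> t powr \<rho> * (u t)\<^sup>2 \<le> B * t powr (a - 1)"
  shows "weighted_sq \<rho> (B * (T powr a / a)) u"
proof -
  note [measurable] = u
  have p: "integrable M (\<lambda>t. B * pow_kernel a t)" "(\<integral>t. pow_kernel a t \<partial>M) \<le> T powr a / a"
    using pow_kernel_integral(1)[OF a T, of 0] pow_kernel_integral(2)[OF a T, of 0] by auto
  have le': "t powr \<rho> * (u t)\<^sup>2 \<le> B * pow_kernel a t" if "t \<in> space M" for t
    using that le[of t] by (simp add: pow_kernel_def)
  have I: "integrable M (\<lambda>t. t powr \<rho> * (u t)\<^sup>2)"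
  proof (rule Bochner_Integration.integrable_bound[OF p(1)])
    show "AE t in M. norm (t powr \<rho> * (u t)\<^sup>2) \<le> norm (B * pow_kernel a t)"
    proof (rule AE_I2)
      fix t assume "t \<in> space M"
      then show "norm (t powr \<rho> * (u t)\<^sup>2) \<le> norm (B * pow_kernel a t)"
        using le'[of t] B by (simp add: pow_kernel_nonneg)
    qed
  qed measurable
  have "(\<integral>t. t powr \<rho> * (u t)\<^sup>2 \<partial>M) \<le> (\<integral>t. B * pow_kernel a t \<partial>M)" by (intro integral_mono I p le')
  also have "\<dots> \<le> B * (T powr a / a)" using mult_left_mono[OF p(2) B] by simp
  finally show ?thesis using I u by (simp add: weighted_sq_def)
qed

lemma ml_fun_measurable_M:
  assumes "1 < \<gamma>" "\<gamma> < 2"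
  shows "ml_fun \<gamma> \<mu> m \<in> borel_measurable M"
  using measurable_compose[OF id_measurable_lebesgue_on borel_measurable_ml_fun[OF assms]] by simp

text \<open>
  By \<open>\<bar>e\<^sub>\<mu>(t)\<bar> \<le> B * t powr (\<mu> - 1)\<close>, the square with the weight is at most a power of \<open>t\<close> with the
  exponent \<open>\<rho> + 2 * (\<mu> - 1)\<close>.  For \<open>\<mu> = \<gamma> - 2\<close> the condition reads \<open>\<rho> > 5 - 2 * \<gamma>\<close>.
\<close>

lemma ml_fun_weighted_sq:
  assumes g: "1 < \<gamma>" "\<gamma> < 2" and \<rho>: "- 1 < \<rho> + 2 * (\<mu> - 1)"
  obtains c where "0 \<le> c" "\<And>m. 0 \<le> m \<Longrightarrow> weighted_sq \<rho> c (ml_fun \<gamma> \<mu> m)"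
proof -
  obtain B where B: "0 < B" "\<And>m t. 0 \<le> m \<Longrightarrow> \<bar>ml_fun \<gamma> \<mu> m t\<bar> \<le> B * (if 0 < t then t powr (\<mu> - 1) else 0)"
    using ml_fun_bound'[OF g] by metis
  define a where "a = \<rho> + 2 * (\<mu> - 1) + 1"
  have a: "0 < a" using \<rho> by (simp add: a_def)
  show thesis
  proof (rule that)
    show "0 \<le> B\<^sup>2 * (T powr a / a)" using a by simp
    fix m :: real assume m: "0 \<le> m"
    show "weighted_sq \<rho> (B\<^sup>2 * (T powr a / a)) (ml_fun \<gamma> \<mu> m)"
    proof (rule weighted_sq_power_bound[OF ml_fun_measurable_M[OF g] _ a])
      fix t :: real assume t: "0 < t" "t < T"
      have "\<bar>ml_fun \<gamma> \<mu> m t\<bar>\<^sup>2 \<le> (B * t powr (\<mu> - 1))\<^sup>2"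
        using B(2)[OF m, of t] t by (intro power_mono) auto
      then have "t powr \<rho> * (ml_fun \<gamma> \<mu> m t)\<^sup>2 \<le> t powr \<rho> * (B * t powr (\<mu> - 1))\<^sup>2"
        by (intro mult_left_mono) auto
      also have "\<dots> = B\<^sup>2 * (t powr \<rho> * (t powr (\<mu> - 1) * t powr (\<mu> - 1)))"
        by (simp add: power_mult_distrib power2_eq_square)
      also have "t powr \<rho> * (t powr (\<mu> - 1) * t powr (\<mu> - 1)) = t powr (a - 1)"
        by (simp add: a_def algebra_simps flip: powr_add)
      finally show "t powr \<rho> * (ml_fun \<gamma> \<mu> m t)\<^sup>2 \<le> B\<^sup>2 * t powr (a - 1)" .
    qed simp
  qed
qed

text \<open>
  The decay in \<open>m * t powr \<gamma>\<close> compensates for the factor \<open>sqrt m\<close>: as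
  \<open>m * t powr \<gamma> / (1 + m * t powr \<gamma>)\<^sup>2 \<le> 1\<close>, the factor costs \<open>t powr (- \<gamma>)\<close> in the square, uniformly in \<open>m\<close>.
\<close>

lemma ml_fun_sqrt_weighted_sq:
  assumes g: "1 < \<gamma>" "\<gamma> < 2" and \<rho>: "- 1 < \<rho> + 2 * (\<mu> - 1) - \<gamma>"
  obtains c where "0 \<le> c" "\<And>m. 0 \<le> m \<Longrightarrow> weighted_sq \<rho> c (\<lambda>t. sqrt m * ml_fun \<gamma> \<mu> m t)"
proof -
  obtain B where B: "0 < B" "\<And>m t. 0 \<le> m \<Longrightarrow> 0 < t \<Longrightarrow> \<bar>ml_fun \<gamma> \<mu> m t\<bar> \<le> B * t powr (\<mu> - 1) / (1 + m * t powr \<gamma>)"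
    using ml_fun_bound[OF g] by metis
  define a where "a = \<rho> + 2 * (\<mu> - 1) - \<gamma> + 1"
  have a: "0 < a" using \<rho> by (simp add: a_def)
  show thesis
  proof (rule that)
    show "0 \<le> B\<^sup>2 * (T powr a / a)" using a by simp
    fix m :: real assume m: "0 \<le> m"
    show "weighted_sq \<rho> (B\<^sup>2 * (T powr a / a)) (\<lambda>t. sqrt m * ml_fun \<gamma> \<mu> m t)"
    proof (rule weighted_sq_power_bound[OF _ _ a])
      show "(\<lambda>t. sqrt m * ml_fun \<gamma> \<mu> m t) \<in> borel_measurable M" using ml_fun_measurable_M[OF g] by simp
      fix t :: real assume t: "0 < t" "t < T"
      let ?y = "m * t powr \<gamma>"
      have y: "0 \<le> ?y" using m by simp
      have "\<bar>ml_fun \<gamma> \<mu> m t\<bar>\<^sup>2 \<le> (B * t powr (\<mu> - 1) / (1 + ?y))\<^sup>2"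
        using B(2)[OF m t(1)] by (intro power_mono) auto
      then have "t powr \<rho> * (sqrt m * ml_fun \<gamma> \<mu> m t)\<^sup>2 \<le> t powr \<rho> * (m * (B * t powr (\<mu> - 1) / (1 + ?y))\<^sup>2)"
        using m by (auto simp: power_mult_distrib intro!: mult_left_mono)
      also have "\<dots> = (B\<^sup>2 * (t powr \<rho> * (t powr (\<mu> - 1) * t powr (\<mu> - 1)) * t powr (- \<gamma>))) * (?y / (1 + ?y)\<^sup>2)"
        using t by (simp add: power_mult_distrib power_divide power2_eq_square powr_minus field_simps)
      also have "\<dots> \<le> (B\<^sup>2 * (t powr \<rho> * (t powr (\<mu> - 1) * t powr (\<mu> - 1)) * t powr (- \<gamma>))) * 1"
      proof (rule mult_left_mono)
        have "?y \<le> (1 + ?y)\<^sup>2" using y unfolding power2_sum by simp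
        moreover have "0 < (1 + ?y)\<^sup>2" using y by simp
        ultimately show "?y / (1 + ?y)\<^sup>2 \<le> 1" by (simp add: divide_le_eq_1)
      qed simp
      also have "t powr \<rho> * (t powr (\<mu> - 1) * t powr (\<mu> - 1)) * t powr (- \<gamma>) = t powr (a - 1)"
        by (simp add: a_def algebra_simps flip: powr_add)
      finally show "t powr \<rho> * (sqrt m * ml_fun \<gamma> \<mu> m t)\<^sup>2 \<le> B\<^sup>2 * t powr (a - 1)" by simp
    qed simp
  qed
qed

lemma ml_fun_dominated:
  assumes g: "1 < \<gamma>" "\<gamma> < 2" and \<mu>: "0 < \<mu>"
  obtains B where "0 < B" "\<And>m. 0 \<le> m \<Longrightarrow> dominated_kernel B \<mu> (ml_fun \<gamma> \<mu> m)"
  using ml_fun_bound'[OF g, of \<mu>] borel_measurable_ml_fun[OF g, of \<mu>] \<mu>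
  unfolding dominated_kernel_def pow_kernel_def by (metis less_imp_le)

lemma primitive_kernel_ml_fun:
  assumes g: "1 < \<gamma>" "\<gamma> < 2" and \<mu>: "1 < \<mu>" and m: "0 \<le> m"
  shows "primitive_kernel (ml_fun \<gamma> \<mu> m) (ml_fun \<gamma> (\<mu> - 1) m)"
  unfolding primitive_kernel_def
proof (intro conjI allI impI)
  show "continuous_on UNIV (ml_fun \<gamma> \<mu> m)" by (rule continuous_on_ml_fun[OF g \<mu> m])
  show "\<exists>B a. dominated_kernel B a (ml_fun \<gamma> (\<mu> - 1) m)" "\<exists>B a. dominated_kernel B a (ml_fun \<gamma> \<mu> m)"
    using ml_fun_dominated[OF g, of "\<mu> - 1"] ml_fun_dominated[OF g, of \<mu>] \<mu> m by (smt (verit))+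
  fix x :: real assume "x \<noteq> 0"
  then consider "x < 0" | "0 < x" by linarith
  then show "(ml_fun \<gamma> \<mu> m has_real_derivative ml_fun \<gamma> (\<mu> - 1) m x) (at x)"
  proof cases
    case 1
    have "((\<lambda>x. 0) has_real_derivative ml_fun \<gamma> (\<mu> - 1) m x) (at x)" using 1 by simp
    then show ?thesis
      by (rule has_field_derivative_transform_within_open[where S = "{..<0}"]) (use 1 in auto)
  next
    case 2
    then show ?thesis by (rule ml_fun_has_derivative[OF g])
  qed
qed simp

lemma weak_derivative_pair_ml_fun:
  assumes "1 < \<gamma>" "\<gamma> < 2"
  shows "weak_derivative_pair (ml_fun \<gamma> \<mu> m) (ml_fun \<gamma> (\<mu> - 1) m)"
  by (rule weak_derivative_pair_smooth) (auto intro: ml_fun_has_derivative[OF assms] continuous_on_ml_fun_pos[OF assms])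

lemma weak_derivative_pair_ml_conv:
  assumes "1 < \<gamma>" "\<gamma> < 2" "1 < \<mu>" "0 \<le> m" "integrable M W"
  shows "weak_derivative_pair (conv T (ml_fun \<gamma> \<mu> m) W) (conv T (ml_fun \<gamma> (\<mu> - 1) m) W)"
  by (rule weak_derivative_pair_conv[OF primitive_kernel_ml_fun[OF assms(1-4)] assms(5)])

definition weak_H2 :: "(real \<Rightarrow> real) \<Rightarrow> (real \<Rightarrow> real) \<Rightarrow> (real \<Rightarrow> real) \<Rightarrow> bool" where
  "weak_H2 F W1 W2 \<longleftrightarrow> (\<forall>Y\<in>{F, W1, W2}. Y \<in> borel_measurable M \<and> integrable M (\<lambda>t. (Y t)\<^sup>2)) \<and>
     (\<forall>\<psi>. test \<psi> \<longrightarrow> (\<integral>t. deriv \<psi> t * F t \<partial>M) = - (\<integral>t. \<psi> t * W1 t \<partial>M)) \<and>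
     (\<forall>\<psi>. test \<psi> \<longrightarrow> (\<integral>t. deriv (deriv \<psi>) t * F t \<partial>M) = (\<integral>t. \<psi> t * W2 t \<partial>M))"

definition mode_energy :: "real \<Rightarrow> real \<Rightarrow> (real \<Rightarrow> real) \<Rightarrow> (real \<Rightarrow> real) \<Rightarrow> (real \<Rightarrow> real) \<Rightarrow> real" where
  "mode_energy p q F W1 W2 = p\<^sup>2 + q\<^sup>2 + (\<integral>t. (F t)\<^sup>2 \<partial>M) + (\<integral>t. (W1 t)\<^sup>2 \<partial>M) + (\<integral>t. (W2 t)\<^sup>2 \<partial>M)"

text \<open>
  The \<open>k\<close>-th coefficient of the solution times \<open>\<lambda>\<^sub>k powr (- s / 2)\<close>, for \<open>m = \<lambda>\<^sub>k powr s\<close>.  The parameters are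
  scaled accordingly: \<open>p = \<lambda>\<^sub>k powr (s / 2) * g\<^sub>k\<close>, \<open>q = h\<^sub>k\<close> and \<open>F = \<lambda>\<^sub>k powr (- s / 2) * f\<^sub>k\<close>, which are the
  coordinates of \<open>g \<in> \<bbbH>\<^sup>s\<close>, \<open>h \<in> L\<^sup>2\<close> and \<open>f(t) \<in> \<bbbH>\<^sup>-\<^sup>s\<close>.
\<close>

definition mode :: "real \<Rightarrow> real \<Rightarrow> real \<Rightarrow> real \<Rightarrow> (real \<Rightarrow> real) \<Rightarrow> real \<Rightarrow> real" where
  "mode \<gamma> m p q F t = p / m * ml_fun \<gamma> 1 m t + q / sqrt m * ml_fun \<gamma> 2 m t + conv T (ml_fun \<gamma> \<gamma> m) F t"

lemma mode_energy_ge: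
  "p\<^sup>2 \<le> mode_energy p q F W1 W2" "q\<^sup>2 \<le> mode_energy p q F W1 W2"
  "(\<integral>t. (F t)\<^sup>2 \<partial>M) \<le> mode_energy p q F W1 W2" "(\<integral>t. (W1 t)\<^sup>2 \<partial>M) \<le> mode_energy p q F W1 W2"
  "(\<integral>t. (W2 t)\<^sup>2 \<partial>M) \<le> mode_energy p q F W1 W2"
proof -
  have "0 \<le> (\<integral>t. (Y t)\<^sup>2 \<partial>M)" for Y :: "real \<Rightarrow> real" by simp
  from this[of F] this[of W1] this[of W2] show "p\<^sup>2 \<le> mode_energy p q F W1 W2" "q\<^sup>2 \<le> mode_energy p q F W1 W2"
  "(\<integral>t. (F t)\<^sup>2 \<partial>M) \<le> mode_energy p q F W1 W2" "(\<integral>t. (W1 t)\<^sup>2 \<partial>M) \<le> mode_energy p q F W1 W2"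
  "(\<integral>t. (W2 t)\<^sup>2 \<partial>M) \<le> mode_energy p q F W1 W2"
    unfolding mode_energy_def using zero_le_power2[of p] zero_le_power2[of q] by linarith+
qed

lemma ml_fun_Icc_bound:
  assumes g: "1 < \<gamma>" "\<gamma> < 2" and \<mu>: "1 \<le> \<mu>"
  obtains B where "0 \<le> B" "\<And>m t. 0 \<le> m \<Longrightarrow> t < T \<Longrightarrow> \<bar>ml_fun \<gamma> \<mu> m t\<bar> \<le> B"
proof -
  obtain B where B: "0 < B" "\<And>m t. 0 \<le> m \<Longrightarrow> \<bar>ml_fun \<gamma> \<mu> m t\<bar> \<le> B * (if 0 < t then t powr (\<mu> - 1) else 0)"
    using ml_fun_bound'[OF g] by metis
  show thesis
  proof (rule that)
    show "0 \<le> B * T powr (\<mu> - 1)" using B by simp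
    fix m t :: real assume "0 \<le> m" "t < T"
    then have "(if 0 < t then t powr (\<mu> - 1) else 0) \<le> T powr (\<mu> - 1)" using \<mu> by (auto intro: powr_mono2)
    from mult_left_mono[OF this, of B] B show "\<bar>ml_fun \<gamma> \<mu> m t\<bar> \<le> B * T powr (\<mu> - 1)"
      using B(2)[OF \<open>0 \<le> m\<close>, of t] by linarith
  qed
qed

text \<open>
  The functions \<open>e\<^sub>1\<close>, \<open>e\<^sub>2\<close> and \<open>e\<^sub>\<gamma>\<close> are bounded on the time interval uniformly in \<open>m\<close>; the lower bound \<open>m0\<close>
  controls the factors \<open>1 / m\<close> and \<open>1 / sqrt m\<close>.  Uniformity in \<open>t\<close> makes the series of the solution
  converge at every time.
\<close>

lemma mode_pointwise_bound:
  assumes g: "1 < \<gamma>" "\<gamma> < 2" and m0: "0 < m0"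
  obtains C where "0 \<le> C" "\<And>m p q F W1 W2 t. m0 \<le> m \<Longrightarrow> weak_H2 F W1 W2 \<Longrightarrow> t \<in> {0<..<T} \<Longrightarrow>
     (mode \<gamma> m p q F t)\<^sup>2 \<le> C * mode_energy p q F W1 W2"
proof -
  obtain B1 where B1: "0 \<le> B1" "\<And>m t. 0 \<le> m \<Longrightarrow> t < T \<Longrightarrow> \<bar>ml_fun \<gamma> 1 m t\<bar> \<le> B1"
    using ml_fun_Icc_bound[OF g, of 1] by auto
  obtain B2 where B2: "0 \<le> B2" "\<And>m t. 0 \<le> m \<Longrightarrow> t < T \<Longrightarrow> \<bar>ml_fun \<gamma> 2 m t\<bar> \<le> B2"
    using ml_fun_Icc_bound[OF g, of 2] by auto
  obtain B3 where B3: "0 \<le> B3" "\<And>m t. 0 \<le> m \<Longrightarrow> t < T \<Longrightarrow> \<bar>ml_fun \<gamma> \<gamma> m t\<bar> \<le> B3"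
    using ml_fun_Icc_bound[OF g, of \<gamma>] g by auto
  obtain D where D: "0 < D" "\<And>m. 0 \<le> m \<Longrightarrow> dominated_kernel D \<gamma> (ml_fun \<gamma> \<gamma> m)"
    using ml_fun_dominated[OF g, of \<gamma>] g by auto
  define \<kappa> where "\<kappa> = D * (T powr \<gamma> / \<gamma>)"
  have \<kappa>: "0 < \<kappa>" using D g T by (simp add: \<kappa>_def)
  let ?C = "4 * ((B1 / m0)\<^sup>2) + 4 * (B2\<^sup>2 / m0) + 2 * (\<kappa> * B3)"
  show thesis
  proof (rule that)
    show "0 \<le> ?C" using m0 \<kappa> B3 by simp
    fix m p q F W1 W2 t
    assume m: "m0 \<le> m" and H: "weak_H2 F W1 W2" and t: "t \<in> {0<..<T}"
    have m': "0 < m" using m m0 by simp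
    have F: "F \<in> borel_measurable M" "integrable M (\<lambda>t. (F t)\<^sup>2)" using H by (auto simp: weak_H2_def)
    let ?E = "mode_energy p q F W1 W2"
    have 1: "(p / m * ml_fun \<gamma> 1 m t)\<^sup>2 \<le> (B1 / m0)\<^sup>2 * ?E"
    proof -
      have "\<bar>p / m * ml_fun \<gamma> 1 m t\<bar> \<le> \<bar>p\<bar> / m0 * B1"
        unfolding abs_mult using B1(2)[of m t] t m m0 m'
        by (intro mult_mono) (auto simp: abs_divide intro: divide_left_mono)
      then have "\<bar>p / m * ml_fun \<gamma> 1 m t\<bar>\<^sup>2 \<le> (\<bar>p\<bar> / m0 * B1)\<^sup>2" by (intro power_mono) auto
      also have "\<dots> = (B1 / m0)\<^sup>2 * p\<^sup>2" by (simp add: power_mult_distrib power_divide)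
      also have "\<dots> \<le> (B1 / m0)\<^sup>2 * ?E" by (intro mult_left_mono mode_energy_ge) simp
      finally show ?thesis unfolding power2_abs .
    qed
    have 2: "(q / sqrt m * ml_fun \<gamma> 2 m t)\<^sup>2 \<le> B2\<^sup>2 / m0 * ?E"
    proof -
      have "\<bar>ml_fun \<gamma> 2 m t\<bar>\<^sup>2 \<le> B2\<^sup>2" using B2(2)[of m t] t m' by (intro power_mono) auto
      moreover have "q\<^sup>2 / m \<le> q\<^sup>2 / m0" using m m0 m' by (intro divide_left_mono) auto
      ultimately have "q\<^sup>2 / m * (ml_fun \<gamma> 2 m t)\<^sup>2 \<le> q\<^sup>2 / m0 * B2\<^sup>2"
        using m0 by (intro mult_mono) auto
      also have "\<dots> = B2\<^sup>2 / m0 * q\<^sup>2" by simp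
      also have "\<dots> \<le> B2\<^sup>2 / m0 * ?E" using m0 by (intro mult_left_mono mode_energy_ge) simp
      finally show ?thesis using m' by (simp add: power_mult_distrib power_divide)
    qed
    have 3: "(conv T (ml_fun \<gamma> \<gamma> m) F t)\<^sup>2 \<le> \<kappa> * B3 * ?E"
    proof -
      let ?K = "ml_fun \<gamma> \<gamma> m"
      have d: "dominated_kernel D \<gamma> ?K" using D m' by simp
      have bd: "\<bar>\<bar>?K (t - r)\<bar>\<bar> \<le> B3" if "r \<in> {0<..<T}" for r using B3(2)[of m "t - r"] t that m' by simp
      have i: "integrable M (\<lambda>r. \<bar>?K (t - r)\<bar> * (F r)\<^sup>2)"
        using kernel_integrable(3)[OF d, of t] by (intro integrable_mult_bounded[OF F(2) _ bd]) auto
      have "(conv T ?K F t)\<^sup>2 \<le> \<kappa> * (\<integral>r. \<bar>?K (t - r)\<bar> * (F r)\<^sup>2 \<partial>M)"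
        unfolding conv_def
        by (rule square_integral_le[OF kernel_integrable(3)[OF d] _ \<kappa> i F(1)])
          (use kernel_integrable(4)[OF d, of t] t in \<open>simp add: \<kappa>_def\<close>)
      also have "\<dots> \<le> \<kappa> * (\<integral>r. B3 * (F r)\<^sup>2 \<partial>M)"
        using i F \<kappa> bd by (intro mult_left_mono integral_mono mult_right_mono) auto
      also have "\<dots> = \<kappa> * B3 * (\<integral>r. (F r)\<^sup>2 \<partial>M)" by simp
      also have "\<dots> \<le> \<kappa> * B3 * ?E" using \<kappa> B3 by (intro mult_left_mono mode_energy_ge) simp
      finally show ?thesis .
    qed
    let ?x = "p / m * ml_fun \<gamma> 1 m t" and ?y = "q / sqrt m * ml_fun \<gamma> 2 m t" and ?z = "conv T (ml_fun \<gamma> \<gamma> m) F t"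
    have "(?x + ?y + ?z)\<^sup>2 \<le> 2 * (?x + ?y)\<^sup>2 + 2 * ?z\<^sup>2" using norm_add_sq_le[of "?x + ?y" ?z] unfolding real_norm_def power2_abs .
    moreover have "(?x + ?y)\<^sup>2 \<le> 2 * ?x\<^sup>2 + 2 * ?y\<^sup>2" using norm_add_sq_le[of ?x ?y] unfolding real_norm_def power2_abs .
    ultimately have "(?x + ?y + ?z)\<^sup>2 \<le> 4 * ((B1 / m0)\<^sup>2 * ?E) + 4 * (B2\<^sup>2 / m0 * ?E) + 2 * (\<kappa> * B3 * ?E)"
      using 1 2 3 by linarith
    then show "(mode \<gamma> m p q F t)\<^sup>2 \<le> ?C * ?E" by (simp add: mode_def algebra_simps)
  qed
qed

text \<open>
  All terms of the third derivative are bounded uniformly in \<open>m\<close>.  Of the four norms, \<open>c1\<close> to \<open>c4\<close>, the first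
  belongs to the most singular function, with the index \<open>\<gamma> - 2\<close>, and uses \<open>\<rho> > 5 - 2 * \<gamma>\<close> in full.
\<close>

lemma mode_third_derivative:
  assumes g: "1 < \<gamma>" "\<gamma> < 2" and \<rho>: "5 - 2 * \<gamma> < \<rho>"
  obtains C where "0 \<le> C" "\<And>m p q F W1 W2. 0 < m \<Longrightarrow> weak_H2 F W1 W2 \<Longrightarrow>
     \<exists>v3. weighted_sq \<rho> (C * mode_energy p q F W1 W2) v3 \<and>
       (\<forall>\<psi>. test \<psi> \<longrightarrow> (\<integral>t. (deriv ^^ 3) \<psi> t * mode \<gamma> m p q F t \<partial>M) = - (\<integral>t. \<psi> t * v3 t \<partial>M))"
proof -
  obtain c1 where c1: "0 \<le> c1" "\<And>m. 0 \<le> m \<Longrightarrow> weighted_sq \<rho> c1 (ml_fun \<gamma> (\<gamma> - 2) m)"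
    using ml_fun_weighted_sq[OF g, of \<rho> "\<gamma> - 2"] \<rho> by auto
  obtain c2 where c2: "0 \<le> c2" "\<And>m. 0 \<le> m \<Longrightarrow> weighted_sq \<rho> c2 (\<lambda>t. sqrt m * ml_fun \<gamma> (\<gamma> - 1) m t)"
    using ml_fun_sqrt_weighted_sq[OF g, of \<rho> "\<gamma> - 1"] \<rho> g by auto
  obtain c3 where c3: "0 \<le> c3" "\<And>m. 0 \<le> m \<Longrightarrow> weighted_sq \<rho> c3 (ml_fun \<gamma> (\<gamma> - 1) m)"
    using ml_fun_weighted_sq[OF g, of \<rho> "\<gamma> - 1"] \<rho> by auto
  obtain D where D: "0 < D" "\<And>m. 0 \<le> m \<Longrightarrow> dominated_kernel D (\<gamma> - 1) (ml_fun \<gamma> (\<gamma> - 1) m)"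
    using ml_fun_dominated[OF g, of "\<gamma> - 1"] g by auto
  obtain B where "0 \<le> B" and B: "\<And>m t. 0 \<le> m \<Longrightarrow> t < T \<Longrightarrow> \<bar>ml_fun \<gamma> \<gamma> m t\<bar> \<le> B"
    using ml_fun_Icc_bound[OF g, of \<gamma>] g by auto
  obtain B' where "0 \<le> B'" and B': "\<And>m t. 0 \<le> m \<Longrightarrow> t < T \<Longrightarrow> \<bar>ml_fun \<gamma> (\<gamma> + 1) m t\<bar> \<le> B'"
    using ml_fun_Icc_bound[OF g, of "\<gamma> + 1"] g by auto
  define c4 where "c4 = T powr \<rho> * (D * (T powr (\<gamma> - 1) / (\<gamma> - 1)))\<^sup>2"
  \<comment> \<open>The constant of the trace estimate for \<open>a = F(0)\<close> and \<open>b = F'(0)\<close>.\<close>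
  define k where "k = (2 + 2 * T\<^sup>2) / T"
  let ?C = "4 * c1 + 4 * c2 + 8 * (k * c1) + 8 * (k * c3) + 4 * c4"
  have k: "0 \<le> k" using T by (simp add: k_def)
  have c4: "0 \<le> c4" by (simp add: c4_def)
  show thesis
  proof (rule that)
    show "0 \<le> ?C" using c1 c2 c3 c4 k by simp
    fix m p q :: real and F W1 W2 :: "real \<Rightarrow> real" assume m: "0 < m" and H: "weak_H2 F W1 W2"
    let ?e = "\<lambda>\<mu>. ml_fun \<gamma> \<mu> m" and ?E = "mode_energy p q F W1 W2"
    have F: "F \<in> borel_measurable M" "integrable M (\<lambda>t. (F t)\<^sup>2)"
      and W1: "W1 \<in> borel_measurable M" "integrable M (\<lambda>t. (W1 t)\<^sup>2)"
      and W2: "W2 \<in> borel_measurable M" "integrable M (\<lambda>t. (W2 t)\<^sup>2)" using H by (auto simp: weak_H2_def)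
    note iF = square_integrable_imp_integrable[OF F] and i1 = square_integrable_imp_integrable[OF W1]
      and i2 = square_integrable_imp_integrable[OF W2]
    have d1: "(\<integral>t. deriv \<psi> t * F t \<partial>M) = - (\<integral>t. \<psi> t * W1 t \<partial>M)" if "test \<psi>" for \<psi>
      using H that by (simp add: weak_H2_def)
    have d2: "(\<integral>t. deriv \<psi> t * W1 t \<partial>M) = - (\<integral>t. \<psi> t * W2 t \<partial>M)" if "test \<psi>" for \<psi>
      using d1[OF test_deriv[OF that]] H that by (simp add: weak_H2_def)
    obtain a where a: "AE t in M. F t = a + conv T heaviside W1 t"
      using weak_derivative_imp_primitive[OF iF i1 d1] by blast
    obtain b where b: "AE t in M. W1 t = b + conv T heaviside W2 t"
      using weak_derivative_imp_primitive[OF i1 i2 d2] by blast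
    have a2: "a\<^sup>2 \<le> k * ?E"
    proof -
      have "T * a\<^sup>2 \<le> 2 * (\<integral>t. (F t)\<^sup>2 \<partial>M) + 2 * T\<^sup>2 * (\<integral>t. (W1 t)\<^sup>2 \<partial>M)"
        by (rule primitive_constant_bound[OF F W1 a])
      also have "\<dots> \<le> 2 * ?E + 2 * T\<^sup>2 * ?E" by (intro add_mono mult_left_mono mode_energy_ge) auto
      finally show ?thesis using T by (simp add: k_def field_simps)
    qed
    have b2: "b\<^sup>2 \<le> k * ?E"
    proof -
      have "T * b\<^sup>2 \<le> 2 * (\<integral>t. (W1 t)\<^sup>2 \<partial>M) + 2 * T\<^sup>2 * (\<integral>t. (W2 t)\<^sup>2 \<partial>M)"
        by (rule primitive_constant_bound[OF W1 W2 b])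
      also have "\<dots> \<le> 2 * ?E + 2 * T\<^sup>2 * ?E" by (intro add_mono mult_left_mono mode_energy_ge) auto
      finally show ?thesis using T by (simp add: k_def field_simps)
    qed
    \<comment> \<open>The primitives in \<open>F = a + H * (b + H * F'')\<close>, with the Heaviside function \<open>H\<close>, are passed on to the
      kernel.  Afterwards the kernel of the convolution has the index \<open>\<gamma> + 2\<close> and may be differentiated three
      times while remaining integrable.\<close>
    have rep: "mode \<gamma> m p q F t = (p / m * ?e 1 t + q / sqrt m * ?e 2 t) +
        ((a * ?e (\<gamma> + 1) t + b * ?e (\<gamma> + 2) t) + conv T (?e (\<gamma> + 2)) W2 t)" if t: "t \<in> {0<..<T}" for t
    proof -
      have K1: "primitive_kernel (?e (\<gamma> + 1)) (?e \<gamma>)" "primitive_kernel (?e (\<gamma> + 2)) (?e (\<gamma> + 1))"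
        using primitive_kernel_ml_fun[OF g, of "\<gamma> + 1" m] primitive_kernel_ml_fun[OF g, of "\<gamma> + 2" m] g m
        by (auto simp: add.commute)
      have "conv T (?e \<gamma>) F t = a * ?e (\<gamma> + 1) t + conv T (?e (\<gamma> + 1)) W1 t"
        using t m by (intro conv_of_primitive[OF K1(1) _ i1 F(1) a, of B] B) auto
      also have "conv T (?e (\<gamma> + 1)) W1 t = b * ?e (\<gamma> + 2) t + conv T (?e (\<gamma> + 2)) W2 t"
        using t m by (intro conv_of_primitive[OF K1(2) _ i2 W1(1) b, of B'] B') auto
      finally show ?thesis by (simp add: mode_def)
    qed
    \<comment> \<open>The \<open>j\<close>-th derivative of the mode: every index is lowered by \<open>j\<close>.\<close>
    define u where "u = (\<lambda>j t. (p / m * ?e (1 - j) t + q / sqrt m * ?e (2 - j) t) +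
        ((a * ?e (\<gamma> + 1 - j) t + b * ?e (\<gamma> + 2 - j) t) + conv T (?e (\<gamma> + 2 - j)) W2 t))"
    have wd: "weak_derivative_pair (u j) (u (j + 1))" if "j \<le> 2" for j
    proof -
      have s: "c - (j + 1) = c - j - 1" for c by simp
      have "1 < \<gamma> + 2 - j" using g that by simp
      then show ?thesis unfolding u_def s using g m
        by (intro weak_derivative_pair_add weak_derivative_pair_cmult weak_derivative_pair_ml_fun
          weak_derivative_pair_ml_conv i2) auto
    qed
    have "(\<integral>t. (deriv ^^ 3) \<psi> t * mode \<gamma> m p q F t \<partial>M) = - (\<integral>t. \<psi> t * u 3 t \<partial>M)" if \<psi>: "test \<psi>" for \<psi>
    proof -
      have "(\<integral>t. (deriv ^^ 3) \<psi> t * mode \<gamma> m p q F t \<partial>M) = (\<integral>t. (deriv ^^ 3) \<psi> t * u 0 t \<partial>M)"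
        by (rule Bochner_Integration.integral_cong) (auto simp: rep u_def)
      also have "\<dots> = - (\<integral>t. \<psi> t * u 3 t \<partial>M)"
      proof (rule weak_derivative_pair_3[OF _ _ _ \<psi>])
        show "weak_derivative_pair (u 0) (u 1)" "weak_derivative_pair (u 1) (u 2)" "weak_derivative_pair (u 2) (u 3)"
          using wd[of 0] wd[of 1] wd[of 2] by simp_all
      qed
      finally show ?thesis .
    qed
    moreover have "weighted_sq \<rho> (?C * ?E) (u 3)"
    proof -
      \<comment> \<open>At \<open>j = 3\<close> the data \<open>p\<close> and \<open>q\<close> carry the indices \<open>- 2\<close> and \<open>- 1\<close>, poles of \<open>\<Gamma>\<close>.\<close>
      have z: "rGamma (- 2 :: real) = 0" "rGamma (- 1 :: real) = 0"
        by (simp_all add: rGamma_eq_zero_iff)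
      have s: "?e (- 2) t = - m * ?e (\<gamma> - 2) t" "?e (- 1) t = - m * ?e (\<gamma> - 1) t" for t
        using ml_fun_shift[OF g z(1), of m t] ml_fun_shift[OF g z(2), of m t] by (simp_all add: add.commute)
      have u3: "u 3 = (\<lambda>t. (- p * ?e (\<gamma> - 2) t + - q * (sqrt m * ?e (\<gamma> - 1) t)) +
        ((a * ?e (\<gamma> - 2) t + b * ?e (\<gamma> - 1) t) + conv T (?e (\<gamma> - 1)) W2 t))"
      proof
        fix t
        have "p / m * ?e (- 2) t = - p * ?e (\<gamma> - 2) t" using m by (simp add: s)
        moreover have "q / sqrt m * ?e (- 1) t = - q * (sqrt m * ?e (\<gamma> - 1) t)"
        proof -
          have e: "m / sqrt m = sqrt m" using m by (simp add: real_div_sqrt)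
          have "q / sqrt m * ?e (- 1) t = - q * ((m / sqrt m) * ?e (\<gamma> - 1) t)" by (simp add: s)
          then show ?thesis by (simp only: e)
        qed
        ultimately show "u 3 t = (- p * ?e (\<gamma> - 2) t + - q * (sqrt m * ?e (\<gamma> - 1) t)) +
          ((a * ?e (\<gamma> - 2) t + b * ?e (\<gamma> - 1) t) + conv T (?e (\<gamma> - 1)) W2 t)"
          by (simp add: u_def)
      qed
      have cv: "weighted_sq \<rho> (c4 * (\<integral>t. (W2 t)\<^sup>2 \<partial>M)) (conv T (?e (\<gamma> - 1)) W2)"
      proof -
        have d: "dominated_kernel D (\<gamma> - 1) (?e (\<gamma> - 1))" using D m by simp
        let ?c = "conv T (?e (\<gamma> - 1)) W2"
        note Y = conv_square_integral[OF d W2 D(1)]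
        have [measurable]: "?c \<in> borel_measurable M" using conv_integrable[OF d i2] by simp
        have le: "t powr \<rho> * (?c t)\<^sup>2 \<le> T powr \<rho> * (?c t)\<^sup>2" if "t \<in> space M" for t
          using that g \<rho> by (intro mult_right_mono powr_mono2) auto
        have I: "integrable M (\<lambda>t. t powr \<rho> * (?c t)\<^sup>2)"
          by (rule Bochner_Integration.integrable_bound[OF integrable_mult_right[OF Y(1), of "T powr \<rho>"]])
            (use le in auto)
        have "(\<integral>t. t powr \<rho> * (?c t)\<^sup>2 \<partial>M) \<le> (\<integral>t. T powr \<rho> * (?c t)\<^sup>2 \<partial>M)"
          using I Y le by (intro integral_mono) auto
        also have "\<dots> = T powr \<rho> * (\<integral>t. (?c t)\<^sup>2 \<partial>M)" by simp
        also have "\<dots> \<le> T powr \<rho> * ((D * (T powr (\<gamma> - 1) / (\<gamma> - 1)))\<^sup>2 * (\<integral>t. (W2 t)\<^sup>2 \<partial>M))"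
          by (intro mult_left_mono Y) simp
        finally show ?thesis using I by (simp add: weighted_sq_def c4_def mult.assoc)
      qed
      have "weighted_sq \<rho> (2 * (2 * ((- p)\<^sup>2 * c1) + 2 * ((- q)\<^sup>2 * c2)) +
        2 * (2 * (2 * (a\<^sup>2 * c1) + 2 * (b\<^sup>2 * c3)) + 2 * (c4 * (\<integral>t. (W2 t)\<^sup>2 \<partial>M)))) (u 3)"
        unfolding u3 using m by (intro weighted_sq_add weighted_sq_cmult c1 c2 c3 cv) auto
      moreover have "2 * (2 * ((- p)\<^sup>2 * c1) + 2 * ((- q)\<^sup>2 * c2)) +
        2 * (2 * (2 * (a\<^sup>2 * c1) + 2 * (b\<^sup>2 * c3)) + 2 * (c4 * (\<integral>t. (W2 t)\<^sup>2 \<partial>M))) \<le> ?C * ?E"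
      proof -
        have "p\<^sup>2 * c1 \<le> ?E * c1" "q\<^sup>2 * c2 \<le> ?E * c2" "a\<^sup>2 * c1 \<le> k * ?E * c1" "b\<^sup>2 * c3 \<le> k * ?E * c3"
          "c4 * (\<integral>t. (W2 t)\<^sup>2 \<partial>M) \<le> c4 * ?E"
          by (intro mult_right_mono mult_left_mono mode_energy_ge a2 b2 c1 c2 c3 c4)+
        moreover have "?C * ?E = 4 * (?E * c1) + 4 * (?E * c2) + 8 * (k * ?E * c1) + 8 * (k * ?E * c3) + 4 * (c4 * ?E)"
          by (simp add: algebra_simps)
        ultimately show ?thesis by simp
      qed
      ultimately show ?thesis by (auto simp: weighted_sq_def)
    qed
    ultimately show "\<exists>v3. weighted_sq \<rho> (?C * ?E) v3 \<and>
       (\<forall>\<psi>. test \<psi> \<longrightarrow> (\<integral>t. (deriv ^^ 3) \<psi> t * mode \<gamma> m p q F t \<partial>M) = - (\<integral>t. \<psi> t * v3 t \<partial>M))"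
      by blast
  qed
qed

lemma mode_measurable:
  assumes g: "1 < \<gamma>" "\<gamma> < 2" and m: "0 < m" and H: "weak_H2 F W1 W2"
  shows "mode \<gamma> m p q F \<in> borel_measurable M"
proof -
  obtain D' where "0 < D'" "\<And>m. 0 \<le> m \<Longrightarrow> dominated_kernel D' \<gamma> (ml_fun \<gamma> \<gamma> m)"
    using ml_fun_dominated[OF g, of \<gamma>] g by auto
  with m have D: "dominated_kernel D' \<gamma> (ml_fun \<gamma> \<gamma> m)" by simp
  have "F \<in> borel_measurable M" "integrable M (\<lambda>t. (F t)\<^sup>2)" using H by (auto simp: weak_H2_def)
  then have "integrable M F" by (rule square_integrable_imp_integrable)
  from conv_integrable[OF D this] have "conv T (ml_fun \<gamma> \<gamma> m) F \<in> borel_measurable M" by simp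
  then have "(\<lambda>t. p / m * ml_fun \<gamma> 1 m t + q / sqrt m * ml_fun \<gamma> 2 m t + conv T (ml_fun \<gamma> \<gamma> m) F t) \<in> borel_measurable M"
    by (intro borel_measurable_add borel_measurable_times borel_measurable_const ml_fun_measurable_M[OF g])
  then show ?thesis by (simp add: mode_def[abs_def])
qed

end

section \<open>Summation over the modes\<close>

lemma HH_iff: "a \<in> HH lam r \<longleftrightarrow> summable (\<lambda>k. (lam k powr (r / 2) * a k)\<^sup>2)"
proof -
  have "(lam k powr (r / 2) * a k)\<^sup>2 = lam k powr r * \<bar>a k\<bar>\<^sup>2" for k
    by (simp add: power_mult_distrib power2_eq_square flip: powr_add)
  then show ?thesis by (simp only: HH_def mem_Collect_eq)
qed

lemma coord_HH_iso: "a \<in> HH lam r \<Longrightarrow> coord (HH_iso lam r a) k = lam k powr (r / 2) * a k"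
  by (simp add: HH_iff HH_iso_def coord_Ell2)

context time_interval
begin

lemma L2_imp_integrable:
  assumes "Y \<in> L2 M"
  shows "integrable M (Y :: real \<Rightarrow> ell2)"
proof (rule Bochner_Integration.integrable_bound)
  show "integrable M (\<lambda>t. 1 + (norm (Y t))\<^sup>2)" using assms by (simp add: L2_def)
  have "x \<le> 1 + x\<^sup>2" for x :: real
  proof -
    have "0 \<le> (x - 1)\<^sup>2 + x\<^sup>2 + 1" by simp
    then show ?thesis unfolding power2_diff by simp
  qed
  then show "AE t in M. norm (Y t) \<le> norm (1 + (norm (Y t))\<^sup>2)" by simp
qed (use assms in \<open>simp add: L2_def\<close>)

lemma test_scaleR_integrable:
  assumes "test \<psi>" "integrable M (Y :: real \<Rightarrow> ell2)"
  shows "integrable M (\<lambda>t. \<psi> t *\<^sub>R Y t)"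
proof -
  obtain C where C: "\<And>x. \<bar>\<psi> x\<bar> \<le> C" using test_bounded[OF assms(1)] by blast
  show ?thesis
  proof (rule Bochner_Integration.integrable_bound)
    show "integrable M (\<lambda>t. C * norm (Y t))" using assms(2) by simp
    show "(\<lambda>t. \<psi> t *\<^sub>R Y t) \<in> borel_measurable M"
      by (intro borel_measurable_scaleR test_measurable assms borel_measurable_integrable[OF assms(2)])
    have "\<bar>\<psi> t\<bar> * norm (Y t) \<le> \<bar>C\<bar> * norm (Y t)" for t using C[of t] by (intro mult_right_mono) auto
    then show "AE t in M. norm (\<psi> t *\<^sub>R Y t) \<le> norm (C * norm (Y t))" by (simp add: abs_mult)
  qed
qed

lemma coord_integral: "integrable M Y \<Longrightarrow> coord (\<integral>t. Y t \<partial>M) k = (\<integral>t. coord (Y t) k \<partial>M)"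
  by (rule integral_bounded_linear[OF bounded_linear_coord, symmetric])

lemma H2_coords:
  assumes "F \<in> H2 T"
  shows "weak_H2 (\<lambda>t. coord (F t) k) (\<lambda>t. coord (weak_deriv 1 T F t) k) (\<lambda>t. coord (weak_deriv 2 T F t) k)"
    and "F \<in> L2 M" "weak_deriv 1 T F \<in> L2 M" "weak_deriv 2 T F \<in> L2 M"
proof -
  show F: "F \<in> L2 M" using assms by (simp add: H2_def)
  have "\<exists>W. W \<in> L2 M \<and> has_weak_deriv 1 T F W" "\<exists>W. W \<in> L2 M \<and> has_weak_deriv 2 T F W"
    using assms by (auto simp: H2_def)
  from this[THEN someI_ex]
  have W1: "weak_deriv 1 T F \<in> L2 M" and d1: "has_weak_deriv 1 T F (weak_deriv 1 T F)"
    and W2: "weak_deriv 2 T F \<in> L2 M" and d2: "has_weak_deriv 2 T F (weak_deriv 2 T F)"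
    unfolding weak_deriv_def by blast+
  show "weak_deriv 1 T F \<in> L2 M" "weak_deriv 2 T F \<in> L2 M" by fact+
  have c: "(\<integral>t. \<psi> t * coord (Y t) k \<partial>M) = coord (\<integral>t. \<psi> t *\<^sub>R Y t \<partial>M) k" if "test \<psi>" "Y \<in> L2 M" for \<psi> Y
    using coord_integral[OF test_scaleR_integrable[OF that(1) L2_imp_integrable[OF that(2)]]]
    by (simp add: coord_scaleR)
  show "weak_H2 (\<lambda>t. coord (F t) k) (\<lambda>t. coord (weak_deriv 1 T F t) k) (\<lambda>t. coord (weak_deriv 2 T F t) k)"
    unfolding weak_H2_def
  proof (intro conjI allI impI)
    show "\<forall>Y\<in>{\<lambda>t. coord (F t) k, \<lambda>t. coord (weak_deriv 1 T F t) k, \<lambda>t. coord (weak_deriv 2 T F t) k}.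
        Y \<in> borel_measurable M \<and> integrable M (\<lambda>t. (Y t)\<^sup>2)"
      using coord_square_integrals(1)[OF F] coord_square_integrals(1)[OF W1] coord_square_integrals(1)[OF W2]
        coord_borel_measurable[of _ M] F W1 W2 by (auto simp: L2_def)
    fix \<psi> assume \<psi>: "test \<psi>"
    have "(\<integral>t. deriv \<psi> t *\<^sub>R F t \<partial>M) = - (\<integral>t. \<psi> t *\<^sub>R weak_deriv 1 T F t \<partial>M)"
      using d1 \<psi> by (simp add: has_weak_deriv_def)
    then show "(\<integral>t. deriv \<psi> t * coord (F t) k \<partial>M) = - (\<integral>t. \<psi> t * coord (weak_deriv 1 T F t) k \<partial>M)"
      by (simp add: c \<psi> test_deriv F W1 coord_uminus del: One_nat_def)
    have "(\<integral>t. deriv (deriv \<psi>) t *\<^sub>R F t \<partial>M) = (\<integral>t. \<psi> t *\<^sub>R weak_deriv 2 T F t \<partial>M)"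
      using d2 \<psi> unfolding has_weak_deriv_def by (simp add: numeral_2_eq_2)
    then show "(\<integral>t. deriv (deriv \<psi>) t * coord (F t) k \<partial>M) = (\<integral>t. \<psi> t * coord (weak_deriv 2 T F t) k \<partial>M)"
      by (simp add: c \<psi> test_deriv F W2)
  qed
qed

lemma borel_measurable_cong_AE_M:
  fixes f g :: "real \<Rightarrow> real"
  assumes f: "f \<in> borel_measurable M" and ae: "AE t in M. f t = g t"
  shows "g \<in> borel_measurable M"
proof -
  have S: "{0<..<T} \<in> sets lebesgue" by simp
  let ?r = "\<lambda>h t. if t \<in> {0<..<T} then h t else (0 :: real)"
  have "?r f \<in> borel_measurable lebesgue" using f borel_measurable_if[OF S, of f] by simp
  moreover have "AE t in lebesgue. ?r f t = ?r g t" using ae by (auto simp: AE_restrict_space_iff elim!: eventually_mono)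
  ultimately have "?r g \<in> borel_measurable lebesgue" by (rule borel_measurable_AE)
  then show ?thesis using borel_measurable_if[OF S, of g] by simp
qed

text \<open>
  The values \<open>f t\<close> lie in \<open>\<bbbH>\<^sup>-\<^sup>s\<close> for almost every \<open>t\<close> only, so that \<open>f r k\<close> and the coordinate of \<open>HH_iso\<close>
  agree under the integral up to a null set.
\<close>

lemma solution_eq_mode:
  assumes g: "1 < \<gamma>" "\<gamma> < 2" and lam: "0 < lam k" and t: "t \<in> {0<..<T}"
    and f: "HH_valued lam (- s) T f" and F: "(\<lambda>t. coord (HH_iso lam (- s) (f t)) k) \<in> borel_measurable M"
  shows "lam k powr (- s / 2) * solution lam s \<gamma> a b f t k =
    mode \<gamma> (lam k powr s) (lam k powr (s / 2) * a k) (b k) (\<lambda>t. coord (HH_iso lam (- s) (f t)) k) t"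
proof -
  let ?m = "lam k powr s" and ?l = "lam k powr (- s / 2)" and ?F = "\<lambda>t. coord (HH_iso lam (- s) (f t)) k"
  let ?K = "ml_fun \<gamma> \<gamma> (lam k powr s)"
  have sq: "sqrt ?m = lam k powr (s / 2)" using powr_half_sqrt[of ?m] by (simp add: powr_powr)
  have l1: "?l = 1 / sqrt ?m" unfolding sq using powr_minus_divide[of "lam k" "s / 2"] by simp
  have l2: "?l = lam k powr (s / 2) / ?m"
    using powr_diff[of "lam k" "s / 2" s] by simp
  have ae: "AE r in M. ?F r = ?l * f r k" using f unfolding HH_valued_def
    by eventually_elim (simp add: coord_HH_iso)
  have m2: "(\<lambda>r. ?l * f r k) \<in> borel_measurable M" by (rule borel_measurable_cong_AE_M[OF F ae])
  let ?g = "\<lambda>r. (t - r) powr (\<gamma> - 1) * mittag_leffler \<gamma> \<gamma> (- ?m * (t - r) powr \<gamma>) * f r k"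
  have "(\<integral>r. ?g r \<partial>lebesgue_on {0<..<t}) = (\<integral>r. (if r \<in> {0<..<t} then ?g r else 0) \<partial>lebesgue)"
    by (rule Lebesgue_Measure.integral_restrict_UNIV[symmetric]) simp
  also have "\<dots> = (\<integral>r. (if r \<in> {0<..<T} then ?K (t - r) * f r k else 0) \<partial>lebesgue)"
    using t by (intro Bochner_Integration.integral_cong refl) (auto simp: ml_fun_def)
  also have "\<dots> = (\<integral>r. ?K (t - r) * f r k \<partial>M)"
    by (rule Lebesgue_Measure.integral_restrict_UNIV) simp
  finally have A: "(\<integral>r. ?g r \<partial>lebesgue_on {0<..<t}) = (\<integral>r. ?K (t - r) * f r k \<partial>M)" .
  have "?l * (\<integral>r. ?g r \<partial>lebesgue_on {0<..<t}) = (\<integral>r. ?K (t - r) * (?l * f r k) \<partial>M)"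
    by (subst A) (simp only: integral_mult_right_zero[symmetric] mult.left_commute)
  also have "\<dots> = conv T ?K ?F t"
  proof -
    have K: "(\<lambda>r. ?K (t - r)) \<in> borel_measurable M"
      by (rule measurable_compose[OF _ borel_measurable_ml_fun[OF g]]) simp
    show ?thesis unfolding conv_def
    proof (rule integral_cong_AE)
      show "(\<lambda>r. ?K (t - r) * (?l * f r k)) \<in> borel_measurable M" "(\<lambda>r. ?K (t - r) * ?F r) \<in> borel_measurable M"
        by (rule borel_measurable_times[OF K m2], rule borel_measurable_times[OF K F])
      show "AE r in M. ?K (t - r) * (?l * f r k) = ?K (t - r) * ?F r" using ae
        by eventually_elim simp
    qed
  qed
  finally have "?l * (\<integral>r. ?g r \<partial>lebesgue_on {0<..<t}) = conv T ?K ?F t" .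
  moreover have "?l * (mittag_leffler \<gamma> 1 (- ?m * t powr \<gamma>) * a k) = lam k powr (s / 2) * a k / ?m * ml_fun \<gamma> 1 ?m t"
    using t unfolding l2 by (simp add: ml_fun_def)
  moreover have "?l * (t * mittag_leffler \<gamma> 2 (- ?m * t powr \<gamma>) * b k) = b k / sqrt ?m * ml_fun \<gamma> 2 ?m t"
    using t unfolding l1 by (simp add: ml_fun_def)
  ultimately show ?thesis unfolding solution_def mode_def by (simp only: distrib_left)
qed

lemma sum_squares_le_square_sum:
  fixes a b c :: real
  assumes "0 \<le> a" "0 \<le> b" "0 \<le> c"
  shows "a\<^sup>2 + b\<^sup>2 + c\<^sup>2 \<le> (a + b + c)\<^sup>2"
proof -
  have "0 \<le> a * b" "0 \<le> a * c" "0 \<le> b * c" using assms by auto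
  then show ?thesis by (simp add: power2_eq_square algebra_simps)
qed

text \<open>
  Each norm of the data is a norm of \<open>\<ell>\<^sup>2\<close>, or an integral of such norms over time, in which the sum over the
  modes may be taken last.
\<close>

lemma mode_energy_summable:
  fixes lam :: "nat \<Rightarrow> real"
  assumes lam: "\<And>k. 0 < lam k" and a: "a \<in> HH lam s" and b: "summable (\<lambda>k. (b k)\<^sup>2)" and F: "F \<in> H2 T"
  defines "E \<equiv> \<lambda>k. mode_energy (lam k powr (s / 2) * a k) (b k) (\<lambda>t. coord (F t) k)
    (\<lambda>t. coord (weak_deriv 1 T F t) k) (\<lambda>t. coord (weak_deriv 2 T F t) k)"
  shows "summable E" "suminf E \<le> (HH_norm lam s a + sqrt (\<Sum>k. (b k)\<^sup>2) + H2_norm T F)\<^sup>2" "\<And>k. 0 \<le> E k"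
proof -
  note cF = coord_square_integrals(2,3)[OF H2_coords(2)[OF F]] and c1 = coord_square_integrals(2,3)[OF H2_coords(3)[OF F]]
    and c2 = coord_square_integrals(2,3)[OF H2_coords(4)[OF F]]
  have a': "summable (\<lambda>k. (lam k powr (s / 2) * a k)\<^sup>2)" using a by (simp add: HH_iff)
  have e: "(lam k powr (s / 2) * a k)\<^sup>2 = lam k powr s * \<bar>a k\<bar>\<^sup>2" for k
    by (simp add: power_mult_distrib power2_eq_square flip: powr_add)
  have hh: "(\<Sum>k. (lam k powr (s / 2) * a k)\<^sup>2) = (HH_norm lam s a)\<^sup>2"
    using suminf_nonneg[OF a'] unfolding HH_norm_def e by simp
  have hb: "(\<Sum>k. (b k)\<^sup>2) = (sqrt (\<Sum>k. (b k)\<^sup>2))\<^sup>2" using suminf_nonneg[OF b] by simp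
  note S = summable_add[OF summable_add[OF summable_add[OF summable_add[OF a' b] cF(1)] c1(1)] c2(1)]
  show "summable E" using S by (simp add: E_def mode_energy_def)
  have "suminf E = (\<Sum>k. (lam k powr (s / 2) * a k)\<^sup>2) + (\<Sum>k. (b k)\<^sup>2) + (\<Sum>k. \<integral>t. (coord (F t) k)\<^sup>2 \<partial>M) +
      (\<Sum>k. \<integral>t. (coord (weak_deriv 1 T F t) k)\<^sup>2 \<partial>M) + (\<Sum>k. \<integral>t. (coord (weak_deriv 2 T F t) k)\<^sup>2 \<partial>M)"
    unfolding E_def mode_energy_def
    by (simp only: suminf_add[symmetric] a' b cF c1 c2 summable_add)
  also have "\<dots> \<le> (HH_norm lam s a)\<^sup>2 + (sqrt (\<Sum>k. (b k)\<^sup>2))\<^sup>2 + (H2_norm T F)\<^sup>2"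
  proof -
    have "(H2_norm T F)\<^sup>2 = (L2_norm M F)\<^sup>2 + (L2_norm M (weak_deriv 1 T F))\<^sup>2 + (L2_norm M (weak_deriv 2 T F))\<^sup>2"
      by (simp add: H2_norm_def)
    then show ?thesis using hh hb cF(2) c1(2) c2(2) by linarith
  qed
  also have "\<dots> \<le> (HH_norm lam s a + sqrt (\<Sum>k. (b k)\<^sup>2) + H2_norm T F)\<^sup>2"
    using suminf_nonneg[OF a'] suminf_nonneg[OF b]
    by (intro sum_squares_le_square_sum) (auto simp: HH_norm_def H2_norm_def e)
  finally show "suminf E \<le> (HH_norm lam s a + sqrt (\<Sum>k. (b k)\<^sup>2) + H2_norm T F)\<^sup>2" .
  show "0 \<le> E k" for k unfolding E_def mode_energy_def by simp
qed

text \<open>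
  The pointwise bound puts \<open>u(t)\<close> into \<open>\<bbbH>\<^sup>-\<^sup>s\<close> for every \<open>t\<close>, and the weighted bounds of the third derivatives
  sum to an \<open>\<ell>\<^sup>2\<close>-valued function.  Weak derivatives of vector-valued functions can be checked coordinatewise,
  and near the support of a test function the weight \<open>t powr \<rho>\<close> is bounded below.
\<close>

lemma third_derivative_estimate:
  fixes lam :: "nat \<Rightarrow> real"
  assumes g: "1 < \<gamma>" "\<gamma> < 2" and \<rho>: "5 - 2 * \<gamma> < \<rho>"
    and lam: "0 < l0" "\<And>k. l0 \<le> lam k" and s: "0 < s"
  obtains C where "0 \<le> C" "\<And>a b f. a \<in> HH lam s \<Longrightarrow> summable (\<lambda>k. (b k)\<^sup>2) \<Longrightarrow> HH_valued lam (- s) T f \<Longrightarrow>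
     (\<lambda>t. HH_iso lam (- s) (f t)) \<in> H2 T \<Longrightarrow>
     HH_valued lam (- s) T (solution lam s \<gamma> a b f) \<and>
     (\<exists>u3. HH_valued lam (- s) T u3 \<and>
       has_weak_deriv 3 T (\<lambda>t. HH_iso lam (- s) (solution lam s \<gamma> a b f t)) (\<lambda>t. HH_iso lam (- s) (u3 t)) \<and>
       (\<lambda>t. t powr (\<rho> / 2) *\<^sub>R HH_iso lam (- s) (u3 t)) \<in> L2 M \<and>
       L2_norm M (\<lambda>t. t powr (\<rho> / 2) *\<^sub>R HH_iso lam (- s) (u3 t)) \<le>
         C * (HH_norm lam s a + sqrt (\<Sum>k. (b k)\<^sup>2) + H2_norm T (\<lambda>t. HH_iso lam (- s) (f t))))"
proof -
  have lam0: "0 < lam k" for k using lam(1) lam(2)[of k] by linarith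
  have m0: "0 < l0 powr s" using lam by simp
  have mk: "l0 powr s \<le> lam k powr s" for k using lam s by (intro powr_mono2) auto
  obtain C1 where C1: "0 \<le> C1" "\<And>m p q F W1 W2 t. l0 powr s \<le> m \<Longrightarrow> weak_H2 F W1 W2 \<Longrightarrow> t \<in> {0<..<T} \<Longrightarrow>
     (mode \<gamma> m p q F t)\<^sup>2 \<le> C1 * mode_energy p q F W1 W2"
  proof (rule mode_pointwise_bound[OF g m0])
    fix C assume "0 \<le> C" "\<And>m p q F W1 W2 t. l0 powr s \<le> m \<Longrightarrow> weak_H2 F W1 W2 \<Longrightarrow> t \<in> {0<..<T} \<Longrightarrow>
      (mode \<gamma> m p q F t)\<^sup>2 \<le> C * mode_energy p q F W1 W2"
    then show thesis by (rule that)
  qed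
  obtain C2 where C2: "0 \<le> C2" "\<And>m p q F W1 W2. 0 < m \<Longrightarrow> weak_H2 F W1 W2 \<Longrightarrow>
     \<exists>v3. weighted_sq \<rho> (C2 * mode_energy p q F W1 W2) v3 \<and>
       (\<forall>\<psi>. test \<psi> \<longrightarrow> (\<integral>t. (deriv ^^ 3) \<psi> t * mode \<gamma> m p q F t \<partial>M) = - (\<integral>t. \<psi> t * v3 t \<partial>M))"
  proof (rule mode_third_derivative[OF g \<rho>])
    fix C assume "0 \<le> C" "\<And>m p q F W1 W2. 0 < m \<Longrightarrow> weak_H2 F W1 W2 \<Longrightarrow>
     \<exists>v3. weighted_sq \<rho> (C * mode_energy p q F W1 W2) v3 \<and>
       (\<forall>\<psi>. test \<psi> \<longrightarrow> (\<integral>t. (deriv ^^ 3) \<psi> t * mode \<gamma> m p q F t \<partial>M) = - (\<integral>t. \<psi> t * v3 t \<partial>M))"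
    then show thesis by (rule that)
  qed
  show thesis
  proof (rule that)
    show "0 \<le> sqrt C2" using C2 by simp
    fix a b f assume a: "a \<in> HH lam s" and b: "summable (\<lambda>k. (b k :: real)\<^sup>2)" and f: "HH_valued lam (- s) T f"
      and FH: "(\<lambda>t. HH_iso lam (- s) (f t)) \<in> H2 T"
    define F where "F = (\<lambda>t. HH_iso lam (- s) (f t))"
    note F = FH[folded F_def]
    let ?Fk = "\<lambda>k t. coord (F t) k" and ?W1 = "\<lambda>k t. coord (weak_deriv 1 T F t) k" and ?W2 = "\<lambda>k t. coord (weak_deriv 2 T F t) k"
    let ?p = "\<lambda>k. lam k powr (s / 2) * a k"
    define E where "E = (\<lambda>k. mode_energy (?p k) (b k) (?Fk k) (?W1 k) (?W2 k))"
    define v where "v = (\<lambda>k. mode \<gamma> (lam k powr s) (?p k) (b k) (?Fk k))"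
    let ?u = "solution lam s \<gamma> a b f"
    let ?V = "\<lambda>t. HH_iso lam (- s) (?u t)"
    note ES = mode_energy_summable[OF lam0 a b F, folded E_def]
    note H = H2_coords(1)[OF F]
    have mkp: "0 < lam k powr s" for k using lam0[of k] by simp
    have Fm: "?Fk k \<in> borel_measurable M" for k using H2_coords(2)[OF F] by (auto simp: L2_def intro: coord_borel_measurable)
    have uv: "lam k powr (- s / 2) * ?u t k = v k t" if "t \<in> {0<..<T}" for t k
      using solution_eq_mode[OF g lam0 that f Fm[unfolded F_def]] by (simp add: v_def F_def)
    have vb: "(v k t)\<^sup>2 \<le> C1 * E k" if "t \<in> {0<..<T}" for t k
      unfolding v_def E_def by (rule C1(2)[OF mk H that])
    have CE: "summable (\<lambda>k. C1 * E k)" by (rule summable_mult[OF ES(1)])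
    have uHH: "?u t \<in> HH lam (- s)" if t: "t \<in> {0<..<T}" for t
      unfolding HH_iff by (rule summable_comparison_test'[OF CE, of 0]) (use uv[OF t] vb[OF t] in auto)
    have cV: "coord (?V t) k = v k t" if "t \<in> {0<..<T}" for t k
      using uv[OF that] by (simp add: coord_HH_iso[OF uHH[OF that]])
    have vm: "v k \<in> borel_measurable M" for k unfolding v_def by (rule mode_measurable[OF g mkp H])
    have Vm: "?V \<in> borel_measurable M"
    proof (rule ell2_borel_measurableI)
      fix k
      have "(\<lambda>t. coord (?V t) k) \<in> borel_measurable M \<longleftrightarrow> v k \<in> borel_measurable M"
        by (rule measurable_cong) (simp add: cV)
      then show "(\<lambda>t. coord (?V t) k) \<in> borel_measurable M" using vm by simp
    qed
    have Vi: "integrable M ?V"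
    proof (rule M.integrable_const_bound[OF _ Vm])
      show "AE t in M. norm (?V t) \<le> sqrt (\<Sum>k. C1 * E k)"
      proof (rule AE_I2)
        fix t assume "t \<in> space M"
        then have t: "t \<in> {0<..<T}" by simp
        have "(norm (?V t))\<^sup>2 = (\<Sum>k. (v k t)\<^sup>2)" unfolding norm_ell2_sq cV[OF t] ..
        also have "\<dots> \<le> (\<Sum>k. C1 * E k)"
        proof (rule suminf_le[OF vb[OF t] _ CE])
          show "summable (\<lambda>k. (v k t)\<^sup>2)" using summable_coord[of "?V t"] by (simp only: cV[OF t])
        qed
        finally show "norm (?V t) \<le> sqrt (\<Sum>k. C1 * E k)" by (rule real_le_rsqrt)
      qed
    qed
    have "\<forall>k. \<exists>v3. weighted_sq \<rho> (C2 * E k) v3 \<and>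
       (\<forall>\<psi>. test \<psi> \<longrightarrow> (\<integral>t. (deriv ^^ 3) \<psi> t * v k t \<partial>M) = - (\<integral>t. \<psi> t * v3 t \<partial>M))"
      unfolding v_def E_def using C2(2)[OF mkp H] by blast
    then obtain v3 where v3: "\<And>k. weighted_sq \<rho> (C2 * E k) (v3 k)"
      "\<And>k \<psi>. test \<psi> \<Longrightarrow> (\<integral>t. (deriv ^^ 3) \<psi> t * v k t \<partial>M) = - (\<integral>t. \<psi> t * v3 k t \<partial>M)" by metis
    have v3m: "v3 k \<in> borel_measurable M" for k using v3(1) by (simp add: weighted_sq_def)
    \<comment> \<open>Undo the scaling by \<open>\<lambda>\<^sub>k powr (- s / 2)\<close>.  On the null set where the coordinates are not square
      summable, the value \<open>0\<close> keeps \<open>u3 t\<close> in \<open>\<bbbH>\<^sup>-\<^sup>s\<close>.\<close>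
    define u3 where "u3 = (\<lambda>t k. if summable (\<lambda>k. (v3 k t)\<^sup>2) then lam k powr (s / 2) * v3 k t else 0)"
    have ll: "lam k powr (- (s / 2)) * lam k powr (s / 2) = 1" for k using lam0[of k] by (simp flip: powr_add)
    have u3c: "lam k powr (- s / 2) * u3 t k = (if summable (\<lambda>k. (v3 k t)\<^sup>2) then v3 k t else 0)" for t k
      by (simp add: u3_def mult.assoc[symmetric] ll)
    have u3HH: "u3 t \<in> HH lam (- s)" for t
      unfolding HH_iff u3c by (cases "summable (\<lambda>k. (v3 k t)\<^sup>2)") auto
    let ?V3 = "ell2_of_coords v3"
    have V3: "HH_iso lam (- s) (u3 t) = ?V3 t" for t
      by (rule ell2_eqI) (simp only: coord_HH_iso[OF u3HH] u3c coord_ell2_of_coords)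
    note W = ell2_of_coords_weighted[of v3 M "\<lambda>t. t powr \<rho>" "\<lambda>k. C2 * E k"]
    have CE2: "summable (\<lambda>k. C2 * E k)" by (rule summable_mult[OF ES(1)])
    have ae: "AE t in M. summable (\<lambda>k. (v3 k t)\<^sup>2)"
      and wi: "integrable M (\<lambda>t. t powr \<rho> * (norm (?V3 t))\<^sup>2)"
      and wb: "(\<integral>t. t powr \<rho> * (norm (?V3 t))\<^sup>2 \<partial>M) \<le> (\<Sum>k. C2 * E k)"
      using v3(1) CE2 by (intro W; force simp: weighted_sq_def)+
    have V3m: "?V3 \<in> borel_measurable M" by (rule measurable_ell2_of_coords[OF v3m])
    have ind: "(indicator {c..d} :: real \<Rightarrow> real) \<in> borel_measurable M" for c d
      using measurable_compose[OF id_measurable_lebesgue_on borel_measurable_indicator[of "{c..d}" borel]] by simp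
    \<comment> \<open>Away from \<open>t = 0\<close> the weight is bounded below by \<open>c powr \<rho>\<close>, so the third derivative is locally
      integrable.\<close>
    have loc: "integrable M (\<lambda>t. indicator {c..d} t *\<^sub>R ?V3 t)" if "0 < c" for c d
    proof (rule Bochner_Integration.integrable_bound)
      show "integrable M (\<lambda>t. 1 + c powr (- \<rho>) * (t powr \<rho> * (norm (?V3 t))\<^sup>2))" using wi by simp
      show "(\<lambda>t. indicator {c..d} t *\<^sub>R ?V3 t) \<in> borel_measurable M"
        by (intro borel_measurable_scaleR ind V3m)
      have "norm (indicator {c..d} t *\<^sub>R ?V3 t) \<le> 1 + c powr (- \<rho>) * (t powr \<rho> * (norm (?V3 t))\<^sup>2)" for t
      proof (cases "t \<in> {c..d}")
        case True
        let ?n = "norm (?V3 t)"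
        have "1 \<le> c powr (- \<rho>) * t powr \<rho>"
        proof -
          have "c powr \<rho> \<le> t powr \<rho>" using True that g \<rho> by (intro powr_mono2) auto
          then have "c powr (- \<rho>) * c powr \<rho> \<le> c powr (- \<rho>) * t powr \<rho>" by (intro mult_left_mono) auto
          then show ?thesis using that by (simp flip: powr_add)
        qed
        then have "1 * ?n\<^sup>2 \<le> c powr (- \<rho>) * t powr \<rho> * ?n\<^sup>2" by (intro mult_right_mono) auto
        moreover have "?n \<le> 1 + ?n\<^sup>2"
        proof -
          have "0 \<le> (?n - 1)\<^sup>2 + ?n\<^sup>2 + 1" by simp
          then show ?thesis unfolding power2_diff by simp
        qed
        ultimately show ?thesis using True by (simp add: mult.assoc)
      qed simp
      then show "AE t in M. norm (indicator {c..d} t *\<^sub>R ?V3 t) \<le> norm (1 + c powr (- \<rho>) * (t powr \<rho> * (norm (?V3 t))\<^sup>2))"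
        by (intro AE_I2) (auto intro: order_trans[OF _ abs_ge_self])
    qed
    have si: "set_integrable lebesgue {c..d} Y" if "0 < c" "d < T" "integrable M (\<lambda>t. indicator {c..d} t *\<^sub>R Y t)"
      for c d and Y :: "real \<Rightarrow> ell2"
    proof -
      have "integrable lebesgue (\<lambda>t. indicator {0<..<T} t *\<^sub>R (indicator {c..d} t *\<^sub>R Y t))"
        using that(3) by (simp add: integrable_restrict_space)
      also have "(\<lambda>t. indicator {0<..<T} t *\<^sub>R (indicator {c..d} t *\<^sub>R Y t)) = (\<lambda>t. indicator {c..d} t *\<^sub>R Y t)"
        using that(1,2) by (auto simp: indicator_def fun_eq_iff)
      finally show ?thesis by (simp add: set_integrable_def)
    qed
    have Vloc: "integrable M (\<lambda>t. indicator {c..d} t *\<^sub>R ?V t)" for c d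
      by (rule Bochner_Integration.integrable_bound[OF Vi borel_measurable_scaleR[OF ind Vm]])
        (auto simp: indicator_def)
    have weak: "has_weak_deriv 3 T ?V ?V3"
      unfolding has_weak_deriv_def
    proof (intro conjI allI impI)
      fix c d :: real assume "0 < c \<and> d < T"
      then show "set_integrable lebesgue {c..d} ?V" "set_integrable lebesgue {c..d} ?V3"
        using si[OF _ _ Vloc] si[OF _ _ loc] by auto
    next
      fix \<psi> assume \<psi>: "test \<psi>"
      obtain c d where cd: "0 < c" "d < T" "\<And>x. x \<notin> {c..d} \<Longrightarrow> \<psi> x = 0" using test_support[OF \<psi>] by blast
      have \<psi>3: "test ((deriv ^^ 3) \<psi>)" by (simp add: numeral_3_eq_3 test_deriv \<psi>)
      have "integrable M (\<lambda>t. \<psi> t *\<^sub>R (indicator {c..d} t *\<^sub>R ?V3 t))"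
        by (rule test_scaleR_integrable[OF \<psi> loc[OF cd(1)]])
      also have "(\<lambda>t. \<psi> t *\<^sub>R (indicator {c..d} t *\<^sub>R ?V3 t)) = (\<lambda>t. \<psi> t *\<^sub>R ?V3 t)"
        using cd(3) by (auto simp: indicator_def fun_eq_iff)
      finally have i3: "integrable M (\<lambda>t. \<psi> t *\<^sub>R ?V3 t)" .
      show "(\<integral>t. (deriv ^^ 3) \<psi> t *\<^sub>R ?V t \<partial>M) = (- 1) ^ 3 *\<^sub>R (\<integral>t. \<psi> t *\<^sub>R ?V3 t \<partial>M)"
      proof (rule ell2_eqI)
        fix k
        have "coord (\<integral>t. (deriv ^^ 3) \<psi> t *\<^sub>R ?V t \<partial>M) k = (\<integral>t. (deriv ^^ 3) \<psi> t * coord (?V t) k \<partial>M)"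
          using coord_integral[OF test_scaleR_integrable[OF \<psi>3 Vi]] by (simp add: coord_scaleR)
        also have "\<dots> = (\<integral>t. (deriv ^^ 3) \<psi> t * v k t \<partial>M)"
          by (rule Bochner_Integration.integral_cong) (auto simp: cV)
        also have "\<dots> = - (\<integral>t. \<psi> t * v3 k t \<partial>M)" by (rule v3(2)[OF \<psi>])
        also have "(\<integral>t. \<psi> t * v3 k t \<partial>M) = (\<integral>t. \<psi> t * coord (?V3 t) k \<partial>M)"
        proof (rule integral_cong_AE)
          show "(\<lambda>t. \<psi> t * v3 k t) \<in> borel_measurable M" "(\<lambda>t. \<psi> t * coord (?V3 t) k) \<in> borel_measurable M"
            by (intro borel_measurable_times test_measurable \<psi> v3m coord_borel_measurable V3m)+
          show "AE t in M. \<psi> t * v3 k t = \<psi> t * coord (?V3 t) k" using ae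
            by eventually_elim (simp add: coord_ell2_of_coords)
        qed
        also have "\<dots> = coord (\<integral>t. \<psi> t *\<^sub>R ?V3 t \<partial>M) k"
          using coord_integral[OF i3] by (simp add: coord_scaleR)
        finally show "coord (\<integral>t. (deriv ^^ 3) \<psi> t *\<^sub>R ?V t \<partial>M) k = coord ((- 1) ^ 3 *\<^sub>R (\<integral>t. \<psi> t *\<^sub>R ?V3 t \<partial>M)) k"
          by (simp add: coord_scaleR coord_uminus)
      qed
    qed
    have sqn: "(norm (t powr (\<rho> / 2) *\<^sub>R ?V3 t))\<^sup>2 = t powr \<rho> * (norm (?V3 t))\<^sup>2" for t
      by (simp add: power_mult_distrib power2_eq_square[of "t powr _"] flip: powr_add)
    have inL2: "(\<lambda>t. t powr (\<rho> / 2) *\<^sub>R ?V3 t) \<in> L2 M"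
      unfolding L2_def mem_Collect_eq sqn using wi
      by (auto intro!: borel_measurable_scaleR V3m powr_measurable_M)
    let ?S = "HH_norm lam s a + sqrt (\<Sum>k. (b k)\<^sup>2) + H2_norm T F"
    have S0: "0 \<le> ?S" using suminf_nonneg[OF b] a
      by (auto simp: HH_norm_def H2_norm_def HH_def intro!: add_nonneg_nonneg suminf_nonneg)
    have "L2_norm M (\<lambda>t. t powr (\<rho> / 2) *\<^sub>R ?V3 t) \<le> sqrt (C2 * ?S\<^sup>2)"
      unfolding L2_norm_def sqn
    proof (rule real_sqrt_le_mono)
      have "(\<Sum>k. C2 * E k) = C2 * suminf E" by (rule suminf_mult[OF ES(1)])
      also have "\<dots> \<le> C2 * ?S\<^sup>2" by (intro mult_left_mono ES C2)
      finally show "(\<integral>t. t powr \<rho> * (norm (?V3 t))\<^sup>2 \<partial>M) \<le> C2 * ?S\<^sup>2" using wb by linarith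
    qed
    also have "\<dots> = sqrt C2 * ?S" using S0 by (simp add: real_sqrt_mult)
    finally have est: "L2_norm M (\<lambda>t. t powr (\<rho> / 2) *\<^sub>R ?V3 t) \<le> sqrt C2 * ?S" .
    have "HH_valued lam (- s) T ?u" "HH_valued lam (- s) T u3"
      unfolding HH_valued_def by (auto intro!: AE_I2 uHH u3HH)
    then show "HH_valued lam (- s) T ?u \<and>
     (\<exists>u3. HH_valued lam (- s) T u3 \<and> has_weak_deriv 3 T ?V (\<lambda>t. HH_iso lam (- s) (u3 t)) \<and>
       (\<lambda>t. t powr (\<rho> / 2) *\<^sub>R HH_iso lam (- s) (u3 t)) \<in> L2 M \<and>
       L2_norm M (\<lambda>t. t powr (\<rho> / 2) *\<^sub>R HH_iso lam (- s) (u3 t)) \<le>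
         sqrt C2 * (HH_norm lam s a + sqrt (\<Sum>k. (b k)\<^sup>2) + H2_norm T (\<lambda>t. HH_iso lam (- s) (f t))))"
      using weak inL2 est by (intro conjI exI[of _ u3]) (simp_all add: V3 F_def)
  qed
qed

end

theorem theorem4p2:
  fixes \<Omega> :: "(real^'n) set"
    and A :: "real^'n \<Rightarrow> real^'n^'n"
    and c :: "real^'n \<Rightarrow> real"
    and lam :: "nat \<Rightarrow> real"
    and \<phi> :: "nat \<Rightarrow> real^'n \<Rightarrow> real"
    and s T :: real
  assumes "open \<Omega>" "bounded \<Omega>" "convex \<Omega>"
    and "\<exists>L. L-lipschitz_on \<Omega> A"
    and "\<forall>x\<in>\<Omega>. transpose (A x) = A x"
    and "\<exists>\<alpha>>0. \<forall>x\<in>\<Omega>. \<forall>\<xi>. \<xi> \<bullet> (A x *v \<xi>) \<ge> \<alpha> * (norm \<xi>)\<^sup>2"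
    and "c \<in> borel_measurable (lebesgue_on \<Omega>)"
    and "\<exists>K. AE x in lebesgue_on \<Omega>. 0 \<le> c x \<and> c x \<le> K"
    and "\<forall>k. 0 < lam k"
    and "\<forall>k. eigenpair \<Omega> A c (lam k) (\<phi> k)"
    and "orthonormal_basis \<Omega> \<phi>"
    and "0 < s" "s < 1" "0 < T"
  shows "\<exists>C :: real \<Rightarrow> real \<Rightarrow> real.
    (\<forall>\<gamma> \<rho>. 1 < \<gamma> \<and> \<gamma> < 2 \<and> \<rho> > 5 - 2 * \<gamma> \<longrightarrow>
      (\<forall>g h f. g \<in> HH_fun \<Omega> \<phi> lam s \<longrightarrow>
         h \<in> L2 (lebesgue_on \<Omega>) \<longrightarrow>
         HH_valued lam (- s) T f \<and> (\<lambda>t. HH_iso lam (- s) (f t)) \<in> H2 T \<longrightarrow>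
         (let u = solution lam s \<gamma> (fourier_coeff \<Omega> \<phi> g) (fourier_coeff \<Omega> \<phi> h) f in
            HH_valued lam (- s) T u \<and>
            (\<exists>u3. HH_valued lam (- s) T u3 \<and>
               has_weak_deriv 3 T (\<lambda>t. HH_iso lam (- s) (u t)) (\<lambda>t. HH_iso lam (- s) (u3 t)) \<and>
               (\<lambda>t. t powr (\<rho> / 2) *\<^sub>R HH_iso lam (- s) (u3 t)) \<in> L2 (lebesgue_on {0<..<T}) \<and>
               L2_norm (lebesgue_on {0<..<T}) (\<lambda>t. t powr (\<rho> / 2) *\<^sub>R HH_iso lam (- s) (u3 t))
                 \<le> C \<gamma> \<rho> * (HH_norm lam s (fourier_coeff \<Omega> \<phi> g) + L2_norm (lebesgue_on \<Omega>) h +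
                     H2_norm T (\<lambda>t. HH_iso lam (- s) (f t))))))) \<and>
    (\<forall>M. \<forall>\<^sub>F \<gamma> in at_right 1. \<forall>\<rho> > 5 - 2 * \<gamma>. M \<le> C \<gamma> \<rho>)"
proof -
  interpret time_interval T by standard (rule assms(14))
  obtain \<alpha> where \<alpha>: "0 < \<alpha>" "\<forall>x\<in>\<Omega>. \<forall>\<xi>. \<xi> \<bullet> (A x *v \<xi>) \<ge> \<alpha> * (norm \<xi>)\<^sup>2" using assms(6) by blast
  obtain K where K: "AE x in lebesgue_on \<Omega>. 0 \<le> c x \<and> c x \<le> K" using assms(8) by blast
  obtain l0 where l0: "0 < l0"
    "\<And>\<mu> w. 0 < \<mu> \<Longrightarrow> eigenpair \<Omega> A c \<mu> w \<Longrightarrow> (\<integral>x. w x * w x \<partial>lebesgue_on \<Omega>) = 1 \<Longrightarrow> l0 \<le> \<mu>"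
    using eigenvalue_lower_bound[OF assms(1,2) \<alpha> K] by blast
  have lam: "l0 \<le> lam k" for k
    using assms(9,10,11) by (intro l0(2)) (auto simp: orthonormal_basis_def)
  define P where "P = (\<lambda>\<gamma> \<rho> C. 0 \<le> C \<and> (\<forall>a b f. a \<in> HH lam s \<longrightarrow> summable (\<lambda>k. (b k)\<^sup>2) \<longrightarrow> HH_valued lam (- s) T f \<longrightarrow>
     (\<lambda>t. HH_iso lam (- s) (f t)) \<in> H2 T \<longrightarrow>
     HH_valued lam (- s) T (solution lam s \<gamma> a b f) \<and>
     (\<exists>u3. HH_valued lam (- s) T u3 \<and>
       has_weak_deriv 3 T (\<lambda>t. HH_iso lam (- s) (solution lam s \<gamma> a b f t)) (\<lambda>t. HH_iso lam (- s) (u3 t)) \<and>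
       (\<lambda>t. t powr (\<rho> / 2) *\<^sub>R HH_iso lam (- s) (u3 t)) \<in> L2 M \<and>
       L2_norm M (\<lambda>t. t powr (\<rho> / 2) *\<^sub>R HH_iso lam (- s) (u3 t)) \<le>
         C * (HH_norm lam s a + sqrt (\<Sum>k. (b k)\<^sup>2) + H2_norm T (\<lambda>t. HH_iso lam (- s) (f t))))))"
  have "\<exists>C. P \<gamma> \<rho> C" if "1 < \<gamma>" "\<gamma> < 2" "5 - 2 * \<gamma> < \<rho>" for \<gamma> \<rho>
    by (rule third_derivative_estimate[where lam = lam, OF that l0(1) lam assms(12)]) (unfold P_def, blast)
  then obtain C0 where C0: "\<And>\<gamma> \<rho>. 1 < \<gamma> \<Longrightarrow> \<gamma> < 2 \<Longrightarrow> 5 - 2 * \<gamma> < \<rho> \<Longrightarrow> P \<gamma> \<rho> (C0 \<gamma> \<rho>)" by metis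
  \<comment> \<open>The estimate persists for larger constants.  The summand \<open>1 / (\<gamma> - 1)\<close>, which is the rate at which the
    integral of \<open>t powr (\<gamma> - 2)\<close> grows, makes the chosen constant unbounded as \<open>\<gamma>\<close> decreases to \<open>1\<close>.\<close>
  define C where "C = (\<lambda>\<gamma> \<rho>. max 0 (C0 \<gamma> \<rho>) + 1 / (\<gamma> - 1 :: real))"
  show ?thesis
  proof (intro exI[of _ C] conjI allI impI)
    fix \<gamma> \<rho> :: real and g h :: "real^'n \<Rightarrow> real" and f :: "real \<Rightarrow> nat \<Rightarrow> real"
    assume gr: "1 < \<gamma> \<and> \<gamma> < 2 \<and> 5 - 2 * \<gamma> < \<rho>" and g: "g \<in> HH_fun \<Omega> \<phi> lam s" and h: "h \<in> L2 (lebesgue_on \<Omega>)"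
      and f: "HH_valued lam (- s) T f \<and> (\<lambda>t. HH_iso lam (- s) (f t)) \<in> H2 T"
    let ?a = "fourier_coeff \<Omega> \<phi> g" and ?b = "fourier_coeff \<Omega> \<phi> h" and ?F = "\<lambda>t. HH_iso lam (- s) (f t)"
    let ?u = "solution lam s \<gamma> ?a ?b f"
    note B = Bessel_inequality[OF assms(11) h]
    have a: "?a \<in> HH lam s" using g by (simp add: HH_fun_def)
    have Pg: "P \<gamma> \<rho> (C0 \<gamma> \<rho>)" using C0 gr by blast
    then have C0p: "0 \<le> C0 \<gamma> \<rho>" by (simp add: P_def)
    obtain u3 where u: "HH_valued lam (- s) T ?u" and u3: "HH_valued lam (- s) T u3"
      "has_weak_deriv 3 T (\<lambda>t. HH_iso lam (- s) (?u t)) (\<lambda>t. HH_iso lam (- s) (u3 t))"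
      "(\<lambda>t. t powr (\<rho> / 2) *\<^sub>R HH_iso lam (- s) (u3 t)) \<in> L2 M"
      "L2_norm M (\<lambda>t. t powr (\<rho> / 2) *\<^sub>R HH_iso lam (- s) (u3 t)) \<le>
        C0 \<gamma> \<rho> * (HH_norm lam s ?a + sqrt (\<Sum>k. (?b k)\<^sup>2) + H2_norm T ?F)"
      using Pg a B(1) f unfolding P_def by blast
    have "sqrt (\<Sum>k. (?b k)\<^sup>2) \<le> L2_norm (lebesgue_on \<Omega>) h"
      using B(2) by (intro real_le_lsqrt) (auto simp: L2_norm_def)
    then have "C0 \<gamma> \<rho> * (HH_norm lam s ?a + sqrt (\<Sum>k. (?b k)\<^sup>2) + H2_norm T ?F) \<le>
        C0 \<gamma> \<rho> * (HH_norm lam s ?a + L2_norm (lebesgue_on \<Omega>) h + H2_norm T ?F)"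
      using C0p by (intro mult_left_mono) auto
    also have "\<dots> \<le> C \<gamma> \<rho> * (HH_norm lam s ?a + L2_norm (lebesgue_on \<Omega>) h + H2_norm T ?F)"
    proof (rule mult_right_mono)
      show "C0 \<gamma> \<rho> \<le> C \<gamma> \<rho>" using C0p gr by (simp add: C_def)
      show "0 \<le> HH_norm lam s ?a + L2_norm (lebesgue_on \<Omega>) h + H2_norm T ?F"
        using a by (auto simp: HH_norm_def HH_def L2_norm_def H2_norm_def intro!: add_nonneg_nonneg suminf_nonneg)
    qed
    finally have "L2_norm M (\<lambda>t. t powr (\<rho> / 2) *\<^sub>R HH_iso lam (- s) (u3 t)) \<le>
        C \<gamma> \<rho> * (HH_norm lam s ?a + L2_norm (lebesgue_on \<Omega>) h + H2_norm T ?F)" using u3(4) by linarith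
    then show "let u = ?u in HH_valued lam (- s) T u \<and>
        (\<exists>u3. HH_valued lam (- s) T u3 \<and>
           has_weak_deriv 3 T (\<lambda>t. HH_iso lam (- s) (u t)) (\<lambda>t. HH_iso lam (- s) (u3 t)) \<and>
           (\<lambda>t. t powr (\<rho> / 2) *\<^sub>R HH_iso lam (- s) (u3 t)) \<in> L2 M \<and>
           L2_norm M (\<lambda>t. t powr (\<rho> / 2) *\<^sub>R HH_iso lam (- s) (u3 t))
             \<le> C \<gamma> \<rho> * (HH_norm lam s ?a + L2_norm (lebesgue_on \<Omega>) h + H2_norm T ?F))"
      unfolding Let_def using u u3 by blast
  next
    fix N :: real
    show "\<forall>\<^sub>F \<gamma> in at_right 1. \<forall>\<rho>>5 - 2 * \<gamma>. N \<le> C \<gamma> \<rho>"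
    proof (rule eventually_at_rightI[of 1 "1 + 1 / (\<bar>N\<bar> + 1)"])
      fix \<gamma> assume \<gamma>: "\<gamma> \<in> {1<..<1 + 1 / (\<bar>N\<bar> + 1)}"
      then have "1 / (1 / (\<bar>N\<bar> + 1)) \<le> 1 / (\<gamma> - 1)" by (intro divide_left_mono mult_pos_pos) auto
      then show "\<forall>\<rho>>5 - 2 * \<gamma>. N \<le> C \<gamma> \<rho>" by (auto simp: C_def)
    qed simp
  qed
qed

end
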